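(* Let $1\le p_0<p<q_0\le\infty$, let $\mathcal S\subset\mathcal D$ be a sparse family, and let $(w,\sigma)$ be a pair of weights. Put $$u:=w^{\frac{p_0}{p_0-p}},\qquad v:=\sigma^{\frac{q_0'}{q_0'-p'}},$$ which are assumed to be weights (locally integrable). Let $\mathcal N\in[0,\infty]$ be the best constant such that $$\sum_{Q\in\mathcal S}\langle |f|^{p_0}\rangle_Q^{\frac1{p_0}}\,\langle |g|^{q_0'}\rangle_Q^{\frac1{q_0'}}\,|Q|\le \mathcal N\,\|f\|_{L^p(w)}\,\|g\|_{L^{p'}(\sigma)}$$ holds for all $f\in L^p(w)$ and $g\in L^{p'}(\sigma)$. Let $\phi,\psi:[1/2,\infty)\to(0,\infty)$ be increasing functions such that $$\int_{1/2}^\infty\Big(\frac1{\phi(t)}+\frac1{\psi(t)}\Big)\frac{dt}t<\infty .$$ Then $$\mathcal N\lesssim [v,u]_{(A_r)(\phi(A_\infty))}+[u,v]_{(A_{r'})(\psi(A_\infty))} .$$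
   Context: Setting: $(X,d)$ is a locally compact separable metric space equipped with a doubling Borel measure $\mu$, finite on compact sets and strictly positive on nonempty open sets. Write $|E|:=\mu(E)$ and $dx$ for $d\mu$. $\mathcal D$ is a fixed dyadic system on $X$: $\mathcal D=\bigcup_{k\in\mathbb Z}\mathcal D_k$, where each $\mathcal D_k$ is a countable partition of $X$ into Borel sets ("cubes"), any two cubes are either disjoint or nested (with $\mathcal D_{k+1}$ refining $\mathcal D_k$), and, for some fixed $\delta\in(0,1)$ and $0<c\le C<\infty$, each $Q\in\mathcal D_k$ has a point $z_Q$ with $B(z_Q,c\delta^k)\subset Q\subset B(z_Q,C\delta^k)$. (On $\mathbb R^n$ with Lebesgue measure one may take the usual dyadic cubes.) A family $\mathcal S\subset\mathcal D$ is sparse if $\big|\bigcup_{Q'\in\mathcal S,\,Q'\subsetneq Q}Q'\big|\le\frac12|Q|$ for every $Q\in\mathcal S$. A weight is a locally integrable, a.e. positive function; for a weight $w$, $w(E):=\int_E w\,dx$ and $\|f\|_{L^p(w)}=(\int|f|^p w\,dx)^{1/p}$. Averages: $\langle h\rangle_Q:=\frac1{|Q|}\int_Q h\,dx$. For an exponent $t$, $t'$ is its conjugate exponent, $1/t+1/t'=1$, with $1/\infty=0$ and $\infty'=1$. Definitions. $r:=\big(\frac{q_0}p\big)'\big(\frac p{p_0}-1\big)+1$. For a cube $Q$, $$A_r(v,u,Q):=\langle v\rangle_Q^{\frac1p-\frac1{q_0}}\langle u\rangle_Q^{(\frac1p-\frac1{q_0})(r-1)},\qquad A_{r'}(u,v,Q):=\langle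 u\rangle_Q^{\frac1{p'}-\frac1{p_0'}}\langle v\rangle_Q^{(\frac1{p'}-\frac1{p_0'})(r'-1)},$$ $$A_\infty(v,Q):=\frac1{v(Q)}\int_Q M(v\mathbf 1_Q)\,dx,$$ where $M$ is the Hardy–Littlewood maximal operator $Mh(x)=\sup_{B\ni x}\frac1{|B|}\int_B|h|$ over balls (so $A_\infty(v,Q)\ge1$). Finally $$[v,u]_{(A_r)(\phi(A_\infty))}:=\sup_Q A_r(v,u,Q)\,A_\infty(v,Q)^{\frac1{p'}}\,\phi(A_\infty(v,Q)),$$ $$[u,v]_{(A_{r'})(\psi(A_\infty))}:=\sup_Q A_{r'}(u,v,Q)\,A_\infty(u,Q)^{\frac1p}\,\psi(A_\infty(u,Q)),$$ with suprema over all cubes $Q$ (an expression is $+\infty$ when its $A_\infty(\cdot,Q)$ factor is $+\infty$). The notation $a\lesssim b$ means $a\le Cb$ with $C$ independent of $w,\sigma,\mathcal S$ (it may depend on $p_0,q_0,p,\phi,\psi$ and the underlying space). *)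

theory Defs
  imports "HOL-Analysis.Analysis"
begin

section \<open>Exponents and extended arithmetic\<close>

text \<open>With \<open>inverse 0 = \<infinity>\<close> and \<open>inverse \<infinity> = 0\<close> this covers \<open>1' = \<infinity>\<close> and
  \<open>\<infinity>' = 1\<close>; see \<open>conj_exp_eq\<close> and \<open>conj_exp_ennreal\<close>.\<close>

definition conj_exp :: "ennreal \<Rightarrow> ennreal" where
  "conj_exp t = inverse (1 - inverse t)"

lemma inverse_inverse_ennreal: "inverse (inverse x) = (x :: ennreal)"
proof (cases x)
  case (real r)
  show ?thesis
  proof (cases "r = 0")
    case False
    with real have "0 < r" by simp
    then show ?thesis using real by (simp add: inverse_ennreal)
  qed (use real in simp)
qed simp

lemma inverse_le_one_ennreal:
  fixes t :: ennreal
  assumes "1 \<le> t"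
  shows "inverse t \<le> 1"
proof (cases t)
  case (real r)
  with assms have "1 \<le> r" by simp
  then have "inverse r \<le> 1" by (simp add: field_simps)
  with real \<open>1 \<le> r\<close> show ?thesis by (simp add: inverse_ennreal)
qed simp

lemma conj_exp_eq:
  assumes "1 \<le> t"
  shows "inverse t + inverse (conj_exp t) = 1"
  using inverse_le_one_ennreal[OF assms]
  by (simp add: conj_exp_def inverse_inverse_ennreal add_diff_inverse_ennreal)

lemma conj_exp_one: "conj_exp 1 = \<infinity>"
  by (simp add: conj_exp_def)

lemma conj_exp_infinity: "conj_exp \<infinity> = 1"
  by (simp add: conj_exp_def)

lemma conj_exp_ennreal:
  assumes "1 < t"
  shows "conj_exp (ennreal t) = ennreal (t / (t - 1))"
proof -
  have "1 - inverse (ennreal t) = ennreal (1 - inverse t)"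
    using assms by (simp add: inverse_ennreal ennreal_minus flip: ennreal_1)
  moreover have "0 < 1 - inverse t"
    using assms by (simp add: field_simps)
  moreover have "inverse (1 - inverse t) = t / (t - 1)"
    using assms by (simp add: field_simps)
  ultimately show ?thesis
    by (simp add: conj_exp_def inverse_ennreal)
qed

text \<open>Powers of elements of \<open>[0,\<infinity>]\<close>, meant for exponents \<open>a > 0\<close> only.\<close>

definition epowr :: "ennreal \<Rightarrow> real \<Rightarrow> ennreal"  (infixr \<open>epowr\<close> 80) where
  "x epowr a = (if x = \<infinity> then \<infinity> else ennreal (enn2real x powr a))"


section \<open>The underlying space\<close>

definition doubling :: "'a::metric_space measure \<Rightarrow> bool" where
  "doubling \<mu> \<longleftrightarrow>
     (\<exists>A::real. \<forall>x r. 0 < r \<longrightarrow> emeasure \<mu> (ball x (2 * r)) \<le> ennreal A * emeasure \<mu> (ball x r))"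

definition admissible_measure :: "'a::metric_space measure \<Rightarrow> bool" where
  "admissible_measure \<mu> \<longleftrightarrow>
     sets \<mu> = sets borel \<and> doubling \<mu> \<and>
     (\<forall>K. compact K \<longrightarrow> emeasure \<mu> K < \<infinity>) \<and>
     (\<forall>U. open U \<longrightarrow> U \<noteq> {} \<longrightarrow> 0 < emeasure \<mu> U)"

text \<open>A dyadic system is given by its generations \<open>D k\<close>, \<open>k \<in> \<int>\<close>; the same set may belong to
  several generations, and \<open>cubes D\<close> counts it once.\<close>

definition cubes :: "(int \<Rightarrow> 'a set set) \<Rightarrow> 'a set set" where
  "cubes D = (\<Union>k. D k)"

definition dyadic_system :: "(int \<Rightarrow> 'a::metric_space set set) \<Rightarrow> bool" where
  "dyadic_system D \<longleftrightarrow>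
     (\<forall>k. countable (D k) \<and> partition_on UNIV (D k) \<and> D k \<subseteq> sets borel) \<and>
     (\<forall>Q\<in>cubes D. \<forall>Q'\<in>cubes D. Q \<inter> Q' = {} \<or> Q \<subseteq> Q' \<or> Q' \<subseteq> Q) \<and>
     (\<forall>k. \<forall>Q\<in>D (k + 1). \<exists>Q'\<in>D k. Q \<subseteq> Q') \<and>
     (\<exists>\<delta> c C. 0 < \<delta> \<and> \<delta> < 1 \<and> 0 < c \<and> c \<le> C \<and>
        (\<forall>k. \<forall>Q\<in>D k. \<exists>z. ball z (c * \<delta> powi k) \<subseteq> Q \<and> Q \<subseteq> ball z (C * \<delta> powi k)))"

definition sparse_family :: "'a measure \<Rightarrow> 'a set set \<Rightarrow> bool" where
  "sparse_family \<mu> S \<longleftrightarrow>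
     (\<forall>Q\<in>S. emeasure \<mu> (\<Union>{Q'\<in>S. Q' \<subset> Q}) \<le> emeasure \<mu> Q / 2)"


section \<open>Weights, averages and the maximal operator\<close>

text \<open>Local integrability means integrability on compact sets. The space need not be proper, so a
  weight may have infinite mass on a cube.\<close>

definition is_weight :: "'a::metric_space measure \<Rightarrow> ('a \<Rightarrow> real) \<Rightarrow> bool" where
  "is_weight \<mu> w \<longleftrightarrow>
     w \<in> borel_measurable \<mu> \<and> (\<forall>K. compact K \<longrightarrow> set_integrable \<mu> K w) \<and> (AE x in \<mu>. 0 < w x)"

text \<open>\<open>mass \<mu> w E\<close>, \<open>avg \<mu> h Q\<close> and \<open>Lp_norm\<close> are only applied to functions that are nonnegative
  almost everywhere (respectively to weights \<open>w\<close>), so that \<open>ennreal\<close> loses nothing.\<close>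

definition mass :: "'a measure \<Rightarrow> ('a \<Rightarrow> real) \<Rightarrow> 'a set \<Rightarrow> ennreal" where
  "mass \<mu> w E = (\<integral>\<^sup>+x\<in>E. ennreal (w x) \<partial>\<mu>)"

definition avg :: "'a measure \<Rightarrow> ('a \<Rightarrow> real) \<Rightarrow> 'a set \<Rightarrow> ennreal" where
  "avg \<mu> h Q = (\<integral>\<^sup>+x\<in>Q. ennreal (h x) \<partial>\<mu>) / emeasure \<mu> Q"

definition Lp_norm :: "'a measure \<Rightarrow> real \<Rightarrow> ('a \<Rightarrow> real) \<Rightarrow> ('a \<Rightarrow> real) \<Rightarrow> ennreal" where
  "Lp_norm \<mu> p w f = (\<integral>\<^sup>+x. ennreal (\<bar>f x\<bar> powr p * w x) \<partial>\<mu>) epowr (1 / p)"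

definition Lp_space :: "'a measure \<Rightarrow> real \<Rightarrow> ('a \<Rightarrow> real) \<Rightarrow> ('a \<Rightarrow> real) set" where
  "Lp_space \<mu> p w = {f \<in> borel_measurable \<mu>. Lp_norm \<mu> p w f < \<infinity>}"

definition hl_maximal :: "'a::metric_space measure \<Rightarrow> ('a \<Rightarrow> real) \<Rightarrow> 'a \<Rightarrow> ennreal" where
  "hl_maximal \<mu> h x =
     (SUP B\<in>{ball y s | y s. 0 < s \<and> x \<in> ball y s}. avg \<mu> (\<lambda>z. \<bar>h z\<bar>) B)"


section \<open>Characteristics of a pair of weights\<close>

text \<open>If \<open>v(Q) = \<infinity>\<close>, the quotient would be \<open>\<infinity>/\<infinity>\<close>, which is \<open>0\<close> for \<^typ>\<open>ennreal\<close>; the value is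
  \<open>\<infinity>\<close> instead.\<close>

definition A_infty :: "'a::metric_space measure \<Rightarrow> ('a \<Rightarrow> real) \<Rightarrow> 'a set \<Rightarrow> ennreal" where
  "A_infty \<mu> v Q =
     (if mass \<mu> v Q = \<infinity> then \<infinity>
      else (\<integral>\<^sup>+x\<in>Q. hl_maximal \<mu> (\<lambda>y. v y * indicator Q y) x \<partial>\<mu>) / mass \<mu> v Q)"

text \<open>The exponents satisfy \<open>1 \<le> p0 < p < q0 \<le> \<infinity>\<close>. The conjugates \<open>p'\<close>, \<open>q0'\<close>, \<open>(q0/p)'\<close> and \<open>r'\<close> are
  finite, hence reals; \<open>q0\<close> and \<open>p0'\<close> may be infinite and enter through their reciprocals.\<close>

definition rconj :: "ennreal \<Rightarrow> real" where
  "rconj t = enn2real (conj_exp t)"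

definition recip :: "ennreal \<Rightarrow> real" where
  "recip t = enn2real (inverse t)"

definition r_exp :: "real \<Rightarrow> real \<Rightarrow> ennreal \<Rightarrow> real" where
  "r_exp p0 p q0 = rconj (q0 / ennreal p) * (p / p0 - 1) + 1"

definition A_r ::
  "'a measure \<Rightarrow> real \<Rightarrow> real \<Rightarrow> ennreal \<Rightarrow> ('a \<Rightarrow> real) \<Rightarrow> ('a \<Rightarrow> real) \<Rightarrow> 'a set \<Rightarrow> ennreal" where
  "A_r \<mu> p0 p q0 v u Q =
     avg \<mu> v Q epowr (1 / p - recip q0) *
     avg \<mu> u Q epowr ((1 / p - recip q0) * (r_exp p0 p q0 - 1))"

definition A_r' ::
  "'a measure \<Rightarrow> real \<Rightarrow> real \<Rightarrow> ennreal \<Rightarrow> ('a \<Rightarrow> real) \<Rightarrow> ('a \<Rightarrow> real) \<Rightarrow> 'a set \<Rightarrow> ennreal" where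
  "A_r' \<mu> p0 p q0 u v Q =
     (let e = 1 / rconj (ennreal p) - recip (conj_exp (ennreal p0));
          r' = rconj (ennreal (r_exp p0 p q0))
      in avg \<mu> u Q epowr e * avg \<mu> v Q epowr (e * (r' - 1)))"

text \<open>\<open>a * A_infty(Q) powr s * \<phi>(A_infty(Q))\<close>, where \<open>\<phi>\<close> is only given on finite arguments.\<close>

definition bumped ::
  "'a::metric_space measure \<Rightarrow> real \<Rightarrow> (real \<Rightarrow> real) \<Rightarrow> ('a \<Rightarrow> real) \<Rightarrow> 'a set \<Rightarrow> ennreal \<Rightarrow> ennreal" where
  "bumped \<mu> s \<phi> v Q a =
     (if A_infty \<mu> v Q = \<infinity> then \<infinity>
      else a * A_infty \<mu> v Q epowr s * ennreal (\<phi> (enn2real (A_infty \<mu> v Q))))"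

definition char_r where
  "char_r \<mu> D p0 p q0 \<phi> v u =
     (SUP Q\<in>cubes D. bumped \<mu> (1 / rconj (ennreal p)) \<phi> v Q (A_r \<mu> p0 p q0 v u Q))"

definition char_r' where
  "char_r' \<mu> D p0 p q0 \<psi> u v =
     (SUP Q\<in>cubes D. bumped \<mu> (1 / p) \<psi> u Q (A_r' \<mu> p0 p q0 u v Q))"


section \<open>The sparse form\<close>

definition sparse_form ::
  "'a measure \<Rightarrow> 'a set set \<Rightarrow> real \<Rightarrow> real \<Rightarrow> ('a \<Rightarrow> real) \<Rightarrow> ('a \<Rightarrow> real) \<Rightarrow> ennreal" where
  "sparse_form \<mu> S a b f g =
     (\<Sum>\<^sub>\<infinity>Q\<in>S. avg \<mu> (\<lambda>x. \<bar>f x\<bar> powr a) Q epowr (1 / a) *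
              avg \<mu> (\<lambda>x. \<bar>g x\<bar> powr b) Q epowr (1 / b) * emeasure \<mu> Q)"

definition best_constant ::
  "'a measure \<Rightarrow> 'a set set \<Rightarrow> real \<Rightarrow> real \<Rightarrow> ennreal \<Rightarrow> ('a \<Rightarrow> real) \<Rightarrow> ('a \<Rightarrow> real) \<Rightarrow> ennreal" where
  "best_constant \<mu> S p0 p q0 w \<sigma> =
     Inf {N. \<forall>f\<in>Lp_space \<mu> p w. \<forall>g\<in>Lp_space \<mu> (rconj (ennreal p)) \<sigma>.
            sparse_form \<mu> S p0 (rconj q0) f g
              \<le> N * Lp_norm \<mu> p w f * Lp_norm \<mu> (rconj (ennreal p)) \<sigma> g}"

end

theory Submission
  imports Defs
begin

text \<open>Write \<open>F = |f|^p0 / u\<close> and \<open>G = |g|^q0' / v\<close>. The exponents in the definitions of \<open>u\<close> and \<open>v\<close> are chosen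
so that the \<open>L^(p/p0)(u)\<close> norm of \<open>F\<close> and the \<open>L^(p'/q0')(v)\<close> norm of \<open>G\<close> are powers of the given norms
of \<open>f\<close> and \<open>g\<close>. With \<open>a = 1/p\<close>, \<open>b = 1/p'\<close>, \<open>x = 1/p0 - 1/p\<close>, \<open>y = 1/p - 1/q0\<close>, \<open>A(Q) = <u>_Q^x <v>_Q^y\<close>,
and with \<open>F_Q\<close>, \<open>G_Q\<close> for the averages of \<open>F\<close> over \<open>Q\<close> with respect to \<open>u\<close> and of \<open>G\<close> with respect to \<open>v\<close>,
the summand of the sparse form at \<open>Q\<close> is
\<open>A(Q) * F_Q^(a+x) * u(Q)^a * G_Q^(b+y) * v(Q)^b\<close>, and \<open>A(Q)\<close> is the value of both \<open>A_r\<close> and \<open>A_r'\<close>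
at \<open>Q\<close> (lemmas \<open>A_r_eq\<close>, \<open>A_r'_eq\<close>).

If \<open>u\<close> and \<open>v\<close> both satisfied a Carleson condition on the family, Hoelder's inequality and the maximal
theorem would finish the proof. A sparse family satisfies such a condition for \<open>u\<close> only with constant
\<open>A_infty(u, Q)\<close>, up to a factor (lemma \<open>weight_carleson\<close>), and each of the two characteristics pays for
the entropy of one weight only. The point is therefore to use one Carleson condition at a time.

Let \<open>k(Q)\<close> and \<open>l(Q)\<close> be the dyadic levels of the largest \<open>F\<close>-average and of the largest \<open>G\<close>-average over
the cubes of the family that contain \<open>Q\<close>. They increase as \<open>Q\<close> shrinks, and since the cubes above \<open>Q\<close> form
a chain, either \<open>k\<close> stays constant above \<open>Q\<close> as long as \<open>l\<close> does, or the other way round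
(lemma \<open>two_sided_sum_le\<close>). In the first half of the family, take the maximal cubes \<open>R\<close> with given
\<open>l(R)\<close>. For fixed \<open>l\<close> they are disjoint, so the maximal theorem for \<open>v\<close> controls
the \<open>G\<close>-side without loss; below \<open>R\<close> both levels are constant. What remains is to compare the sum of
\<open>A(Q) u(Q)^a v(Q)^b\<close> over \<open>Q \<subseteq> R\<close> with its single term at \<open>R\<close>. The total exponent of this term is
\<open>a + b = 1\<close>, just too large for summation over a sparse family. On a subfamily where \<open>A\<close> is
constant up to a factor \<open>2\<close>, however, one may trade a small power of \<open>A\<close>, which replaces
\<open>u(Q)^a v(Q)^b\<close> by \<open>u(Q)^s v(Q)^t |Q|^r\<close> with \<open>r > 0\<close> and \<open>s + t + r = 1\<close>; the factor \<open>|Q|^r\<close> makes the sum over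
generations geometric (lemmas \<open>sparse_sum_powr_le\<close>, \<open>sum_below_cube_le\<close>).

The maximal cubes \<open>R\<close> still overlap for the \<open>F\<close>-side, and there the Carleson condition for \<open>u\<close> is used.
It costs \<open>A_infty(u, Q)^(1/p)\<close>, so the family is split once more according to the size \<open>2^n\<close> of
\<open>A_infty(u, Q)\<close>; the bump leaves a factor \<open>1 / \<psi> (2^n)\<close>, and these are summable by hypothesis
(lemmas \<open>one_sided_sum_le\<close>, \<open>dyadic_bump_sum_le\<close>). The second half is symmetric, with \<open>v\<close> and \<open>\<phi>\<close>.

The values of \<open>\<phi>\<close> and \<open>\<psi>\<close> matter only on \<open>[1/2, \<infinity>)\<close>, so one has to know that \<open>A_infty \<ge> 1\<close>. This requires
\<open>|h| \<le> M h\<close> almost everywhere, with constant exactly \<open>1\<close>, on a space of homogeneous type; lemma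
\<open>AE_le_hl_maximal\<close> obtains it by filling open sets with disjoint closed balls taken from the dyadic cubes.\<close>

section \<open>Hoelder's inequality for finite sums\<close>

lemma sum_powr_mult_le:
  fixes A B :: "'i \<Rightarrow> real"
  assumes nonneg: "\<And>i. i \<in> I \<Longrightarrow> 0 \<le> A i" "\<And>i. i \<in> I \<Longrightarrow> 0 \<le> B i"
    and st: "0 < s" "0 < t" "s + t = 1"
  shows "(\<Sum>i\<in>I. A i powr s * B i powr t) \<le> (\<Sum>i\<in>I. A i) powr s * (\<Sum>i\<in>I. B i) powr t"
proof (cases "finite I")
  case True
  define X Y where "X = sum A I" and "Y = sum B I"
  have XY: "0 \<le> X" "0 \<le> Y"
    unfolding X_def Y_def using nonneg by (auto intro: sum_nonneg)
  show ?thesis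
  proof (cases "X = 0 \<or> Y = 0")
    case True
    then have "A i powr s * B i powr t = 0" if "i \<in> I" for i
      using that nonneg \<open>finite I\<close> by (auto simp: X_def Y_def sum_nonneg_eq_0_iff)
    then have "(\<Sum>i\<in>I. A i powr s * B i powr t) = 0" by (intro sum.neutral) blast
    then show ?thesis by simp
  next
    case False
    with XY have XY': "0 < X" "0 < Y" by auto
    have "A i powr s * B i powr t \<le> X powr s * Y powr t * (s * (A i / X) + t * (B i / Y))"
      if i: "i \<in> I" for i
    proof -
      have "(A i / X) powr s * (B i / Y) powr t \<le> s * (A i / X) + t * (B i / Y)"
      proof (cases "A i = 0 \<or> B i = 0")
        case True
        then show ?thesis using i nonneg st XY' by auto
      next
        case False
        then show ?thesis
          using i nonneg st XY' by (intro Youngs_inequality_0) (auto simp: less_le)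
      qed
      then show ?thesis
        using XY' nonneg[OF i] by (simp add: powr_divide field_simps)
    qed
    then have "(\<Sum>i\<in>I. A i powr s * B i powr t)
        \<le> (\<Sum>i\<in>I. X powr s * Y powr t * (s * (A i / X) + t * (B i / Y)))"
      by (rule sum_mono)
    also have "\<dots> = X powr s * Y powr t * (s * (X / X) + t * (Y / Y))"
      by (simp add: X_def Y_def sum.distrib flip: sum_distrib_left sum_divide_distrib)
    also have "\<dots> = X powr s * Y powr t"
      using XY' st by simp
    finally show ?thesis by (simp add: X_def Y_def)
  qed
qed simp

lemma sum_powr_mult3_le:
  fixes A B C :: "'i \<Rightarrow> real"
  assumes nonneg: "\<And>i. i \<in> I \<Longrightarrow> 0 \<le> A i" "\<And>i. i \<in> I \<Longrightarrow> 0 \<le> B i" "\<And>i. i \<in> I \<Longrightarrow> 0 \<le> C i"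
    and str: "0 < s" "0 < t" "0 < r" "s + t + r = 1"
  shows "(\<Sum>i\<in>I. A i powr s * B i powr t * C i powr r)
    \<le> (\<Sum>i\<in>I. A i) powr s * (\<Sum>i\<in>I. B i) powr t * (\<Sum>i\<in>I. C i) powr r"
proof -
  define q where "q = t + r"
  have q: "0 < q" "t / q + r / q = 1" "s + q = 1"
    using str by (auto simp: q_def simp flip: add_divide_distrib)
  have "(\<Sum>i\<in>I. A i powr s * B i powr t * C i powr r)
      = (\<Sum>i\<in>I. A i powr s * (B i powr (t / q) * C i powr (r / q)) powr q)"
    using q nonneg by (intro sum.cong) (auto simp: powr_mult powr_powr)
  also have "\<dots> \<le> (\<Sum>i\<in>I. A i) powr s * (\<Sum>i\<in>I. B i powr (t / q) * C i powr (r / q)) powr q"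
    using nonneg str q by (intro sum_powr_mult_le) auto
  also have "\<dots> \<le> (\<Sum>i\<in>I. A i) powr s *
      ((\<Sum>i\<in>I. B i) powr (t / q) * (\<Sum>i\<in>I. C i) powr (r / q)) powr q"
    using nonneg str q
    by (intro mult_left_mono powr_mono2 sum_powr_mult_le sum_nonneg) auto
  also have "\<dots> = (\<Sum>i\<in>I. A i) powr s * (\<Sum>i\<in>I. B i) powr t * (\<Sum>i\<in>I. C i) powr r"
    using q by (simp add: powr_mult powr_powr)
  finally show ?thesis .
qed

section \<open>Finite laminar families\<close>

definition laminar :: "'a set set \<Rightarrow> bool" where
  "laminar S \<longleftrightarrow> {} \<notin> S \<and> (\<forall>Q\<in>S. \<forall>R\<in>S. Q \<inter> R = {} \<or> Q \<subseteq> R \<or> R \<subseteq> Q)"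

definition maximal_members :: "'a set set \<Rightarrow> 'a set set" where
  "maximal_members T = {R \<in> T. \<forall>Q\<in>T. R \<subseteq> Q \<longrightarrow> Q = R}"

lemma laminarD:
  assumes "laminar S"
  shows "Q \<in> S \<Longrightarrow> R \<in> S \<Longrightarrow> Q \<inter> R = {} \<or> Q \<subseteq> R \<or> R \<subseteq> Q" and "Q \<in> S \<Longrightarrow> Q \<noteq> {}"
  using assms unfolding laminar_def by metis+

lemma laminar_subset: "laminar S \<Longrightarrow> T \<subseteq> S \<Longrightarrow> laminar T"
  unfolding laminar_def by (meson subsetD)

lemma maximal_members_subset: "maximal_members T \<subseteq> T"
  by (auto simp: maximal_members_def)

lemma ex_maximal_member:
  assumes "finite T" "Q \<in> T"
  shows "\<exists>R\<in>maximal_members T. Q \<subseteq> R"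
  using finite_has_maximal2[OF assms] by (force simp: maximal_members_def)

lemma Union_maximal_members: "finite T \<Longrightarrow> \<Union>(maximal_members T) = \<Union>T"
  using ex_maximal_member[of T] maximal_members_subset[of T] by blast

lemma disjoint_maximal_members: "laminar T \<Longrightarrow> pairwise disjnt (maximal_members T)"
proof (unfold pairwise_def disjnt_def, intro ballI impI)
  fix Q R
  assume "laminar T" and Q: "Q \<in> maximal_members T" and R: "R \<in> maximal_members T" "Q \<noteq> R"
  then have "Q \<inter> R = {} \<or> Q \<subseteq> R \<or> R \<subseteq> Q"
    using maximal_members_subset[of T] by (intro laminarD[of T]) auto
  then show "Q \<inter> R = {}" using Q R by (auto simp: maximal_members_def)
qed

text \<open>Every member lies below exactly one maximal member: two maximal members are disjoint, and no member is
empty.\<close>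

lemma sum_maximal_members:
  fixes h :: "'a set \<Rightarrow> 'b::comm_monoid_add"
  assumes T: "finite T" "laminar T"
  shows "(\<Sum>Q\<in>T. h Q) = (\<Sum>R\<in>maximal_members T. \<Sum>Q | Q \<in> T \<and> Q \<subseteq> R. h Q)"
proof -
  have "T = (\<Union>R\<in>maximal_members T. {Q \<in> T. Q \<subseteq> R})"
    using ex_maximal_member[OF T(1)] by (intro set_eqI) auto
  then have "(\<Sum>Q\<in>T. h Q) = (\<Sum>Q\<in>(\<Union>R\<in>maximal_members T. {Q \<in> T. Q \<subseteq> R}). h Q)"
    by simp
  also have "\<dots> = (\<Sum>R\<in>maximal_members T. \<Sum>Q\<in>{Q \<in> T. Q \<subseteq> R}. h Q)"
  proof (rule sum.UNION_disjoint)
    show "finite (maximal_members T)"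
      using T(1) maximal_members_subset finite_subset by blast
    show "\<forall>R\<in>maximal_members T. finite {Q \<in> T. Q \<subseteq> R}" using T(1) by simp
    show "\<forall>R\<in>maximal_members T. \<forall>R'\<in>maximal_members T. R \<noteq> R' \<longrightarrow>
        {Q \<in> T. Q \<subseteq> R} \<inter> {Q \<in> T. Q \<subseteq> R'} = {}"
    proof (intro ballI impI equals0I)
      fix R R' Q
      assume "R \<in> maximal_members T" "R' \<in> maximal_members T" "R \<noteq> R'"
        and Q: "Q \<in> {Q \<in> T. Q \<subseteq> R} \<inter> {Q \<in> T. Q \<subseteq> R'}"
      then have "R \<inter> R' = {}"
        using disjoint_maximal_members[OF T(2)] by (simp add: pairwise_def disjnt_def)
      moreover have "Q \<noteq> {}" using T(2) Q by (auto simp: laminar_def)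
      ultimately show False using Q by blast
    qed
  qed
  finally show ?thesis .
qed

lemma sum_measure_maximal_members:
  assumes "finite T" "laminar T" "\<And>Q. Q \<in> T \<Longrightarrow> Q \<in> fmeasurable N"
  shows "(\<Sum>R\<in>maximal_members T. measure N R) = measure N (\<Union>T)"
proof -
  have "measure N (\<Union>(maximal_members T)) = (\<Sum>R\<in>maximal_members T. measure N R)"
    using assms maximal_members_subset[of T] disjoint_maximal_members[OF assms(2)]
    by (intro measure_Union') (auto intro: finite_subset)
  then show ?thesis using Union_maximal_members[OF assms(1)] by simp
qed

section \<open>Power sums over sparse families\<close>

text \<open>The sum of the geometric series with ratio \<open>2 powr (- r)\<close>.\<close>

definition sparse_geometric_constant :: "real \<Rightarrow> real" where
  "sparse_geometric_constant r = 1 / (1 - 2 powr (- r))"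

lemma sparse_geometric_constant:
  assumes "0 < r"
  shows "1 + sparse_geometric_constant r * 2 powr (- r) = sparse_geometric_constant r"
    and "0 < sparse_geometric_constant r"
proof -
  define z :: real where "z = 2 powr (- r)"
  have "z < 1" using assms by (simp add: powr_less_one z_def)
  then show "1 + sparse_geometric_constant r * 2 powr (- r) = sparse_geometric_constant r"
    and "0 < sparse_geometric_constant r"
    by (simp_all add: sparse_geometric_constant_def field_simps flip: z_def)
qed

lemma sparse_subset_measure:
  assumes S: "finite S" "\<And>Q. Q \<in> S \<Longrightarrow> Q \<in> fmeasurable m" and "T \<subseteq> S" "Q \<in> S"
    and sparse: "measure m (\<Union>{Q'\<in>S. Q' \<subset> Q}) \<le> measure m Q / 2"
  shows "measure m (\<Union>{Q'\<in>T. Q' \<subset> Q}) \<le> measure m Q / 2"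
proof -
  have "measure m (\<Union>{Q'\<in>T. Q' \<subset> Q}) \<le> measure m (\<Union>{Q'\<in>S. Q' \<subset> Q})"
    using assms
    by (intro measure_mono_fmeasurable fmeasurable.finite_Union sets.finite_Union)
       (auto intro: finite_subset)
  then show ?thesis using sparse by simp
qed

text \<open>Peel off the maximal cubes. They are disjoint, so Hoelder's inequality bounds their contribution by
the single term of the union. The remaining cubes have a union of at most half the measure, which is
where \<open>r > 0\<close> enters: each generation contributes at most \<open>2 powr (- r)\<close> times the bound of the previous one.\<close>

lemma sparse_sum_powr_le:
  assumes "finite T" "laminar T"
    and "\<And>Q. Q \<in> T \<Longrightarrow> Q \<in> fmeasurable m" "\<And>Q. Q \<in> T \<Longrightarrow> Q \<in> fmeasurable u"
      "\<And>Q. Q \<in> T \<Longrightarrow> Q \<in> fmeasurable v"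
    and "\<And>Q. Q \<in> T \<Longrightarrow> measure m (\<Union>{Q'\<in>T. Q' \<subset> Q}) \<le> measure m Q / 2"
    and str: "0 < s" "0 < t" "0 < r" "s + t + r = 1"
  shows "(\<Sum>Q\<in>T. measure u Q powr s * measure v Q powr t * measure m Q powr r)
    \<le> sparse_geometric_constant r *
       (measure u (\<Union>T) powr s * measure v (\<Union>T) powr t * measure m (\<Union>T) powr r)"
  using assms(1-6)
proof (induction T rule: finite_psubset_induct)
  case (psubset T)
  define c where "c = sparse_geometric_constant r"
  define h where "h Q = measure u Q powr s * measure v Q powr t * measure m Q powr r" for Q
  define M where "M = maximal_members T"
  note [simp] = \<open>finite T\<close>
  show ?case
  proof (cases "T = {}")
    case False
    have MT: "M \<subseteq> T" "finite M"
      unfolding M_def using maximal_members_subset[of T] by (auto intro: finite_subset)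
    have "M \<noteq> {}" using False ex_maximal_member[of T] by (force simp: M_def)
    then have sub: "T - M \<subset> T" using MT by blast
    have fin: "\<Union>T' \<in> fmeasurable N" if "T' \<subseteq> T" "N \<in> {m, u, v}" for T' N
      using that psubset.prems by (intro fmeasurable.finite_Union) (auto intro: finite_subset)
    have sums: "(\<Sum>R\<in>M. measure N R) = measure N (\<Union>T)" if "N \<in> {m, u, v}" for N
      unfolding M_def using that psubset.prems by (intro sum_measure_maximal_members) auto
    have first: "(\<Sum>Q\<in>M. h Q) \<le> h (\<Union>T)"
      unfolding h_def using sum_powr_mult3_le[OF _ _ _ str, of M "measure u" "measure v" "measure m"]
      using sums[of m] sums[of u] sums[of v] by simp
    \<comment> \<open>Each remaining cube lies strictly below a maximal one.\<close>
    have half: "measure m (\<Union>(T - M)) \<le> measure m (\<Union>T) / 2"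
    proof -
      have "measure m (\<Union>(T - M)) \<le> measure m (\<Union>R\<in>M. \<Union>{Q\<in>T. Q \<subset> R})"
      proof (rule measure_mono_fmeasurable)
        show "\<Union>(T - M) \<subseteq> (\<Union>R\<in>M. \<Union>{Q\<in>T. Q \<subset> R})"
        proof (intro Union_least)
          fix Q assume Q: "Q \<in> T - M"
          then obtain R where "R \<in> M" "Q \<subset> R"
            using ex_maximal_member[of T Q] by (auto simp: M_def)
          then show "Q \<subseteq> (\<Union>R\<in>M. \<Union>{Q\<in>T. Q \<subset> R})" using Q by auto
        qed
        show "\<Union>(T - M) \<in> sets m" using fin[of "T - M" m] by (simp add: fmeasurableD)
        show "(\<Union>R\<in>M. \<Union>{Q\<in>T. Q \<subset> R}) \<in> fmeasurable m"
          using MT fin[of _ m] by (intro fmeasurable.finite_UN) auto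
      qed
      also have "\<dots> \<le> (\<Sum>R\<in>M. measure m (\<Union>{Q\<in>T. Q \<subset> R}))"
        using MT fin[of _ m] by (intro measure_UNION_le) (auto intro!: fmeasurableD)
      also have "\<dots> \<le> (\<Sum>R\<in>M. measure m R / 2)"
        using MT psubset.prems(5) by (intro sum_mono) auto
      also have "\<dots> = measure m (\<Union>T) / 2"
        by (simp add: sums flip: sum_divide_distrib)
      finally show ?thesis .
    qed
    have "(\<Sum>Q\<in>T - M. h Q) \<le> c * h (\<Union>(T - M))"
      unfolding h_def c_def
    proof (rule psubset.IH[OF sub])
      show "laminar (T - M)" using psubset.prems(1) by (rule laminar_subset) auto
      show "measure m (\<Union>{Q'\<in>T - M. Q' \<subset> Q}) \<le> measure m Q / 2" if "Q \<in> T - M" for Q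
        using that by (rule_tac sparse_subset_measure[OF \<open>finite T\<close> psubset.prems(2) _ _ psubset.prems(5)]) auto
    qed (auto intro: psubset.prems)
    also have "\<dots> \<le> c * (measure u (\<Union>T) powr s * measure v (\<Union>T) powr t * (measure m (\<Union>T) / 2) powr r)"
    proof -
      have "measure N (\<Union>(T - M)) \<le> measure N (\<Union>T)" if "N \<in> {m, u, v}" for N
        using fin[of "T - M" N] fin[of T N] that
        by (intro measure_mono_fmeasurable) (auto simp: fmeasurableD)
      then have "measure u (\<Union>(T - M)) powr s \<le> measure u (\<Union>T) powr s"
        "measure v (\<Union>(T - M)) powr t \<le> measure v (\<Union>T) powr t"
        using str by (simp_all add: powr_mono2)
      moreover have "measure m (\<Union>(T - M)) powr r \<le> (measure m (\<Union>T) / 2) powr r"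
        using str half by (simp add: powr_mono2)
      moreover have "0 \<le> c" using sparse_geometric_constant(2)[OF str(3)] by (simp add: c_def)
      ultimately show ?thesis
        unfolding h_def by (intro mult_left_mono mult_mono) simp_all
    qed
    also have "\<dots> = c * 2 powr (- r) * h (\<Union>T)"
      by (simp add: h_def powr_divide powr_minus_divide)
    finally have "(\<Sum>Q\<in>T - M. h Q) \<le> c * 2 powr (- r) * h (\<Union>T)" .
    then have "(\<Sum>Q\<in>T. h Q) \<le> (1 + c * 2 powr (- r)) * h (\<Union>T)"
      using first MT by (simp add: sum.subset_diff[of M T] algebra_simps)
    then show ?thesis
      using sparse_geometric_constant(1)[OF str(3)] by (simp add: h_def c_def)
  qed simp
qed

section \<open>Sums over the cubes below a fixed cube\<close>

text \<open>The trade of a power \<open>\<epsilon>\<close> of \<open>A\<close>: since \<open>a + b = 1\<close>, the powers of \<open>u\<close> and \<open>v\<close> that it removes come back as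
the power \<open>\<epsilon> * (x + y)\<close> of \<open>m\<close>. The first equation is used for every cube, the second one to
return at the top cube.\<close>

lemma pair_split_exponents:
  fixes m u v a b x y \<epsilon> :: real
  assumes pos: "0 < m" "0 < u" "0 < v" and ab: "a + b = 1"
  defines "A \<equiv> (u / m) powr x * (v / m) powr y"
  shows "(u / m) powr (a + x) * (v / m) powr (b + y) * m
      = A powr (1 + \<epsilon>) * (u powr (a - \<epsilon> * x) * v powr (b - \<epsilon> * y) * m powr (\<epsilon> * (x + y)))"
    and "u powr (a - \<epsilon> * x) * v powr (b - \<epsilon> * y) * m powr (\<epsilon> * (x + y))
      = A powr (- \<epsilon>) * (u powr a * v powr b)"
proof -
  obtain U V W where uvm: "u = exp U" "v = exp V" "m = exp W"
    using pos by (metis exp_ln)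
  have b: "b = 1 - a" using ab by simp
  have q: "exp P / exp R = exp (P - R)" for P R :: real by (simp add: exp_diff)
  have p: "exp P powr r = exp (r * P)" for P r :: real by (simp add: powr_def)
  show "(u / m) powr (a + x) * (v / m) powr (b + y) * m
      = A powr (1 + \<epsilon>) * (u powr (a - \<epsilon> * x) * v powr (b - \<epsilon> * y) * m powr (\<epsilon> * (x + y)))"
    unfolding A_def uvm b q p exp_add[symmetric] by (simp add: algebra_simps)
  show "u powr (a - \<epsilon> * x) * v powr (b - \<epsilon> * y) * m powr (\<epsilon> * (x + y))
      = A powr (- \<epsilon>) * (u powr a * v powr b)"
    unfolding A_def uvm b q p exp_add[symmetric] by (simp add: algebra_simps)
qed

text \<open>Since \<open>A\<close> is comparable to \<open>\<kappa>\<close> on all of \<open>T\<close>, the power \<open>\<epsilon>\<close> of \<open>A\<close> that is borrowed at each cube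
can be given back at \<open>R\<close> for a factor \<open>2 powr \<epsilon>\<close>; in between, the sum has the form of
\<open>sparse_sum_powr_le\<close>.\<close>

lemma sum_below_cube_le:
  fixes m u v :: "'a measure"
  assumes T: "finite T" "laminar T"
    and fm: "\<And>Q. Q \<in> T \<Longrightarrow> Q \<in> fmeasurable m" "\<And>Q. Q \<in> T \<Longrightarrow> Q \<in> fmeasurable u"
      "\<And>Q. Q \<in> T \<Longrightarrow> Q \<in> fmeasurable v"
    and pos: "\<And>Q. Q \<in> T \<Longrightarrow> 0 < measure m Q" "\<And>Q. Q \<in> T \<Longrightarrow> 0 < measure u Q"
      "\<And>Q. Q \<in> T \<Longrightarrow> 0 < measure v Q"
    and sparse: "\<And>Q. Q \<in> T \<Longrightarrow> measure m (\<Union>{Q'\<in>T. Q' \<subset> Q}) \<le> measure m Q / 2"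
    and ab: "0 < a" "0 < b" "a + b = 1" and xy: "0 < x" "0 < y"
    and eps: "0 < \<epsilon>" "\<epsilon> * x < a" "\<epsilon> * y < b" and "0 < \<kappa>"
    and A: "\<And>Q. Q \<in> T \<Longrightarrow>
        \<kappa> / 2 \<le> (measure u Q / measure m Q) powr x * (measure v Q / measure m Q) powr y"
      "\<And>Q. Q \<in> T \<Longrightarrow>
        (measure u Q / measure m Q) powr x * (measure v Q / measure m Q) powr y \<le> \<kappa>"
    and R: "R \<in> T" "\<And>Q. Q \<in> T \<Longrightarrow> Q \<subseteq> R"
  shows "(\<Sum>Q\<in>T. (measure u Q / measure m Q) powr (a + x) *
                 (measure v Q / measure m Q) powr (b + y) * measure m Q)
    \<le> 2 powr \<epsilon> * sparse_geometric_constant (\<epsilon> * (x + y)) * \<kappa> *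
       (measure u R powr a * measure v R powr b)"
proof -
  define c where "c = sparse_geometric_constant (\<epsilon> * (x + y))"
  have r: "0 < \<epsilon> * (x + y)" using eps xy by simp
  have c: "0 < c" unfolding c_def by (rule sparse_geometric_constant(2)[OF r])
  define A where
    "A Q = (measure u Q / measure m Q) powr x * (measure v Q / measure m Q) powr y" for Q
  define h where "h Q = measure u Q powr (a - \<epsilon> * x) * measure v Q powr (b - \<epsilon> * y) *
    measure m Q powr (\<epsilon> * (x + y))" for Q
  have UT: "\<Union>T = R" using R by auto
  have A': "\<kappa> / 2 \<le> A Q" "A Q \<le> \<kappa>" if "Q \<in> T" for Q
    using A[OF that] by (simp_all add: A_def)
  have "(\<Sum>Q\<in>T. (measure u Q / measure m Q) powr (a + x) *
                 (measure v Q / measure m Q) powr (b + y) * measure m Q)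
      = (\<Sum>Q\<in>T. A Q powr (1 + \<epsilon>) * h Q)"
    unfolding A_def h_def using pos ab by (intro sum.cong refl pair_split_exponents(1)) auto
  also have "\<dots> \<le> (\<Sum>Q\<in>T. \<kappa> powr (1 + \<epsilon>) * h Q)"
    using A' eps by (intro sum_mono mult_right_mono powr_mono2) (auto simp: h_def A_def)
  also have "\<dots> \<le> \<kappa> powr (1 + \<epsilon>) * (c * h R)"
    unfolding sum_distrib_left[symmetric]
  proof (rule mult_left_mono)
    have "(\<Sum>Q\<in>T. h Q) \<le> c * (measure u (\<Union>T) powr (a - \<epsilon> * x) *
        measure v (\<Union>T) powr (b - \<epsilon> * y) * measure m (\<Union>T) powr (\<epsilon> * (x + y)))"
      unfolding h_def c_def
      using eps ab by (intro sparse_sum_powr_le[OF T fm sparse _ _ r]) (auto simp: algebra_simps)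
    then show "(\<Sum>Q\<in>T. h Q) \<le> c * h R" by (simp add: UT h_def)
  qed simp
  also have "h R = A R powr (- \<epsilon>) * (measure u R powr a * measure v R powr b)"
    unfolding A_def h_def using pos R ab by (intro pair_split_exponents(2)) auto
  also have "\<kappa> powr (1 + \<epsilon>) * (c * (A R powr (- \<epsilon>) * (measure u R powr a * measure v R powr b)))
      \<le> \<kappa> powr (1 + \<epsilon>) * (c * ((\<kappa> / 2) powr (- \<epsilon>) * (measure u R powr a * measure v R powr b)))"
    using A'[OF R(1)] eps \<open>0 < \<kappa>\<close> c
    by (intro mult_left_mono mult_right_mono powr_mono2') auto
  also have "\<dots> = \<kappa> powr (1 + \<epsilon>) * (\<kappa> / 2) powr (- \<epsilon>) * c * (measure u R powr a * measure v R powr b)"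
    by simp
  also have "\<kappa> powr (1 + \<epsilon>) * (\<kappa> / 2) powr (- \<epsilon>) = 2 powr \<epsilon> * \<kappa>"
    using \<open>0 < \<kappa>\<close> by (simp add: powr_add powr_divide powr_minus field_simps)
  finally show ?thesis by (simp add: c_def mult_ac)
qed

text \<open>A Carleson condition at the cubes of \<open>T\<close> gives one for unions of subfamilies, because it can
be applied at the disjoint maximal cubes of the subfamily.\<close>

lemma carleson_sum_le:
  fixes u :: "'a measure"
  assumes T: "finite T" "laminar T" "\<And>Q. Q \<in> T \<Longrightarrow> Q \<in> fmeasurable u"
    and carleson: "\<And>R. R \<in> T \<Longrightarrow> (\<Sum>Q | Q \<in> T \<and> Q \<subseteq> R. measure u Q) \<le> \<Lambda> * measure u R"
    and "0 \<le> \<Lambda>" "T' \<subseteq> T"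
  shows "(\<Sum>Q\<in>T'. measure u Q) \<le> \<Lambda> * measure u (\<Union>T')"
proof -
  have T': "finite T'" "laminar T'" "\<And>Q. Q \<in> T' \<Longrightarrow> Q \<in> fmeasurable u"
    using T \<open>T' \<subseteq> T\<close> by (auto intro: finite_subset laminar_subset)
  have "(\<Sum>Q\<in>T'. measure u Q) = (\<Sum>R\<in>maximal_members T'. \<Sum>Q | Q \<in> T' \<and> Q \<subseteq> R. measure u Q)"
    using T' by (intro sum_maximal_members) auto
  also have "\<dots> \<le> (\<Sum>R\<in>maximal_members T'. \<Lambda> * measure u R)"
  proof (rule sum_mono)
    fix R assume "R \<in> maximal_members T'"
    then have R: "R \<in> T" using maximal_members_subset[of T'] \<open>T' \<subseteq> T\<close> by auto
    have "(\<Sum>Q | Q \<in> T' \<and> Q \<subseteq> R. measure u Q) \<le> (\<Sum>Q | Q \<in> T \<and> Q \<subseteq> R. measure u Q)"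
      using T \<open>T' \<subseteq> T\<close> by (intro sum_mono2) auto
    also have "\<dots> \<le> \<Lambda> * measure u R" by (rule carleson[OF R])
    finally show "(\<Sum>Q | Q \<in> T' \<and> Q \<subseteq> R. measure u Q) \<le> \<Lambda> * measure u R" .
  qed
  also have "\<dots> = \<Lambda> * measure u (\<Union>T')"
    using sum_measure_maximal_members[OF T'] by (simp flip: sum_distrib_left)
  finally show ?thesis .
qed

text \<open>Here \<open>k\<close> and \<open>l\<close> are the levels of the averages, and \<open>\<Omega>\<^sub>F i\<close>, \<open>\<Omega>\<^sub>G i\<close> are the corresponding level sets. By
\<open>const\<close>, both levels are constant below a maximal cube of given \<open>l\<close>, so \<open>sum_below_cube_le\<close> reduces the sum
to these cubes, and Hoelder's inequality separates the weights. The \<open>v\<close>-part is bounded through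
disjointness for each \<open>l\<close>, the \<open>u\<close>-part through the Carleson condition for each \<open>k\<close>.\<close>

lemma block_sum_le:
  fixes m u v :: "'a measure" and k l :: "'a set \<Rightarrow> int" and \<Omega>\<^sub>F \<Omega>\<^sub>G :: "int \<Rightarrow> 'a set"
    and a b x y \<epsilon> \<kappa> \<Lambda> :: real
  assumes T: "finite T" "laminar T"
    and fm: "\<And>Q. Q \<in> T \<Longrightarrow> Q \<in> fmeasurable m" "\<And>Q. Q \<in> T \<Longrightarrow> Q \<in> fmeasurable u"
      "\<And>Q. Q \<in> T \<Longrightarrow> Q \<in> fmeasurable v"
    and pos: "\<And>Q. Q \<in> T \<Longrightarrow> 0 < measure m Q" "\<And>Q. Q \<in> T \<Longrightarrow> 0 < measure u Q"
      "\<And>Q. Q \<in> T \<Longrightarrow> 0 < measure v Q"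
    and sparse: "\<And>Q. Q \<in> T \<Longrightarrow> measure m (\<Union>{Q'\<in>T. Q' \<subset> Q}) \<le> measure m Q / 2"
    and ab: "0 < a" "0 < b" "a + b = 1" and xy: "0 < x" "0 < y"
    and eps: "0 < \<epsilon>" "\<epsilon> * x < a" "\<epsilon> * y < b" and "0 < \<kappa>"
    and A: "\<And>Q. Q \<in> T \<Longrightarrow>
        \<kappa> / 2 \<le> (measure u Q / measure m Q) powr x * (measure v Q / measure m Q) powr y"
      "\<And>Q. Q \<in> T \<Longrightarrow>
        (measure u Q / measure m Q) powr x * (measure v Q / measure m Q) powr y \<le> \<kappa>"
    and carleson: "\<And>R. R \<in> T \<Longrightarrow> (\<Sum>Q | Q \<in> T \<and> Q \<subseteq> R. measure u Q) \<le> \<Lambda> * measure u R"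
    and "0 \<le> \<Lambda>"
    and const: "\<And>Q R. Q \<in> T \<Longrightarrow> R \<in> T \<Longrightarrow> Q \<subseteq> R \<Longrightarrow> l Q = l R \<Longrightarrow> k Q = k R"
    and \<Omega>: "\<And>Q. Q \<in> T \<Longrightarrow> Q \<subseteq> \<Omega>\<^sub>F (k Q)" "\<And>i. \<Omega>\<^sub>F i \<in> fmeasurable u"
      "\<And>Q. Q \<in> T \<Longrightarrow> Q \<subseteq> \<Omega>\<^sub>G (l Q)" "\<And>i. \<Omega>\<^sub>G i \<in> fmeasurable v"
  shows "(\<Sum>Q\<in>T. 2 powr ((a + x) * k Q) * 2 powr ((b + y) * l Q) *
      ((measure u Q / measure m Q) powr (a + x) *
       (measure v Q / measure m Q) powr (b + y) * measure m Q))
    \<le> 2 powr \<epsilon> * sparse_geometric_constant (\<epsilon> * (x + y)) * \<kappa> * \<Lambda> powr a *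
       ((\<Sum>i\<in>k ` T. 2 powr ((a + x) / a * i) * measure u (\<Omega>\<^sub>F i)) powr a *
        (\<Sum>i\<in>l ` T. 2 powr ((b + y) / b * i) * measure v (\<Omega>\<^sub>G i)) powr b)"
proof -
  define c where "c = 2 powr \<epsilon> * sparse_geometric_constant (\<epsilon> * (x + y)) * \<kappa>"
  have c: "0 \<le> c"
    using sparse_geometric_constant(2)[of "\<epsilon> * (x + y)"] eps xy \<open>0 < \<kappa>\<close> by (simp add: c_def)
  define \<tau> where "\<tau> Q = (measure u Q / measure m Q) powr (a + x) *
       (measure v Q / measure m Q) powr (b + y) * measure m Q" for Q
  define wF where "wF i = 2 powr ((a + x) / a * real_of_int i)" for i
  define wG where "wG i = 2 powr ((b + y) / b * real_of_int i)" for i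
  have wF: "2 powr ((a + x) * real_of_int i) = wF i powr a"
    and wG: "2 powr ((b + y) * real_of_int i) = wG i powr b" for i
    using ab by (simp_all add: wF_def wG_def powr_powr)
  define Tl where "Tl i = {Q\<in>T. l Q = i}" for i
  define \<R> where "\<R> = Sigma (l ` T) (\<lambda>i. maximal_members (Tl i))"
  have Tl: "Tl i \<subseteq> T" "finite (Tl i)" "laminar (Tl i)" for i
    using T by (auto simp: Tl_def intro: laminar_subset)
  have max: "maximal_members (Tl i) \<subseteq> Tl i" "finite (maximal_members (Tl i))" for i
    using maximal_members_subset[of "Tl i"] Tl(2)[of i] by (auto intro: finite_subset)
  have inner: "(\<Sum>Q | Q \<in> Tl i \<and> Q \<subseteq> R. wF (k Q) powr a * wG (l Q) powr b * \<tau> Q)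
      \<le> c * ((wF (k R) * measure u R) powr a * (wG i * measure v R) powr b)"
    if R: "R \<in> maximal_members (Tl i)" for i R
  proof -
    have R': "R \<in> T" "l R = i" using R max(1)[of i] by (auto simp: Tl_def)
    have "(\<Sum>Q | Q \<in> Tl i \<and> Q \<subseteq> R. wF (k Q) powr a * wG (l Q) powr b * \<tau> Q)
        = (\<Sum>Q | Q \<in> Tl i \<and> Q \<subseteq> R. wF (k R) powr a * wG i powr b * \<tau> Q)"
    proof (intro sum.cong refl)
      fix Q assume "Q \<in> {Q. Q \<in> Tl i \<and> Q \<subseteq> R}"
      then have "Q \<in> T" "l Q = i" "Q \<subseteq> R" by (auto simp: Tl_def)
      then show "wF (k Q) powr a * wG (l Q) powr b * \<tau> Q = wF (k R) powr a * wG i powr b * \<tau> Q"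
        using const[of Q R] R' by simp
    qed
    also have "\<dots> = wF (k R) powr a * wG i powr b * (\<Sum>Q | Q \<in> Tl i \<and> Q \<subseteq> R. \<tau> Q)"
      by (simp add: sum_distrib_left)
    also have "\<dots> \<le> wF (k R) powr a * wG i powr b * (c * (measure u R powr a * measure v R powr b))"
    proof (rule mult_left_mono)
      have sub: "{Q. Q \<in> Tl i \<and> Q \<subseteq> R} \<subseteq> T" using Tl(1) by auto
      show "(\<Sum>Q | Q \<in> Tl i \<and> Q \<subseteq> R. \<tau> Q) \<le> c * (measure u R powr a * measure v R powr b)"
        unfolding \<tau>_def c_def
      proof (rule sum_below_cube_le[OF _ _ _ _ _ _ _ _ _ ab xy eps \<open>0 < \<kappa>\<close>])
        show "finite {Q. Q \<in> Tl i \<and> Q \<subseteq> R}" using sub T(1) by (rule finite_subset)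
        show "laminar {Q. Q \<in> Tl i \<and> Q \<subseteq> R}" using T(2) sub by (rule laminar_subset)
        show "measure m (\<Union>{Q'\<in>{Q. Q \<in> Tl i \<and> Q \<subseteq> R}. Q' \<subset> Q}) \<le> measure m Q / 2"
          if "Q \<in> {Q. Q \<in> Tl i \<and> Q \<subseteq> R}" for Q
          using that sub by (intro sparse_subset_measure[OF T(1) fm(1) sub _ sparse]) auto
        show "R \<in> {Q. Q \<in> Tl i \<and> Q \<subseteq> R}" using R' by (simp add: Tl_def)
      qed (use sub fm pos A in auto)
    qed simp
    also have "\<dots> = c * ((wF (k R) * measure u R) powr a * (wG i * measure v R) powr b)"
      by (simp add: powr_mult wF_def wG_def mult_ac)
    finally show ?thesis .
  qed
  have sumF: "(\<Sum>(i, R)\<in>\<R>. wF (k R) * measure u R) \<le> \<Lambda> * (\<Sum>i\<in>k ` T. wF i * measure u (\<Omega>\<^sub>F i))"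
  proof -
    have "(\<Sum>(i, R)\<in>\<R>. wF (k R) * measure u R)
        = (\<Sum>i\<in>l ` T. \<Sum>R\<in>maximal_members (Tl i). wF (k R) * measure u R)"
      unfolding \<R>_def using T max by (simp add: sum.Sigma)
    also have "\<dots> \<le> (\<Sum>i\<in>l ` T. \<Sum>R\<in>Tl i. wF (k R) * measure u R)"
      using Tl max by (intro sum_mono sum_mono2) (auto simp: wF_def)
    also have "\<dots> = (\<Sum>Q\<in>T. wF (k Q) * measure u Q)"
      unfolding Tl_def using T(1) by (simp add: sum.image_gen[where g = l, symmetric])
    also have "\<dots> = (\<Sum>i\<in>k ` T. \<Sum>Q | Q \<in> T \<and> k Q = i. wF (k Q) * measure u Q)"
      using T(1) by (rule sum.image_gen)
    also have "\<dots> = (\<Sum>i\<in>k ` T. wF i * (\<Sum>Q | Q \<in> T \<and> k Q = i. measure u Q))"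
      by (simp add: sum_distrib_left)
    also have "\<dots> \<le> (\<Sum>i\<in>k ` T. wF i * (\<Lambda> * measure u (\<Omega>\<^sub>F i)))"
    proof (intro sum_mono mult_left_mono)
      fix i
      have "(\<Sum>Q | Q \<in> T \<and> k Q = i. measure u Q) \<le> \<Lambda> * measure u (\<Union>{Q. Q \<in> T \<and> k Q = i})"
        using T fm carleson \<open>0 \<le> \<Lambda>\<close> by (intro carleson_sum_le[of T]) auto
      also have "\<dots> \<le> \<Lambda> * measure u (\<Omega>\<^sub>F i)"
        using \<Omega> fm T \<open>0 \<le> \<Lambda>\<close>
        by (intro mult_left_mono measure_mono_fmeasurable sets.finite_Union)
           (auto simp: fmeasurableD)
      finally show "(\<Sum>Q | Q \<in> T \<and> k Q = i. measure u Q) \<le> \<Lambda> * measure u (\<Omega>\<^sub>F i)" .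
    qed (simp add: wF_def)
    finally show ?thesis by (simp add: sum_distrib_left mult_ac)
  qed
  have sumG: "(\<Sum>(i, R)\<in>\<R>. wG i * measure v R) \<le> (\<Sum>i\<in>l ` T. wG i * measure v (\<Omega>\<^sub>G i))"
  proof -
    have "(\<Sum>(i, R)\<in>\<R>. wG i * measure v R)
        = (\<Sum>i\<in>l ` T. wG i * (\<Sum>R\<in>maximal_members (Tl i). measure v R))"
      unfolding \<R>_def using T max by (simp add: sum.Sigma sum_distrib_left)
    also have "\<dots> = (\<Sum>i\<in>l ` T. wG i * measure v (\<Union>(Tl i)))"
    proof (intro sum.cong refl arg_cong[where f = "\<lambda>z. _ * z"])
      fix i show "(\<Sum>R\<in>maximal_members (Tl i). measure v R) = measure v (\<Union>(Tl i))"
        using Tl[of i] fm by (intro sum_measure_maximal_members) auto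
    qed
    also have "\<dots> \<le> (\<Sum>i\<in>l ` T. wG i * measure v (\<Omega>\<^sub>G i))"
    proof (intro sum_mono mult_left_mono measure_mono_fmeasurable sets.finite_Union)
      fix i show "\<Union>(Tl i) \<subseteq> \<Omega>\<^sub>G i" using \<Omega>(3) unfolding Tl_def by blast
    qed (use \<Omega>(4) fm(3)[THEN fmeasurableD] Tl(1,2) in \<open>auto simp: wG_def dest!: subsetD[OF Tl(1)]\<close>)
    finally show ?thesis .
  qed
  have "(\<Sum>Q\<in>T. wF (k Q) powr a * wG (l Q) powr b * \<tau> Q)
      = (\<Sum>i\<in>l ` T. \<Sum>Q\<in>Tl i. wF (k Q) powr a * wG (l Q) powr b * \<tau> Q)"
    unfolding Tl_def using T(1) by (rule sum.image_gen)
  also have "\<dots> = (\<Sum>i\<in>l ` T. \<Sum>R\<in>maximal_members (Tl i).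
      \<Sum>Q | Q \<in> Tl i \<and> Q \<subseteq> R. wF (k Q) powr a * wG (l Q) powr b * \<tau> Q)"
    using Tl by (intro sum.cong refl sum_maximal_members) auto
  also have "\<dots> \<le> (\<Sum>i\<in>l ` T. \<Sum>R\<in>maximal_members (Tl i).
      c * ((wF (k R) * measure u R) powr a * (wG i * measure v R) powr b))"
    by (intro sum_mono inner)
  also have "\<dots> = c * (\<Sum>(i, R)\<in>\<R>. (wF (k R) * measure u R) powr a * (wG i * measure v R) powr b)"
    unfolding \<R>_def using T max by (simp add: sum.Sigma sum_distrib_left case_prod_unfold)
  also have "\<dots> \<le> c * ((\<Sum>(i, R)\<in>\<R>. wF (k R) * measure u R) powr a *
      (\<Sum>(i, R)\<in>\<R>. wG i * measure v R) powr b)"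
    using sum_powr_mult_le[of \<R> "\<lambda>(i, R). wF (k R) * measure u R" "\<lambda>(i, R). wG i * measure v R" a b]
      c ab by (intro mult_left_mono) (auto simp: case_prod_unfold wF_def wG_def)
  also have "\<dots> \<le> c * ((\<Lambda> * (\<Sum>i\<in>k ` T. wF i * measure u (\<Omega>\<^sub>F i))) powr a *
      (\<Sum>i\<in>l ` T. wG i * measure v (\<Omega>\<^sub>G i)) powr b)"
    using sumF sumG ab c
    by (intro mult_left_mono mult_mono powr_mono2)
       (auto intro!: sum_nonneg simp: wF_def wG_def)
  also have "\<dots> = c * \<Lambda> powr a * ((\<Sum>i\<in>k ` T. wF i * measure u (\<Omega>\<^sub>F i)) powr a *
      (\<Sum>i\<in>l ` T. wG i * measure v (\<Omega>\<^sub>G i)) powr b)"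
    using \<open>0 \<le> \<Lambda>\<close> by (simp add: powr_mult sum_nonneg wF_def mult_ac)
  finally show ?thesis
    unfolding c_def \<tau>_def wF[symmetric] wG[symmetric] by (simp add: wF_def wG_def)
qed

section \<open>Splitting according to the entropy of a cube\<close>

lemma ex_dyadic_scale:
  fixes t :: real
  assumes "1 \<le> t"
  shows "\<exists>n::nat. 2 ^ n \<le> t \<and> t < 2 ^ Suc n"
proof -
  define n where "n = (LEAST n::nat. t < 2 ^ Suc n)"
  have ex: "\<exists>n::nat. t < 2 ^ Suc n"
  proof -
    obtain n where "t < 2 ^ n" using real_arch_pow[of 2 t] by auto
    also have "(2::real) ^ n \<le> 2 ^ Suc n" by simp
    finally show ?thesis by blast
  qed
  have "t < 2 ^ Suc n" unfolding n_def by (rule LeastI_ex[OF ex])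
  moreover have "2 ^ n \<le> t"
  proof (cases n)
    case (Suc k)
    then show ?thesis using not_less_Least[of k "\<lambda>n. t < 2 ^ Suc n"] by (auto simp: n_def not_less)
  qed (use assms in simp)
  ultimately show ?thesis by blast
qed

lemma sum_half_powers_le:
  assumes "finite I"
  shows "(\<Sum>j\<in>I. (1 / 2::real) ^ j) \<le> 2"
proof -
  have "(\<Sum>j\<in>I. (1 / 2::real) ^ j) \<le> (\<Sum>j. (1 / 2) ^ j)"
    using assms by (intro sum_le_suminf summable_geometric) auto
  then show ?thesis by (simp add: suminf_geometric)
qed

text \<open>The blocks are indexed by two natural numbers: \<open>n\<close> with \<open>e Q\<close> about \<open>2 ^ n\<close>, and \<open>j\<close> measuring how far \<open>A Q\<close>
lies below its largest possible value \<open>\<kappa> n\<close> for this \<open>n\<close>. The Carleson constant of a block is about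
\<open>2 ^ n\<close>, and its power \<open>a\<close> cancels against the factor \<open>e Q powr a\<close> in the bump condition. What is left is
\<open>1 / \<psi> (2 ^ n) * (1 / 2) ^ j\<close>, summable in \<open>n\<close> and \<open>j\<close>.\<close>

lemma one_sided_sum_le:
  fixes m u v :: "'a measure" and k l :: "'a set \<Rightarrow> int" and \<Omega>\<^sub>F \<Omega>\<^sub>G :: "int \<Rightarrow> 'a set"
    and a b x y \<epsilon> K L X Y \<Psi> :: real and e :: "'a set \<Rightarrow> real" and \<psi> :: "real \<Rightarrow> real"
  assumes T: "finite T" "laminar T"
    and fm: "\<And>Q. Q \<in> T \<Longrightarrow> Q \<in> fmeasurable m" "\<And>Q. Q \<in> T \<Longrightarrow> Q \<in> fmeasurable u"
      "\<And>Q. Q \<in> T \<Longrightarrow> Q \<in> fmeasurable v"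
    and pos: "\<And>Q. Q \<in> T \<Longrightarrow> 0 < measure m Q" "\<And>Q. Q \<in> T \<Longrightarrow> 0 < measure u Q"
      "\<And>Q. Q \<in> T \<Longrightarrow> 0 < measure v Q"
    and sparse: "\<And>Q. Q \<in> T \<Longrightarrow> measure m (\<Union>{Q'\<in>T. Q' \<subset> Q}) \<le> measure m Q / 2"
    and ab: "0 < a" "0 < b" "a + b = 1" and xy: "0 < x" "0 < y"
    and eps: "0 < \<epsilon>" "\<epsilon> * x < a" "\<epsilon> * y < b"
    and e: "\<And>Q. Q \<in> T \<Longrightarrow> 1 \<le> e Q"
    and \<psi>: "\<And>s. 1 \<le> s \<Longrightarrow> 0 < \<psi> s" "\<And>s t. 1 \<le> s \<Longrightarrow> s \<le> t \<Longrightarrow> \<psi> s \<le> \<psi> t"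
    and \<Psi>: "\<And>I. finite I \<Longrightarrow> (\<Sum>n\<in>I. 1 / \<psi> (2 ^ n)) \<le> \<Psi>"
    and bump: "\<And>Q. Q \<in> T \<Longrightarrow> (measure u Q / measure m Q) powr x *
        (measure v Q / measure m Q) powr y * e Q powr a * \<psi> (e Q) \<le> K"
    and carleson: "\<And>R. R \<in> T \<Longrightarrow> (\<Sum>Q | Q \<in> T \<and> Q \<subseteq> R. measure u Q) \<le> L * e R * measure u R"
    and "0 \<le> L" "0 \<le> K"
    and const: "\<And>Q R. Q \<in> T \<Longrightarrow> R \<in> T \<Longrightarrow> Q \<subseteq> R \<Longrightarrow> l Q = l R \<Longrightarrow> k Q = k R"
    and \<Omega>: "\<And>Q. Q \<in> T \<Longrightarrow> Q \<subseteq> \<Omega>\<^sub>F (k Q)" "\<And>i. \<Omega>\<^sub>F i \<in> fmeasurable u"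
      "\<And>Q. Q \<in> T \<Longrightarrow> Q \<subseteq> \<Omega>\<^sub>G (l Q)" "\<And>i. \<Omega>\<^sub>G i \<in> fmeasurable v"
    and X: "\<And>I. finite I \<Longrightarrow> (\<Sum>i\<in>I. 2 powr ((a + x) / a * real_of_int i) * measure u (\<Omega>\<^sub>F i)) \<le> X"
    and Y: "\<And>I. finite I \<Longrightarrow> (\<Sum>i\<in>I. 2 powr ((b + y) / b * real_of_int i) * measure v (\<Omega>\<^sub>G i)) \<le> Y"
  shows "(\<Sum>Q\<in>T. 2 powr ((a + x) * k Q) * 2 powr ((b + y) * l Q) *
      ((measure u Q / measure m Q) powr (a + x) *
       (measure v Q / measure m Q) powr (b + y) * measure m Q))
    \<le> 2 powr \<epsilon> * sparse_geometric_constant (\<epsilon> * (x + y)) * (2 * L) powr a * (2 * \<Psi>) * K *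
       (X powr a * Y powr b)"
proof -
  define c where "c = 2 powr \<epsilon> * sparse_geometric_constant (\<epsilon> * (x + y))"
  have c: "0 \<le> c"
    using sparse_geometric_constant(2)[of "\<epsilon> * (x + y)"] eps xy by (simp add: c_def)
  define A where
    "A Q = (measure u Q / measure m Q) powr x * (measure v Q / measure m Q) powr y" for Q
  define h where "h Q = 2 powr ((a + x) * k Q) * 2 powr ((b + y) * l Q) *
      ((measure u Q / measure m Q) powr (a + x) *
       (measure v Q / measure m Q) powr (b + y) * measure m Q)" for Q
  \<comment> \<open>The largest value of \<open>A\<close> that the bump condition admits when \<open>e\<close> is about \<open>2 ^ n\<close>.\<close>
  define \<kappa> where "\<kappa> n = K / ((2 ^ n) powr a * \<psi> (2 ^ n))" for n :: nat
  have A_pos: "0 < A Q" if "Q \<in> T" for Q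
    using pos[OF that] by (simp add: A_def)
  have K_pos: "0 < K" if "Q \<in> T" for Q
  proof -
    have "0 < A Q * e Q powr a * \<psi> (e Q)"
      using A_pos[OF that] e[OF that] \<psi>(1)[OF e[OF that]] by simp
    also have "\<dots> \<le> K" unfolding A_def by (rule bump[OF that])
    finally show ?thesis .
  qed
  have pow1: "1 \<le> (2::real) ^ n" for n :: nat by simp
  have XY: "0 \<le> X" "0 \<le> Y" "0 \<le> \<Psi>" using X[of "{}"] Y[of "{}"] \<Psi>[of "{}"] by simp_all
  obtain n where n: "2 ^ n Q \<le> e Q" "e Q < 2 ^ Suc (n Q)" if "Q \<in> T" for Q
    using ex_dyadic_scale[OF e] by metis
  have A_le: "A Q \<le> \<kappa> (n Q)" if Q: "Q \<in> T" for Q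
  proof -
    have "A Q * ((2 ^ n Q) powr a * \<psi> (2 ^ n Q)) \<le> A Q * (e Q powr a * \<psi> (e Q))"
      using n[OF Q] A_pos[OF Q] ab \<psi>(1)[OF pow1, of "n Q"] \<psi>(2)[OF pow1 n(1)[OF Q]]
      by (intro mult_left_mono mult_mono powr_mono2) auto
    also have "\<dots> \<le> K" using bump[OF Q] by (simp add: A_def mult_ac)
    finally show ?thesis
      using \<psi>(1)[OF pow1, of "n Q"] by (simp add: \<kappa>_def pos_le_divide_eq)
  qed
  have "\<exists>j::nat. 2 ^ j \<le> \<kappa> (n Q) / A Q \<and> \<kappa> (n Q) / A Q < 2 ^ Suc j" if "Q \<in> T" for Q
    using A_le[OF that] A_pos[OF that] by (intro ex_dyadic_scale) (simp add: pos_le_divide_eq)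
  then obtain j where j: "2 ^ j Q \<le> \<kappa> (n Q) / A Q" "\<kappa> (n Q) / A Q < 2 ^ Suc (j Q)"
    if "Q \<in> T" for Q by metis
  define g where "g Q = (n Q, j Q)" for Q
  define D where "D = c * (2 * L) powr a * K * (X powr a * Y powr b)"
  have D: "0 \<le> D" if "Q \<in> T" for Q
    using c K_pos[OF that] by (simp add: D_def)
  have block: "(\<Sum>Q | Q \<in> T \<and> g Q = (N, J). h Q) \<le> D * (1 / \<psi> (2 ^ N) * (1 / 2) ^ J)"
    if NJ: "(N, J) \<in> g ` T" for N J
  proof -
    define T' where "T' = {Q. Q \<in> T \<and> g Q = (N, J)}"
    have T': "T' \<subseteq> T" by (auto simp: T'_def)
    obtain Q0 where Q0: "Q0 \<in> T" "g Q0 = (N, J)" using NJ by auto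
    have \<kappa>: "0 < \<kappa> N" using K_pos[OF Q0(1)] \<psi>(1)[OF pow1] by (simp add: \<kappa>_def)
    define \<Lambda> where "\<Lambda> = L * 2 ^ Suc N"
    have \<Lambda>: "0 \<le> \<Lambda>" using \<open>0 \<le> L\<close> by (simp add: \<Lambda>_def)
    have "(\<Sum>Q\<in>T'. h Q) \<le> c * (\<kappa> N / 2 ^ J) * \<Lambda> powr a *
       ((\<Sum>i\<in>k ` T'. 2 powr ((a + x) / a * i) * measure u (\<Omega>\<^sub>F i)) powr a *
        (\<Sum>i\<in>l ` T'. 2 powr ((b + y) / b * i) * measure v (\<Omega>\<^sub>G i)) powr b)"
      unfolding c_def h_def
    proof (rule block_sum_le[OF _ _ _ _ _ _ _ _ _ ab xy eps _ _ _ _ \<Lambda> _ _ \<Omega>(2) _ \<Omega>(4)])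
      show "finite T'" using T' T(1) by (rule finite_subset)
      show "laminar T'" using T(2) T' by (rule laminar_subset)
      show "0 < \<kappa> N / 2 ^ J" using \<kappa> by simp
      fix Q assume Q': "Q \<in> T'"
      then have Q: "Q \<in> T" using T' by auto
      have nj: "n Q = N" "j Q = J" using Q' by (auto simp: T'_def g_def)
      show "Q \<in> fmeasurable m" "Q \<in> fmeasurable u" "Q \<in> fmeasurable v"
        "0 < measure m Q" "0 < measure u Q" "0 < measure v Q"
        "Q \<subseteq> \<Omega>\<^sub>F (k Q)" "Q \<subseteq> \<Omega>\<^sub>G (l Q)"
        using Q fm pos \<Omega> by auto
      show "measure m (\<Union>{Q'\<in>T'. Q' \<subset> Q}) \<le> measure m Q / 2"
        by (rule sparse_subset_measure[OF T(1) fm(1) T' Q sparse[OF Q]])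
      show "\<kappa> N / 2 ^ J / 2 \<le> (measure u Q / measure m Q) powr x * (measure v Q / measure m Q) powr y"
        using j(2)[OF Q] A_pos[OF Q] unfolding A_def[symmetric] nj by (simp add: field_simps)
      show "(measure u Q / measure m Q) powr x * (measure v Q / measure m Q) powr y \<le> \<kappa> N / 2 ^ J"
        using j(1)[OF Q] A_pos[OF Q] unfolding A_def[symmetric] nj by (simp add: field_simps)
      have "(\<Sum>R | R \<in> T' \<and> R \<subseteq> Q. measure u R) \<le> (\<Sum>R | R \<in> T \<and> R \<subseteq> Q. measure u R)"
        using T T' by (intro sum_mono2) auto
      also have "\<dots> \<le> L * e Q * measure u Q" by (rule carleson[OF Q])
      also have "\<dots> \<le> \<Lambda> * measure u Q"
        unfolding \<Lambda>_def using n(2)[OF Q] \<open>0 \<le> L\<close> nj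
        by (intro mult_right_mono mult_left_mono) auto
      finally show "(\<Sum>R | R \<in> T' \<and> R \<subseteq> Q. measure u R) \<le> \<Lambda> * measure u Q" .
      fix R assume "R \<in> T'" "Q \<subseteq> R" "l Q = l R"
      then show "k Q = k R" using T' by (intro const[OF Q]) auto
    qed
    also have "\<dots> \<le> c * (\<kappa> N / 2 ^ J) * \<Lambda> powr a * (X powr a * Y powr b)"
    proof -
      have "finite T'" using T' T(1) by (rule finite_subset)
      then have "(\<Sum>i\<in>k ` T'. 2 powr ((a + x) / a * i) * measure u (\<Omega>\<^sub>F i)) powr a \<le> X powr a"
        "(\<Sum>i\<in>l ` T'. 2 powr ((b + y) / b * i) * measure v (\<Omega>\<^sub>G i)) powr b \<le> Y powr b"
        using X[of "k ` T'"] Y[of "l ` T'"] ab by (simp_all add: powr_mono2 sum_nonneg)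
      then show ?thesis using c \<kappa> by (intro mult_left_mono mult_mono) simp_all
    qed
    also have "\<dots> = D * (1 / \<psi> (2 ^ N) * (1 / 2) ^ J)"
      using \<open>0 \<le> L\<close> \<psi>(1)[OF pow1, of N]
      by (simp add: D_def \<kappa>_def \<Lambda>_def powr_mult power_divide)
    finally show ?thesis by (simp add: T'_def)
  qed
  show ?thesis
  proof (cases "T = {}")
    case True
    then show ?thesis using XY c \<open>0 \<le> K\<close> by (simp add: c_def)
  next
    case False
    then obtain Q0 where Q0: "Q0 \<in> T" by auto
    have "(\<Sum>Q\<in>T. h Q) = (\<Sum>z\<in>g ` T. \<Sum>Q | Q \<in> T \<and> g Q = z. h Q)"
      using T(1) by (rule sum.image_gen)
    also have "\<dots> \<le> (\<Sum>(N, J)\<in>g ` T. D * (1 / \<psi> (2 ^ N) * (1 / 2) ^ J))"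
      using block by (intro sum_mono) auto
    also have "\<dots> \<le> (\<Sum>(N, J)\<in>n ` T \<times> j ` T. D * (1 / \<psi> (2 ^ N) * (1 / 2) ^ J))"
      using T(1) D[OF Q0] \<psi>(1)[OF pow1, THEN less_imp_le]
      by (intro sum_mono2) (auto simp: g_def)
    also have "\<dots> = D * ((\<Sum>N\<in>n ` T. 1 / \<psi> (2 ^ N)) * (\<Sum>J\<in>j ` T. (1 / 2) ^ J))"
      unfolding sum_product sum.cartesian_product by (simp add: case_prod_unfold sum_distrib_left)
    also have "\<dots> \<le> D * (\<Psi> * 2)"
    proof -
      have "(\<Sum>N\<in>n ` T. 1 / \<psi> (2 ^ N)) \<le> \<Psi>" "(\<Sum>J\<in>j ` T. (1 / 2::real) ^ J) \<le> 2"
        using T(1) by (auto intro: \<Psi> sum_half_powers_le)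
      then show ?thesis
        using D[OF Q0] XY by (intro mult_left_mono mult_mono sum_nonneg) auto
    qed
    finally show ?thesis by (simp add: D_def c_def h_def mult_ac)
  qed
qed

section \<open>The maximal theorem for a finite laminar family\<close>

text \<open>The levels run over all integers, so the geometric series is summed from its largest term downwards.\<close>

lemma sum_powr_int_le:
  fixes b m :: real and I :: "int set"
  assumes "finite I" "1 < b"
  shows "(\<Sum>k\<in>{k\<in>I. real_of_int k \<le> m}. b powr k) \<le> b powr m * (b / (b - 1))"
proof -
  define M where "M = \<lfloor>m\<rfloor>"
  define J where "J = {k\<in>I. real_of_int k \<le> m}"
  have J: "finite J" "\<And>k. k \<in> J \<Longrightarrow> k \<le> M"
    using assms by (auto simp: J_def M_def le_floor_iff)
  have inj: "inj_on (\<lambda>k. nat (M - k)) J" using J(2) by (intro inj_onI) (metis diff_ge_0_iff_ge diff_left_imp_eq int_nat_eq)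
  have "(\<Sum>k\<in>J. b powr k) = (\<Sum>k\<in>J. b powr M * (1 / b) ^ nat (M - k))"
  proof (rule sum.cong)
    fix k assume "k \<in> J"
    then have "real_of_int k = real_of_int M - real (nat (M - k))" using J(2)[of k] by simp
    then have "b powr k = b powr M / b powr real (nat (M - k))"
      by (metis powr_diff)
    then show "b powr k = b powr M * (1 / b) ^ nat (M - k)"
      using assms by (simp add: powr_realpow power_divide)
  qed simp
  also have "\<dots> = b powr M * (\<Sum>n\<in>(\<lambda>k. nat (M - k)) ` J. (1 / b) ^ n)"
    by (simp add: sum.reindex[OF inj] sum_distrib_left)
  also have "\<dots> \<le> b powr M * (\<Sum>n. (1 / b) ^ n)"
    using assms J by (intro mult_left_mono sum_le_suminf summable_geometric) auto
  also have "(\<Sum>n. (1 / b) ^ n) = b / (b - 1)"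
    using assms by (subst suminf_geometric) (auto simp: field_simps)
  also have "b powr M * (b / (b - 1)) \<le> b powr m * (b / (b - 1))"
    using assms by (intro mult_right_mono powr_mono) (auto simp: M_def)
  finally show ?thesis by (simp add: J_def)
qed

lemma sum_nn_integral_disjoint_le:
  assumes "finite I" "disjoint_family_on A I" "\<And>i. i \<in> I \<Longrightarrow> A i \<in> sets N"
    and "g \<in> borel_measurable N" and "\<And>i. i \<in> I \<Longrightarrow> A i \<subseteq> E" "E \<in> sets N"
  shows "(\<Sum>i\<in>I. \<integral>\<^sup>+x\<in>A i. g x \<partial>N) \<le> (\<integral>\<^sup>+x\<in>E. g x \<partial>N)"
proof -
  have "(\<Sum>i\<in>I. \<integral>\<^sup>+x\<in>A i. g x \<partial>N) = (\<Sum>i\<in>I. emeasure (density N g) (A i))"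
    using assms by (intro sum.cong refl) (simp add: emeasure_density)
  also have "\<dots> = emeasure (density N g) (\<Union>i\<in>I. A i)"
    using assms by (intro sum_emeasure) auto
  also have "\<dots> \<le> emeasure (density N g) E"
    using assms by (intro emeasure_mono UN_least) auto
  finally show ?thesis using assms by (simp add: emeasure_density)
qed

text \<open>The constant of \<open>sum_average_level_sets_le\<close>: the factor \<open>2 * 2 powr (\<gamma> - 1)\<close> comes from halving the threshold
in the weak type estimate, the quotient from the geometric series over the levels.\<close>

definition level_set_constant :: "real \<Rightarrow> real" where
  "level_set_constant \<gamma> = 2 * 2 powr (\<gamma> - 1) * (2 powr (\<gamma> - 1) / (2 powr (\<gamma> - 1) - 1))"

lemma level_set_constant_pos: "1 < \<gamma> \<Longrightarrow> 0 < level_set_constant \<gamma>"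
  by (simp add: level_set_constant_def)

text \<open>The level set at height \<open>2 powr k\<close> of the maximal function over the cubes of \<open>S\<close>, written without division.\<close>

definition average_level_set :: "'a measure \<Rightarrow> 'a set set \<Rightarrow> ('a \<Rightarrow> real) \<Rightarrow> int \<Rightarrow> 'a set" where
  "average_level_set N S F k =
     \<Union>{Q\<in>S. ennreal (2 powr k) * emeasure N Q \<le> (\<integral>\<^sup>+x\<in>Q. ennreal (F x) \<partial>N)}"

text \<open>The weak type estimate in its truncated form. On a cube whose average is at least \<open>2 t\<close>, the part of \<open>F\<close>
below \<open>t\<close> accounts for at most half of the integral; the maximal cubes of this kind are disjoint.\<close>

lemma emeasure_average_level_set_le:
  fixes F :: "'a \<Rightarrow> real"
  assumes S: "finite S" "laminar S" "\<And>Q. Q \<in> S \<Longrightarrow> Q \<in> fmeasurable N"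
    and F[measurable]: "F \<in> borel_measurable N"
  shows "ennreal (2 powr (real_of_int k - 1)) * emeasure N (average_level_set N S F k)
    \<le> (\<integral>\<^sup>+x. ennreal (F x) * indicator {x. 2 powr (real_of_int k - 1) \<le> F x} x \<partial>N)"
proof -
  \<comment> \<open>Half of the threshold \<open>2 powr k\<close>: the part of \<open>F\<close> below \<open>t\<close> cannot make up the whole average.\<close>
  define t :: real where "t = 2 powr (real_of_int k - 1)"
  have t: "0 < t" "ennreal (2 powr real_of_int k) = ennreal t + ennreal t"
    by (simp_all add: t_def powr_diff flip: ennreal_plus)
  define T where "T = {Q\<in>S. ennreal (2 powr k) * emeasure N Q \<le> (\<integral>\<^sup>+x\<in>Q. ennreal (F x) \<partial>N)}"
  define g where "g x = ennreal (F x) * indicator {x. t \<le> F x} x" for x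
  have g[measurable]: "g \<in> borel_measurable N" unfolding g_def[abs_def] by measurable
  have T: "finite T" "laminar T" "\<And>Q. Q \<in> T \<Longrightarrow> Q \<in> fmeasurable N"
    using S by (auto simp: T_def intro: laminar_subset)
  have sub: "maximal_members T \<subseteq> T" by (rule maximal_members_subset)
  have *: "ennreal t * emeasure N Q \<le> (\<integral>\<^sup>+x\<in>Q. g x \<partial>N)" if Q: "Q \<in> T" for Q
  proof -
    have [measurable]: "Q \<in> sets N" and fin: "emeasure N Q < \<infinity>"
      using T(3)[OF Q] by (auto simp: fmeasurable_def)
    have "ennreal t * emeasure N Q + ennreal t * emeasure N Q \<le> (\<integral>\<^sup>+x\<in>Q. ennreal (F x) \<partial>N)"
      using Q t by (simp add: T_def t(2) distrib_right)
    also have "\<dots> \<le> (\<integral>\<^sup>+x. g x * indicator Q x + ennreal t * indicator Q x \<partial>N)"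
      by (intro nn_integral_mono) (auto simp: g_def indicator_def intro!: ennreal_leI)
    also have "\<dots> = (\<integral>\<^sup>+x\<in>Q. g x \<partial>N) + ennreal t * emeasure N Q"
      by (subst nn_integral_add) (auto simp: nn_integral_cmult_indicator)
    finally show ?thesis
      using fin by (auto simp: ennreal_mult_eq_top_iff ennreal_add_left_cancel_le add.commute)
  qed
  have "emeasure N (\<Union>T) = (\<Sum>R\<in>maximal_members T. emeasure N R)"
  proof -
    have "emeasure N (\<Union>R\<in>maximal_members T. R) = (\<Sum>R\<in>maximal_members T. emeasure N R)"
      using T sub disjoint_maximal_members[OF T(2)]
      by (intro sum_emeasure[symmetric])
         (auto simp: disjoint_family_on_def pairwise_def disjnt_def fmeasurableD dest: subsetD
               intro: finite_subset)
    then show ?thesis using Union_maximal_members[OF T(1)] by simp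
  qed
  then have "ennreal t * emeasure N (\<Union>T) = (\<Sum>R\<in>maximal_members T. ennreal t * emeasure N R)"
    by (simp add: sum_distrib_left)
  also have "\<dots> \<le> (\<Sum>R\<in>maximal_members T. \<integral>\<^sup>+x\<in>R. g x \<partial>N)"
    using * sub by (intro sum_mono) auto
  also have "\<dots> \<le> (\<integral>\<^sup>+x\<in>space N. g x \<partial>N)"
    using T sub disjoint_maximal_members[OF T(2)]
    by (intro sum_nn_integral_disjoint_le)
       (auto simp: fmeasurableD disjoint_family_on_def pairwise_def disjnt_def
             dest: subsetD sets.sets_into_space intro: finite_subset)
  also have "\<dots> = (\<integral>\<^sup>+x. g x \<partial>N)"
    by (intro nn_integral_cong) simp
  finally show ?thesis by (simp add: T_def average_level_set_def t_def g_def)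
qed

lemma average_level_set_fmeasurable:
  assumes "finite S" "\<And>Q. Q \<in> S \<Longrightarrow> Q \<in> fmeasurable N"
  shows "average_level_set N S F k \<in> fmeasurable N"
  unfolding average_level_set_def using assms by (intro fmeasurable.finite_Union) auto

text \<open>The strong type estimate follows from the weak one by summation: at a point \<open>x\<close> only the levels
with \<open>2 powr (k - 1) \<le> F x\<close> contribute, and because of \<open>\<gamma> > 1\<close> their sum is dominated by the largest one.\<close>

lemma sum_average_level_sets_le:
  fixes F :: "'a \<Rightarrow> real"
  assumes S: "finite S" "laminar S" "\<And>Q. Q \<in> S \<Longrightarrow> Q \<in> fmeasurable N"
    and F[measurable]: "F \<in> borel_measurable N" and F0: "\<And>x. 0 \<le> F x"
    and \<gamma>: "1 < \<gamma>" and "finite I" and Z: "0 \<le> Z" "(\<integral>\<^sup>+x. ennreal (F x powr \<gamma>) \<partial>N) = ennreal Z"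
  shows "(\<Sum>k\<in>I. 2 powr (\<gamma> * real_of_int k) * measure N (average_level_set N S F k))
    \<le> level_set_constant \<gamma> * Z"
proof -
  define b :: real where "b = 2 powr (\<gamma> - 1)"
  have b: "1 < b" using \<gamma> by (simp add: b_def)
  define W where "W = level_set_constant \<gamma>"
  have W: "W = 2 * b * (b / (b - 1))" "0 \<le> W"
    using level_set_constant_pos[OF \<gamma>] by (simp_all add: W_def level_set_constant_def b_def)
  define c where "c k = 2 * b powr real_of_int k" for k
  define \<Omega> where "\<Omega> = average_level_set N S F"
  have \<Omega>: "\<Omega> k \<in> fmeasurable N" for k
    unfolding \<Omega>_def using S by (intro average_level_set_fmeasurable) auto
  have pointwise: "(\<Sum>k\<in>I. c k * (F x * indicator {x. 2 powr (real_of_int k - 1) \<le> F x} x))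
      \<le> W * F x powr \<gamma>" for x
  proof (cases "F x = 0")
    case False
    then have Fx: "0 < F x" using F0[of x] by simp
    have level: "2 powr (real_of_int k - 1) \<le> F x \<longleftrightarrow> real_of_int k \<le> log 2 (F x) + 1" for k
      using Fx by (subst powr_le_iff) auto
    have "(\<Sum>k\<in>I. c k * (F x * indicator {x. 2 powr (real_of_int k - 1) \<le> F x} x))
        = (\<Sum>k\<in>I. if real_of_int k \<le> log 2 (F x) + 1 then 2 * F x * b powr real_of_int k else 0)"
      by (intro sum.cong refl) (auto simp: c_def level)
    also have "\<dots> = 2 * F x * (\<Sum>k\<in>{k\<in>I. real_of_int k \<le> log 2 (F x) + 1}. b powr real_of_int k)"
      using \<open>finite I\<close> by (simp add: sum.inter_filter sum_distrib_left if_distrib cong: if_cong)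
    also have "\<dots> \<le> 2 * F x * (b powr (log 2 (F x) + 1) * (b / (b - 1)))"
      using Fx b \<open>finite I\<close> by (intro mult_left_mono sum_powr_int_le) auto
    also have "b powr (log 2 (F x) + 1) = F x powr (\<gamma> - 1) * b"
    proof -
      have "b powr log 2 (F x) = F x powr (\<gamma> - 1)"
      proof -
        have "b powr log 2 (F x) = (2 powr log 2 (F x)) powr (\<gamma> - 1)"
          by (simp only: b_def powr_powr mult.commute)
        then show ?thesis using Fx by simp
      qed
      then show ?thesis using b by (simp add: powr_add)
    qed
    also have "2 * F x * (F x powr (\<gamma> - 1) * b * (b / (b - 1))) = W * (F x powr 1 * F x powr (\<gamma> - 1))"
      using Fx by (simp add: W)
    also have "F x powr 1 * F x powr (\<gamma> - 1) = F x powr \<gamma>"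
      by (simp only: powr_add[symmetric]) simp
    finally show ?thesis .
  qed simp
  have "ennreal (\<Sum>k\<in>I. 2 powr (\<gamma> * real_of_int k) * measure N (\<Omega> k))
      = (\<Sum>k\<in>I. ennreal (c k) * (ennreal (2 powr (real_of_int k - 1)) * emeasure N (\<Omega> k)))"
  proof (subst sum_ennreal[symmetric], simp, intro sum.cong refl)
    fix k
    have "2 powr (\<gamma> * real_of_int k) = c k * 2 powr (real_of_int k - 1)"
    proof -
      have "c k * 2 powr (real_of_int k - 1)
          = 2 powr 1 * 2 powr ((\<gamma> - 1) * real_of_int k) * 2 powr (real_of_int k - 1)"
        by (simp only: c_def b_def powr_powr) simp
      also have "\<dots> = 2 powr (\<gamma> * real_of_int k)"
        by (simp only: powr_add[symmetric]) (simp add: algebra_simps)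
      finally show ?thesis by simp
    qed
    then show "ennreal (2 powr (\<gamma> * real_of_int k) * measure N (\<Omega> k))
        = ennreal (c k) * (ennreal (2 powr (real_of_int k - 1)) * emeasure N (\<Omega> k))"
      by (simp add: emeasure_eq_measure2[OF \<Omega>] ennreal_mult c_def mult_ac)
  qed
  also have "\<dots> \<le> (\<Sum>k\<in>I. ennreal (c k) *
      (\<integral>\<^sup>+x. ennreal (F x) * indicator {x. 2 powr (real_of_int k - 1) \<le> F x} x \<partial>N))"
    unfolding \<Omega>_def using S F by (intro sum_mono mult_left_mono emeasure_average_level_set_le) auto
  also have "\<dots> = (\<integral>\<^sup>+x. (\<Sum>k\<in>I. ennreal (c k) *
      (ennreal (F x) * indicator {x. 2 powr (real_of_int k - 1) \<le> F x} x)) \<partial>N)"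
    by (subst nn_integral_sum) (auto simp: nn_integral_cmult)
  also have "\<dots> = (\<integral>\<^sup>+x. ennreal (\<Sum>k\<in>I. c k * (F x * indicator {x. 2 powr (real_of_int k - 1) \<le> F x} x)) \<partial>N)"
    using F0 by (intro nn_integral_cong, subst sum_ennreal[symmetric])
      (auto simp: c_def ennreal_mult indicator_def intro!: sum.cong)
  also have "\<dots> \<le> (\<integral>\<^sup>+x. ennreal W * ennreal (F x powr \<gamma>) \<partial>N)"
    using W(2) by (intro nn_integral_mono) (simp add: pointwise ennreal_leI flip: ennreal_mult)
  also have "\<dots> = ennreal (W * Z)"
    using W(2) Z by (simp add: nn_integral_cmult ennreal_mult)
  finally show ?thesis
    using W(2) Z by (simp add: W_def \<Omega>_def ennreal_le_iff)
qed

section \<open>Outer regularity\<close>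

text \<open>The sets that can be approximated from inside by closed and from outside by open sets form a
sigma-algebra. It contains the closed sets, since a closed set in a metric space is the intersection
of its open \<open>1/n\<close>-neighbourhoods.\<close>

lemma borel_closed_open_approximation:
  fixes N :: "'a::metric_space measure"
  assumes N: "sets N = sets borel" "finite_measure N" and "E \<in> sets borel" "0 < \<epsilon>"
  shows "\<exists>C U. closed C \<and> open U \<and> C \<subseteq> E \<and> E \<subseteq> U \<and> measure N (U - C) \<le> \<epsilon>"
proof -
  interpret finite_measure N by (rule N(2))
  have borel[measurable]: "C \<in> sets N" if "closed C" for C using that N by simp
  have openN: "U \<in> sets N" if "open U" for U using that N by simp
  have "E \<in> sigma_sets UNIV (Collect closed)"
    using \<open>E \<in> sets borel\<close> by (simp add: borel_eq_closed)
  then show ?thesis using \<open>0 < \<epsilon>\<close>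
  proof (induction arbitrary: \<epsilon> rule: sigma_sets.induct)
    case (Basic E)
    then have E: "closed E" by simp
    show ?case
    proof (cases "E = {}")
      case False
      define U where "U n = {x. infdist x E < 1 / real (Suc n)}" for n
      have U: "open (U n)" for n
        unfolding U_def by (intro open_Collect_less continuous_intros)
      have "decseq U"
        by (force simp: U_def decseq_Suc_iff frac_less2 intro: less_trans)
      moreover have "(\<Inter>n. U n) = E"
      proof (intro set_eqI iffI)
        fix x assume x: "x \<in> (\<Inter>n. U n)"
        have "infdist x E \<le> 0"
        proof (rule ccontr)
          assume "\<not> infdist x E \<le> 0"
          then obtain n where "1 / real (Suc n) < infdist x E"
            using nat_approx_posE by (metis not_le)
          then show False using x by (auto simp: U_def not_less dest!: spec[of _ n])
        qed
        then have "infdist x E = 0" using infdist_nonneg[of x E] by simp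
        then show "x \<in> E" using in_closed_iff_infdist_zero[OF E False] by simp
      qed (auto simp: U_def)
      ultimately have "(\<lambda>n. measure N (U n)) \<longlonglongrightarrow> measure N E"
        using finite_Lim_measure_decseq[of U] openN[OF U] by (simp add: image_subset_iff)
      then have "eventually (\<lambda>n. measure N (U n) < measure N E + \<epsilon>) sequentially"
        using Basic.prems by (intro order_tendstoD) auto
      then obtain n where n: "measure N (U n) < measure N E + \<epsilon>"
        by (auto simp: eventually_sequentially)
      have sub: "E \<subseteq> U n" using \<open>(\<Inter>n. U n) = E\<close> by blast
      then have "measure N (U n - E) \<le> \<epsilon>"
        using n E U by (subst finite_measure_Diff) (auto simp: openN)
      then show ?thesis using U sub E by blast
    next
      case True
      then show ?thesis using Basic.prems by (intro exI[of _ "{}"]) simp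
    qed
  next
    case Empty
    have "measure N ({} - {}) \<le> \<epsilon>" using Empty by simp
    then show ?case using closed_empty open_empty subset_refl by blast
  next
    case (Compl E)
    then obtain C U where "closed C" "open U" "C \<subseteq> E" "E \<subseteq> U" "measure N (U - C) \<le> \<epsilon>" by metis
    moreover have "- C - - U = U - C" by auto
    ultimately show ?case
      by (intro exI[of _ "- U"] exI[of _ "- C"]) (auto simp: Compl_eq_Diff_UNIV[symmetric])
  next
    case (Union A)
    have "\<exists>C U. closed C \<and> open U \<and> C \<subseteq> A i \<and> A i \<subseteq> U \<and> measure N (U - C) \<le> \<epsilon> / 2 * (1 / 2) ^ Suc i"
      for i using Union.prems by (intro Union.IH) simp
    then obtain C U where CU: "\<And>i. closed (C i)" "\<And>i. open (U i)" "\<And>i. C i \<subseteq> A i" "\<And>i. A i \<subseteq> U i"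
        "\<And>i. measure N (U i - C i) \<le> \<epsilon> / 2 * (1 / 2) ^ Suc i"
      by metis
    define V where "V = (\<Union>i. U i)"
    define F where "F n = (\<Union>i<n. C i)" for n
    have V: "open V" and F: "closed (F n)" for n
      using CU by (auto simp: V_def F_def)
    have "(\<lambda>n. measure N (V - F n)) \<longlonglongrightarrow> measure N (\<Inter>n. V - F n)"
      using V F by (intro finite_Lim_measure_decseq) (auto simp: openN decseq_def F_def)
    moreover have "measure N (\<Inter>n. V - F n) < \<epsilon>"
    proof -
      have bound: "summable (\<lambda>i. \<epsilon> / 2 * (1 / 2) ^ Suc i)"
        by (intro summable_mult) (auto intro: summable_ignore_initial_segment[of _ 1, simplified] summable_geometric)
      have summ: "summable (\<lambda>i. measure N (U i - C i))"
        using CU(5) by (intro summable_comparison_test'[OF bound]) auto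
      have "(\<Inter>n. V - F n) \<subseteq> (\<Union>i. U i - C i)"
        by (auto simp: V_def F_def)
      then have "measure N (\<Inter>n. V - F n) \<le> measure N (\<Union>i. U i - C i)"
        using CU(1,2) by (intro finite_measure_mono) (auto simp: openN intro!: sets.countable_UN)
      also have "\<dots> \<le> (\<Sum>i. measure N (U i - C i))"
        using CU summ by (intro finite_measure_subadditive_countably) (auto simp: openN)
      also have "\<dots> \<le> (\<Sum>i. \<epsilon> / 2 * (1 / 2) ^ Suc i)"
        using CU(5) by (intro suminf_le summ bound) auto
      also have "\<dots> = \<epsilon> / 2"
        using power_half_series by (subst suminf_mult) (auto simp: sums_iff)
      finally show ?thesis using Union.prems by simp
    qed
    ultimately have "eventually (\<lambda>n. measure N (V - F n) < \<epsilon>) sequentially"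
      by (rule order_tendstoD)
    then obtain n where "measure N (V - F n) < \<epsilon>" by (auto simp: eventually_sequentially)
    moreover have "F n \<subseteq> (\<Union>i. A i)" "(\<Union>i. A i) \<subseteq> V"
      using CU(3,4) unfolding F_def V_def by blast+
    ultimately show ?case using V F[of n] by (intro exI[of _ "F n"] exI[of _ V]) auto
  qed
qed

text \<open>Restricting the measure to an open set of finite measure reduces outer regularity to the finite case.\<close>

lemma open_outer_approximation:
  fixes \<mu> :: "'a::metric_space measure"
  assumes \<mu>: "sets \<mu> = sets borel" and V: "open V" "emeasure \<mu> V < \<infinity>"
    and E: "E \<in> sets borel" "E \<subseteq> V" and "0 < \<epsilon>"
  shows "\<exists>U. open U \<and> E \<subseteq> U \<and> U \<subseteq> V \<and> measure \<mu> U \<le> measure \<mu> E + \<epsilon>"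
proof -
  define N where "N = density \<mu> (indicator V)"
  have Vs: "V \<in> sets \<mu>" using V \<mu> by simp
  have N: "sets N = sets borel" by (simp add: N_def \<mu>)
  have eN: "emeasure N A = emeasure \<mu> (A \<inter> V)" if "A \<in> sets borel" for A
    using that Vs \<mu> by (simp add: N_def emeasure_density Int_commute flip: indicator_inter_arith)
  have "finite_measure N"
    using eN[of UNIV] V N by (intro finite_measureI) (simp add: N_def \<mu> sets_eq_imp_space_eq[OF \<mu>])
  then obtain C U where CU: "closed C" "open U" "C \<subseteq> E" "E \<subseteq> U" "measure N (U - C) \<le> \<epsilon>"
    using borel_closed_open_approximation[OF N _ E(1) \<open>0 < \<epsilon>\<close>] by metis
  have "V \<in> fmeasurable \<mu>" using V(2) Vs by (simp add: fmeasurable_def)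
  then have fm: "B \<in> fmeasurable \<mu>" if "B \<in> sets borel" "B \<subseteq> V" for B
    by (rule fmeasurableI2[OF _ that(2)]) (simp add: that(1) \<mu>)
  have "measure \<mu> (U \<inter> V) \<le> measure \<mu> (E \<union> (U \<inter> V - C))"
    using CU E V by (intro measure_mono_fmeasurable fm) (auto simp: \<mu>)
  also have "\<dots> \<le> measure \<mu> E + measure \<mu> (U \<inter> V - C)"
    using CU E V by (intro measure_Un_le) (auto simp: \<mu>)
  also have "measure \<mu> (U \<inter> V - C) = measure N (U - C)"
  proof -
    have "(U - C) \<inter> V = U \<inter> V - C" by auto
    then show ?thesis using CU by (simp add: measure_def eN)
  qed
  finally show ?thesis using CU V E by (intro exI[of _ "U \<inter> V"]) auto
qed

section \<open>Geometry of dyadic cubes\<close>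

lemma doubling_iterate:
  assumes "doubling \<mu>"
  obtains A :: real where "1 \<le> A"
    "\<And>x r n. 0 < r \<Longrightarrow> emeasure \<mu> (ball x (2 ^ n * r)) \<le> ennreal (A ^ n) * emeasure \<mu> (ball x r)"
proof -
  obtain A0 :: real where A0:
    "\<And>x r. 0 < r \<Longrightarrow> emeasure \<mu> (ball x (2 * r)) \<le> ennreal A0 * emeasure \<mu> (ball x r)"
    using assms unfolding doubling_def by blast
  define A where "A = max 1 A0"
  have A: "emeasure \<mu> (ball x (2 * r)) \<le> ennreal A * emeasure \<mu> (ball x r)" if "0 < r" for x r
    using A0[OF that] by (rule order_trans) (auto simp: A_def intro!: mult_right_mono ennreal_leI)
  have "emeasure \<mu> (ball x (2 ^ n * r)) \<le> ennreal (A ^ n) * emeasure \<mu> (ball x r)" if "0 < r" for x r n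
  proof (induction n)
    case (Suc n)
    have "emeasure \<mu> (ball x (2 * (2 ^ n * r))) \<le> ennreal A * emeasure \<mu> (ball x (2 ^ n * r))"
      using that by (intro A) simp
    also have "\<dots> \<le> ennreal A * (ennreal (A ^ n) * emeasure \<mu> (ball x r))"
      by (intro mult_left_mono Suc) simp
    finally show ?case by (simp add: A_def ennreal_mult mult_ac)
  qed simp
  then show ?thesis using that[of A] by (simp add: A_def)
qed

text \<open>Large closed balls may fail to be compact, but a small ball lies in a compact set, and doubling
carries finiteness over to all larger balls.\<close>

lemma emeasure_ball_finite:
  fixes \<mu> :: "'a::metric_space measure"
  assumes "locally compact (UNIV :: 'a set)" "admissible_measure \<mu>"
  shows "emeasure \<mu> (ball x r) < \<infinity>"
proof -
  have \<mu>: "sets \<mu> = sets borel" "doubling \<mu>" "\<And>K. compact K \<Longrightarrow> emeasure \<mu> K < \<infinity>"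
    using assms(2) by (auto simp: admissible_measure_def)
  obtain A where A: "1 \<le> A"
    "\<And>x r n. 0 < r \<Longrightarrow> emeasure \<mu> (ball x (2 ^ n * r)) \<le> ennreal (A ^ n) * emeasure \<mu> (ball x r)"
    using doubling_iterate[OF \<mu>(2)] by metis
  obtain V K where VK: "openin (top_of_set (UNIV :: 'a set)) V" "x \<in> V" "V \<subseteq> K" "compact K"
    using assms(1)[unfolded locally_def, rule_format, of UNIV x] by auto
  then have "open V" by (simp add: openin_open)
  then obtain s where s: "0 < s" "ball x s \<subseteq> K"
    using VK by (meson open_contains_ball subset_trans)
  have "emeasure \<mu> (ball x s) \<le> emeasure \<mu> K"
    using s VK(4) by (intro emeasure_mono) (auto simp: \<mu> compact_imp_closed)
  then have fin: "emeasure \<mu> (ball x s) < \<infinity>" using \<mu>(3)[OF VK(4)] by simp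
  obtain n where n: "r / s < 2 ^ n" using real_arch_pow[of 2 "r / s"] by auto
  have "emeasure \<mu> (ball x r) \<le> emeasure \<mu> (ball x (2 ^ n * s))"
    using n s by (intro emeasure_mono subset_ball) (auto simp: \<mu> field_simps)
  also have "\<dots> \<le> ennreal (A ^ n) * emeasure \<mu> (ball x s)" by (rule A(2)[OF s(1)])
  also have "\<dots> < \<infinity>" using fin by (simp add: ennreal_mult_less_top)
  finally show ?thesis .
qed

lemma borel_subset_ball_fmeasurable:
  fixes \<mu> :: "'a::metric_space measure"
  assumes "locally compact (UNIV :: 'a set)" "admissible_measure \<mu>" "B \<in> sets borel" "B \<subseteq> ball z r"
  shows "B \<in> fmeasurable \<mu>"
proof -
  have \<mu>: "sets \<mu> = sets borel" using assms(2) by (simp add: admissible_measure_def)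
  have "ball z r \<in> fmeasurable \<mu>"
    using emeasure_ball_finite[OF assms(1,2), of z r] by (simp add: fmeasurable_def \<mu>)
  then show ?thesis by (rule fmeasurableI2[OF _ assms(4)]) (simp add: assms(3) \<mu>)
qed

text \<open>Each cube lies between two concentric balls of comparable measure. The inner ball is closed and has half
the radius given by the dyadic system, so that it stays inside the cube.\<close>

lemma dyadic_cube_geometry:
  fixes \<mu> :: "'a::metric_space measure"
  assumes "locally compact (UNIV :: 'a set)" "admissible_measure \<mu>" "dyadic_system D"
  obtains \<delta> C C' :: real where "0 < \<delta>" "\<delta> < 1" "0 < C" "1 \<le> C'"
    "\<And>k Q. Q \<in> D k \<Longrightarrow> \<exists>z \<rho>. 0 < \<rho> \<and> cball z \<rho> \<subseteq> Q \<and> Q \<subseteq> ball z (C * \<delta> powi k) \<and>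
        measure \<mu> (ball z (C * \<delta> powi k)) \<le> C' * measure \<mu> (cball z \<rho>)"
proof -
  have \<mu>: "sets \<mu> = sets borel" "doubling \<mu>"
    using assms(2) by (auto simp: admissible_measure_def)
  obtain A where A: "1 \<le> A"
    "\<And>x r n. 0 < r \<Longrightarrow> emeasure \<mu> (ball x (2 ^ n * r)) \<le> ennreal (A ^ n) * emeasure \<mu> (ball x r)"
    using doubling_iterate[OF \<mu>(2)] by metis
  obtain \<delta> c C where c: "0 < \<delta>" "\<delta> < 1" "0 < c" "c \<le> C"
    "\<And>k Q. Q \<in> D k \<Longrightarrow> \<exists>z. ball z (c * \<delta> powi k) \<subseteq> Q \<and> Q \<subseteq> ball z (C * \<delta> powi k)"
    using assms(3) unfolding dyadic_system_def by metis
  obtain n where n: "2 * C / c < 2 ^ n" using real_arch_pow[of 2 "2 * C / c"] by auto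
  note fin = borel_subset_ball_fmeasurable[OF assms(1,2)]
  have "\<exists>z \<rho>. 0 < \<rho> \<and> cball z \<rho> \<subseteq> Q \<and> Q \<subseteq> ball z (C * \<delta> powi k) \<and>
        measure \<mu> (ball z (C * \<delta> powi k)) \<le> A ^ n * measure \<mu> (cball z \<rho>)" if Q: "Q \<in> D k" for k Q
  proof -
    obtain z where z: "ball z (c * \<delta> powi k) \<subseteq> Q" "Q \<subseteq> ball z (C * \<delta> powi k)"
      using c(5)[OF Q] by metis
    define \<rho> where "\<rho> = c * \<delta> powi k / 2"
    have \<rho>: "0 < \<rho>" using c by (simp add: \<rho>_def zero_less_power_int)
    have pk: "0 < \<delta> powi k" using c by (simp add: zero_less_power_int)
    have "2 * C < c * 2 ^ n" using n c by (simp add: field_simps)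
    then have big: "C * \<delta> powi k \<le> 2 ^ n * \<rho>"
      using pk by (simp add: \<rho>_def field_simps)
    have "emeasure \<mu> (ball z (C * \<delta> powi k)) \<le> emeasure \<mu> (ball z (2 ^ n * \<rho>))"
      using big by (intro emeasure_mono subset_ball) (auto simp: \<mu>)
    also have "\<dots> \<le> ennreal (A ^ n) * emeasure \<mu> (ball z \<rho>)" by (rule A(2)[OF \<rho>])
    also have "\<dots> \<le> ennreal (A ^ n) * emeasure \<mu> (cball z \<rho>)"
      by (intro mult_left_mono emeasure_mono) (auto simp: \<mu>)
    finally have "emeasure \<mu> (ball z (C * \<delta> powi k)) \<le> ennreal (A ^ n) * emeasure \<mu> (cball z \<rho>)" .
    moreover have "cball z \<rho> \<subseteq> ball z (2 * \<rho>)" using \<rho> by auto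
    moreover have "ball z (2 * \<rho>) \<subseteq> Q" using z by (simp add: \<rho>_def)
    ultimately have "measure \<mu> (ball z (C * \<delta> powi k)) \<le> A ^ n * measure \<mu> (cball z \<rho>)"
      using A(1) fin[of "ball z (C * \<delta> powi k)" z "C * \<delta> powi k"] fin[of "cball z \<rho>" z "2 * \<rho>"]
      by (simp add: emeasure_eq_measure2 flip: ennreal_mult)
    then show ?thesis
      using \<rho> z \<open>cball z \<rho> \<subseteq> ball z (2 * \<rho>)\<close> \<open>ball z (2 * \<rho>) \<subseteq> Q\<close>
      by (intro exI[of _ z] exI[of _ \<rho>]) auto
  qed
  then show ?thesis using that[of \<delta> C "A ^ n"] c A(1) by (simp add: one_le_power)
qed

lemma cube_in_borel: "dyadic_system D \<Longrightarrow> Q \<in> cubes D \<Longrightarrow> Q \<in> sets borel"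
  by (auto simp: dyadic_system_def cubes_def)

lemma measure_ball_pos:
  fixes \<mu> :: "'a::metric_space measure"
  assumes "locally compact (UNIV :: 'a set)" "admissible_measure \<mu>" "0 < r"
  shows "0 < measure \<mu> (ball z r)"
proof -
  have "0 < emeasure \<mu> (ball z r)"
    using assms(2,3) unfolding admissible_measure_def by (metis ball_eq_empty not_le open_ball)
  then show ?thesis
    using emeasure_ball_finite[OF assms(1,2), of z r] by (simp add: measure_def enn2real_positive_iff)
qed

lemma cube_measure:
  fixes \<mu> :: "'a::metric_space measure"
  assumes "locally compact (UNIV :: 'a set)" "admissible_measure \<mu>" "dyadic_system D" "Q \<in> cubes D"
  shows "Q \<in> fmeasurable \<mu>" "0 < measure \<mu> Q"
proof -
  obtain k where k: "Q \<in> D k" using assms(4) by (auto simp: cubes_def)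
  obtain \<delta> C C' z \<rho> where z: "0 < \<rho>" "cball z \<rho> \<subseteq> Q" "Q \<subseteq> ball z (C * \<delta> powi k)"
    using dyadic_cube_geometry[OF assms(1-3)] k by metis
  show fm: "Q \<in> fmeasurable \<mu>"
    using borel_subset_ball_fmeasurable[OF assms(1,2) cube_in_borel[OF assms(3,4)] z(3)] .
  have "0 < measure \<mu> (ball z \<rho>)" by (rule measure_ball_pos[OF assms(1,2) z(1)])
  also have "\<dots> \<le> measure \<mu> Q"
    using fm z assms(2) by (intro measure_mono_fmeasurable) (auto simp: admissible_measure_def)
  finally show "0 < measure \<mu> Q" .
qed

lemma dyadic_generation_parent:
  assumes "dyadic_system D" "Q \<in> D k" "Q' \<in> D (k + 1)" "x \<in> Q" "x \<in> Q'"
  shows "Q' \<subseteq> Q"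
proof -
  obtain Q'' where Q'': "Q'' \<in> D k" "Q' \<subseteq> Q''" using assms(1,3) unfolding dyadic_system_def by metis
  have "disjoint (D k)" using assms(1) by (simp add: dyadic_system_def partition_on_def)
  then have "Q'' = Q" using Q'' assms by (auto simp: disjoint_def)
  then show ?thesis using Q'' by simp
qed

text \<open>This replaces a covering theorem. The cubes of generation \<open>k\<close> inside \<open>U\<close> exhaust \<open>U\<close> as \<open>k\<close> grows, so
finitely many of them, for some \<open>k\<close>, cover half of the measure of \<open>U\<close>. Disjointness comes for
free, and the inner balls keep a fixed proportion of each cube. Closed balls are used so that removing
finitely many of them leaves an open set.\<close>

lemma disjoint_closed_balls_fill:
  fixes \<mu> :: "'a::metric_space measure" and D :: "int \<Rightarrow> 'a set set"
  assumes "locally compact (UNIV :: 'a set)" "admissible_measure \<mu>" "dyadic_system D"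
  obtains \<eta> :: real where "0 < \<eta>" "\<eta> \<le> 1"
    "\<And>U. open U \<Longrightarrow> emeasure \<mu> U < \<infinity> \<Longrightarrow> \<exists>\<B>. finite \<B> \<and> pairwise disjnt \<B> \<and>
        (\<forall>B\<in>\<B>. \<exists>z \<rho>. B = cball z \<rho>) \<and> \<Union>\<B> \<subseteq> U \<and> \<eta> * measure \<mu> U \<le> measure \<mu> (\<Union>\<B>)"
proof -
  obtain \<delta> C C' :: real where \<delta>: "0 < \<delta>" "\<delta> < 1" "0 < C" "1 \<le> C'"
    and geom: "\<And>k Q. Q \<in> D k \<Longrightarrow> \<exists>z \<rho>. 0 < \<rho> \<and> cball z \<rho> \<subseteq> Q \<and> Q \<subseteq> ball z (C * \<delta> powi k) \<and>
        measure \<mu> (ball z (C * \<delta> powi k)) \<le> C' * measure \<mu> (cball z \<rho>)"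
    using dyadic_cube_geometry[OF assms] by metis
  have \<mu>: "sets \<mu> = sets borel" using assms(2) by (simp add: admissible_measure_def)
  have part: "countable (D k)" "disjoint (D k)" "\<Union>(D k) = UNIV" "\<And>Q. Q \<in> D k \<Longrightarrow> Q \<in> sets \<mu>" for k
    using assms(3) by (auto simp: dyadic_system_def partition_on_def \<mu>)
  have fmD: "Q \<in> fmeasurable \<mu>" if "Q \<in> D k" for Q k
    using that by (intro cube_measure[OF assms]) (auto simp: cubes_def)
  have "\<exists>\<B>. finite \<B> \<and> pairwise disjnt \<B> \<and> (\<forall>B\<in>\<B>. \<exists>z \<rho>. B = cball z \<rho>) \<and> \<Union>\<B> \<subseteq> U \<and>
      1 / (2 * C') * measure \<mu> U \<le> measure \<mu> (\<Union>\<B>)" if U: "open U" "emeasure \<mu> U < \<infinity>" for U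
  proof (cases "measure \<mu> U = 0")
    case True
    then show ?thesis by (intro exI[of _ "{}"]) simp
  next
    case False
    then have mU: "measure \<mu> U / 2 < measure \<mu> U" using measure_nonneg[of \<mu> U] by linarith
    define P where "P k = {Q \<in> D (int k). Q \<subseteq> U}" for k :: nat
    have P: "P k \<subseteq> D (int k)" "countable (P k)" for k
      using part(1)[of "int k"] by (auto simp: P_def intro: countable_subset)
    have Psets: "\<Union>(P k) \<in> sets \<mu>" for k
      using P[of k] part(4) by (intro sets.countable_Union) auto
    have "incseq (\<lambda>k. \<Union>(P k))"
    proof (intro incseq_SucI subsetI)
      fix k x assume "x \<in> \<Union>(P k)"
      then obtain Q where Q: "Q \<in> D (int k)" "Q \<subseteq> U" "x \<in> Q" by (auto simp: P_def)
      obtain Q' where Q': "Q' \<in> D (int k + 1)" "x \<in> Q'" using UNIV_I[of x] unfolding part(3)[of "int k + 1", symmetric] by (rule UnionE)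
      have "Q' \<subseteq> Q" using dyadic_generation_parent[OF assms(3) Q(1) Q'(1) Q(3) Q'(2)] .
      then have "Q' \<in> P (Suc k)" using Q(2) Q'(1) by (simp add: P_def add.commute)
      then show "x \<in> \<Union>(P (Suc k))" using Q'(2) by (rule UnionI)
    qed
    moreover have "(\<Union>k. \<Union>(P k)) = U"
    proof (intro set_eqI iffI)
      fix x assume "x \<in> U"
      then obtain e where e: "0 < e" "ball x e \<subseteq> U" using U(1) open_contains_ball by metis
      obtain k where k: "\<delta> ^ k < e / (2 * C)"
        using real_arch_pow_inv[of "e / (2 * C)" \<delta>] e \<delta> by auto
      obtain Q where Q: "Q \<in> D (int k)" "x \<in> Q" using UNIV_I[of x] unfolding part(3)[of "int k", symmetric] by (rule UnionE)
      obtain z where z: "Q \<subseteq> ball z (C * \<delta> ^ k)" using geom[OF Q(1)] by auto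
      have "Q \<subseteq> ball x e"
      proof
        fix y assume "y \<in> Q"
        then have "dist z y < C * \<delta> ^ k" "dist z x < C * \<delta> ^ k" using z Q by auto
        then have "dist x y < 2 * C * \<delta> ^ k" using dist_triangle3[of x y z] by simp
        also have "\<dots> < e" using k \<delta> by (simp add: field_simps)
        finally show "y \<in> ball x e" by simp
      qed
      then show "x \<in> (\<Union>k. \<Union>(P k))" using Q e by (auto simp: P_def)
    qed (auto simp: P_def)
    ultimately have "(\<lambda>k. measure \<mu> (\<Union>(P k))) \<longlonglongrightarrow> measure \<mu> U"
      using Lim_measure_incseq[of "\<lambda>k. \<Union>(P k)" \<mu>] Psets U by (simp add: image_subset_iff less_top)
    then obtain k where k: "measure \<mu> U / 2 < measure \<mu> (\<Union>(P k))"
      using order_tendstoD(1)[OF _ mU] by (metis eventually_sequentially order_refl)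
    have "P k \<noteq> {}" using k measure_nonneg[of \<mu> U] by (intro notI) simp
    define q where "q = from_nat_into (P k)"
    have q: "range q = P k" unfolding q_def using \<open>P k \<noteq> {}\<close> P(2) by (rule range_from_nat_into)
    have qD: "q i \<in> D (int k)" "q i \<subseteq> U" for i using q by (auto simp: P_def)
    have "(\<Union>n. \<Union>i<n. q i) = \<Union>(P k)" unfolding q[symmetric] by auto
    moreover have "emeasure \<mu> (\<Union>(P k)) \<noteq> \<infinity>"
    proof -
      have "emeasure \<mu> (\<Union>(P k)) \<le> emeasure \<mu> U"
        using U by (intro emeasure_mono) (auto simp: P_def \<mu>)
      then show ?thesis using U(2) by auto
    qed
    ultimately have "(\<lambda>n. measure \<mu> (\<Union>i<n. q i)) \<longlonglongrightarrow> measure \<mu> (\<Union>(P k))"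
    proof (subst \<open>(\<Union>n. \<Union>i<n. q i) = \<Union>(P k)\<close>[symmetric], intro Lim_measure_incseq)
      show "range (\<lambda>n. \<Union>i<n. q i) \<subseteq> sets \<mu>" using part(4)[OF qD(1)] by auto
      show "incseq (\<lambda>n. \<Union>i<n. q i)" by (intro incseq_SucI UN_mono) auto
    qed simp
    then obtain n where n: "measure \<mu> U / 2 < measure \<mu> (\<Union>i<n. q i)"
      using order_tendstoD(1)[OF _ k] by (metis eventually_sequentially order_refl)
    define \<Q> where "\<Q> = q ` {..<n}"
    have \<Q>: "finite \<Q>" "\<Q> \<subseteq> D (int k)" "\<Union>\<Q> \<subseteq> U"
      using qD by (auto simp: \<Q>_def)
    have "\<exists>z \<rho>. 0 < \<rho> \<and> cball z \<rho> \<subseteq> Q \<and> measure \<mu> Q \<le> C' * measure \<mu> (cball z \<rho>)" if "Q \<in> \<Q>" for Q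
    proof -
      have Q: "Q \<in> D (int k)" using that \<Q> by auto
      obtain z \<rho> where z: "0 < \<rho>" "cball z \<rho> \<subseteq> Q" "Q \<subseteq> ball z (C * \<delta> powi int k)"
        "measure \<mu> (ball z (C * \<delta> powi int k)) \<le> C' * measure \<mu> (cball z \<rho>)"
        using geom[OF Q] by metis
      have "measure \<mu> Q \<le> measure \<mu> (ball z (C * \<delta> powi int k))"
        using z part(4)[OF Q]
        by (intro measure_mono_fmeasurable borel_subset_ball_fmeasurable[OF assms(1,2), of _ z "C * \<delta> powi int k"]) auto
      then show ?thesis using z by (intro exI[of _ z] exI[of _ \<rho>]) auto
    qed
    then obtain z \<rho> where z: "\<And>Q. Q \<in> \<Q> \<Longrightarrow> 0 < \<rho> Q" "\<And>Q. Q \<in> \<Q> \<Longrightarrow> cball (z Q) (\<rho> Q) \<subseteq> Q"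
      "\<And>Q. Q \<in> \<Q> \<Longrightarrow> measure \<mu> Q \<le> C' * measure \<mu> (cball (z Q) (\<rho> Q))"
      by metis
    define b where "b Q = cball (z Q) (\<rho> Q)" for Q
    have dis: "pairwise (\<lambda>Q R. disjnt (b Q) (b R)) \<Q>"
    proof (intro pairwiseI)
      fix Q R assume QR: "Q \<in> \<Q>" "R \<in> \<Q>" "Q \<noteq> R"
      then have "Q \<inter> R = {}" using \<Q>(2) by (intro disjointD[OF part(2)]) auto
      then show "disjnt (b Q) (b R)"
        using Int_mono[OF z(2)[OF QR(1)] z(2)[OF QR(2)]] by (simp add: b_def disjnt_def)
    qed
    have bfm: "b Q \<in> fmeasurable \<mu>" if "Q \<in> \<Q>" for Q
      unfolding b_def
      by (rule fmeasurableI2[OF fmD[OF subsetD[OF \<Q>(2) that]] z(2)[OF that]]) (simp add: \<mu>)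
    have "measure \<mu> U / 2 \<le> measure \<mu> (\<Union>\<Q>)" using n by (simp add: \<Q>_def)
    also have "\<dots> \<le> (\<Sum>Q\<in>\<Q>. measure \<mu> Q)"
      using \<Q> part(4) by (intro measure_Union_le) auto
    also have "\<dots> \<le> (\<Sum>Q\<in>\<Q>. C' * measure \<mu> (b Q))" unfolding b_def by (intro sum_mono z(3))
    also have "\<dots> = C' * measure \<mu> (\<Union>Q\<in>\<Q>. b Q)"
      using measure_UNION'[OF \<Q>(1) bfm dis] by (simp add: sum_distrib_left)
    finally have "1 / (2 * C') * measure \<mu> U \<le> measure \<mu> (\<Union>(b ` \<Q>))"
      using \<delta>(4) by (simp add: field_simps)
    moreover have "\<Union>(b ` \<Q>) \<subseteq> U" using z(2) \<Q>(3) by (fastforce simp: b_def)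
    moreover have "pairwise disjnt (b ` \<Q>)"
      using dis by (auto simp: pairwise_def)
    ultimately show ?thesis using \<Q>(1) by (intro exI[of _ "b ` \<Q>"]) (auto simp: b_def)
  qed
  then show ?thesis using that[of "1 / (2 * C')"] \<delta>(4) by simp
qed

section \<open>The maximal function dominates the function\<close>

lemma hl_maximal_ge_avg:
  "0 < s \<Longrightarrow> x \<in> ball y s \<Longrightarrow> avg \<mu> (\<lambda>z. \<bar>h z\<bar>) (ball y s) \<le> hl_maximal \<mu> h x"
  unfolding hl_maximal_def by (rule SUP_upper) auto

lemma borel_measurable_hl_maximal:
  fixes \<mu> :: "'a::metric_space measure"
  assumes "sets \<mu> = sets borel"
  shows "hl_maximal \<mu> h \<in> borel_measurable \<mu>"
proof (rule borel_measurableI_greater)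
  fix t :: ennreal
  have "{x \<in> space \<mu>. t < hl_maximal \<mu> h x}
      = \<Union>{ball y s | y s. 0 < s \<and> t < avg \<mu> (\<lambda>z. \<bar>h z\<bar>) (ball y s)}"
  proof (intro set_eqI iffI)
    fix x assume "x \<in> {x \<in> space \<mu>. t < hl_maximal \<mu> h x}"
    then obtain y s where "0 < s" "x \<in> ball y s" "t < avg \<mu> (\<lambda>z. \<bar>h z\<bar>) (ball y s)"
      unfolding hl_maximal_def by (auto simp: less_SUP_iff)
    then show "x \<in> \<Union>{ball y s | y s. 0 < s \<and> t < avg \<mu> (\<lambda>z. \<bar>h z\<bar>) (ball y s)}"
      by (intro UnionI[of "ball y s"]) auto
  next
    fix x assume "x \<in> \<Union>{ball y s | y s. 0 < s \<and> t < avg \<mu> (\<lambda>z. \<bar>h z\<bar>) (ball y s)}"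
    then obtain y s where "0 < s" "x \<in> ball y s" "t < avg \<mu> (\<lambda>z. \<bar>h z\<bar>) (ball y s)"
      by auto
    then have "t < hl_maximal \<mu> h x" using hl_maximal_ge_avg[of s x y \<mu> h] by (metis less_le_trans)
    then show "x \<in> {x \<in> space \<mu>. t < hl_maximal \<mu> h x}"
      by (simp add: sets_eq_imp_space_eq[OF assms])
  qed
  also have "open \<dots>" by (intro open_Union) auto
  then have "\<dots> \<in> sets \<mu>" by (simp add: assms)
  finally show "{x \<in> space \<mu>. t < hl_maximal \<mu> h x} \<in> sets \<mu>" .
qed

lemma avg_mult_measure:
  assumes "Q \<in> fmeasurable \<mu>" "0 < measure \<mu> Q"
  shows "avg \<mu> h Q * ennreal (measure \<mu> Q) = (\<integral>\<^sup>+x\<in>Q. ennreal (h x) \<partial>\<mu>)"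
  using assms
  by (simp add: avg_def emeasure_eq_measure2 ennreal_divide_times ennreal_times_divide mult_divide_eq_ennreal)

text \<open>The maximal function at one point of \<open>E \<inter> cball z \<rho>\<close> controls the averages over all larger open balls
with centre \<open>z\<close>, and these shrink to the closed ball.\<close>

lemma superlevel_measure_closed_ball_le:
  fixes \<mu> :: "'a::metric_space measure"
  assumes X: "locally compact (UNIV :: 'a set)" "admissible_measure \<mu>"
    and E: "E \<in> sets \<mu>" "\<And>x. x \<in> E \<Longrightarrow> hl_maximal \<mu> h x \<le> ennreal \<alpha>" "\<And>x. x \<in> E \<Longrightarrow> \<beta> \<le> \<bar>h x\<bar>"
    and "0 \<le> \<alpha>" "0 \<le> \<beta>"
  shows "\<beta> * measure \<mu> (E \<inter> cball z \<rho>) \<le> \<alpha> * measure \<mu> (cball z \<rho>)"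
proof (cases "E \<inter> cball z \<rho> = {}")
  case False
  then obtain x where x: "x \<in> E" "dist z x \<le> \<rho>" by auto
  then have "0 \<le> \<rho>" using zero_le_dist[of z x] by linarith
  have \<mu>: "sets \<mu> = sets borel" using X by (simp add: admissible_measure_def)
  define B where "B n = ball z (\<rho> + 1 / real (Suc n))" for n
  have B: "B n \<in> fmeasurable \<mu>" "0 < measure \<mu> (B n)" for n
    using emeasure_ball_finite[OF X, of z "\<rho> + 1 / real (Suc n)"] \<open>0 \<le> \<rho>\<close>
      measure_ball_pos[OF X, of "\<rho> + 1 / real (Suc n)" z]
    by (auto simp: B_def fmeasurable_def \<mu> add_nonneg_pos)
  have sub: "cball z \<rho> \<subseteq> B n" for n
  proof
    fix y assume "y \<in> cball z \<rho>"
    then have "dist z y \<le> \<rho>" by simp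
    moreover have "0 < 1 / real (Suc n)" by simp
    ultimately show "y \<in> B n" unfolding B_def mem_ball by linarith
  qed
  have le: "\<beta> * measure \<mu> (E \<inter> cball z \<rho>) \<le> \<alpha> * measure \<mu> (B n)" for n
  proof -
    have fm: "E \<inter> cball z \<rho> \<in> fmeasurable \<mu>"
      by (rule fmeasurableI2[OF B(1)[of n] le_infI2[OF sub]]) (intro sets.Int E(1), simp add: \<mu>)
    have "ennreal (\<beta> * measure \<mu> (E \<inter> cball z \<rho>)) = ennreal \<beta> * emeasure \<mu> (E \<inter> cball z \<rho>)"
      using fm \<open>0 \<le> \<beta>\<close> by (simp add: emeasure_eq_measure2 ennreal_mult)
    also have "\<dots> = (\<integral>\<^sup>+y. ennreal \<beta> * indicator (E \<inter> cball z \<rho>) y \<partial>\<mu>)"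
      using fm by (simp add: nn_integral_cmult_indicator fmeasurableD)
    also have "\<dots> \<le> (\<integral>\<^sup>+y\<in>B n. ennreal \<bar>h y\<bar> \<partial>\<mu>)"
      using E(3) sub[of n] by (intro nn_integral_mono) (auto simp: indicator_def intro!: ennreal_leI)
    also have "\<dots> = avg \<mu> (\<lambda>z. \<bar>h z\<bar>) (B n) * ennreal (measure \<mu> (B n))"
      by (rule avg_mult_measure[OF B, symmetric])
    also have "\<dots> \<le> ennreal \<alpha> * ennreal (measure \<mu> (B n))"
    proof (rule mult_right_mono)
      have "x \<in> B n" by (rule subsetD[OF sub]) (simp add: x)
      then have "avg \<mu> (\<lambda>z. \<bar>h z\<bar>) (B n) \<le> hl_maximal \<mu> h x"
        unfolding B_def using \<open>0 \<le> \<rho>\<close> by (intro hl_maximal_ge_avg) (auto simp: add_nonneg_pos)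
      also have "\<dots> \<le> ennreal \<alpha>" by (rule E(2)[OF x(1)])
      finally show "avg \<mu> (\<lambda>z. \<bar>h z\<bar>) (B n) \<le> ennreal \<alpha>" .
    qed simp
    also have "\<dots> = ennreal (\<alpha> * measure \<mu> (B n))"
      using \<open>0 \<le> \<alpha>\<close> by (simp add: ennreal_mult)
    finally show ?thesis using \<open>0 \<le> \<alpha>\<close> by (simp add: ennreal_le_iff)
  qed
  have "(\<Inter>n. B n) = cball z \<rho>"
  proof (intro set_eqI iffI)
    fix y assume y: "y \<in> (\<Inter>n. B n)"
    show "y \<in> cball z \<rho>"
    proof (rule ccontr)
      assume "y \<notin> cball z \<rho>"
      then obtain n where "1 / real (Suc n) < dist z y - \<rho>"
        using nat_approx_posE[of "dist z y - \<rho>"] by auto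
      moreover have "y \<in> B n" using y by blast
      ultimately show False by (simp add: B_def)
    qed
  next
    fix y assume "y \<in> cball z \<rho>"
    then show "y \<in> (\<Inter>n. B n)" by (intro INT_I subsetD[OF sub])
  qed
  moreover have "(\<lambda>n. measure \<mu> (B n)) \<longlonglongrightarrow> measure \<mu> (\<Inter>n. B n)"
  proof (rule Lim_measure_decseq)
    show "range B \<subseteq> sets \<mu>" using B by (auto simp: fmeasurableD)
    show "decseq B"
      unfolding B_def decseq_Suc_iff by (intro allI subset_ball add_left_mono divide_left_mono) auto
    show "emeasure \<mu> (B n) \<noteq> \<infinity>" for n using B(1)[of n] by (auto simp: fmeasurable_def)
  qed
  ultimately have "(\<lambda>n. \<alpha> * measure \<mu> (B n)) \<longlonglongrightarrow> \<alpha> * measure \<mu> (cball z \<rho>)"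
    by (intro tendsto_mult_left) simp
  then show ?thesis by (rule LIMSEQ_le_const) (use le in auto)
qed (use \<open>0 \<le> \<alpha>\<close> in simp)

text \<open>Fill \<open>U\<close> with disjoint closed balls, use the estimate on them, and repeat in the open
remainder. After \<open>n\<close> rounds at most the part \<open>(1 - \<eta>) ^ n\<close> of \<open>U\<close> is left, on which the trivial bound is
used.\<close>

lemma superlevel_measure_open_le:
  fixes \<mu> :: "'a::metric_space measure" and D :: "int \<Rightarrow> 'a set set"
  assumes X: "locally compact (UNIV :: 'a set)" "admissible_measure \<mu>" "dyadic_system D"
    and E: "E \<in> sets \<mu>" "\<And>x. x \<in> E \<Longrightarrow> hl_maximal \<mu> h x \<le> ennreal \<alpha>" "\<And>x. x \<in> E \<Longrightarrow> \<beta> \<le> \<bar>h x\<bar>"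
    and ab: "0 \<le> \<alpha>" "0 \<le> \<beta>" and U: "open U" "emeasure \<mu> U < \<infinity>"
  shows "\<beta> * measure \<mu> (E \<inter> U) \<le> \<alpha> * measure \<mu> U"
proof -
  have \<mu>: "sets \<mu> = sets borel" using X by (simp add: admissible_measure_def)
  obtain \<eta> :: real where \<eta>: "0 < \<eta>" "\<eta> \<le> 1"
    and fill: "\<And>U. open U \<Longrightarrow> emeasure \<mu> U < \<infinity> \<Longrightarrow> \<exists>\<B>. finite \<B> \<and> pairwise disjnt \<B> \<and>
        (\<forall>B\<in>\<B>. \<exists>z \<rho>. B = cball z \<rho>) \<and> \<Union>\<B> \<subseteq> U \<and> \<eta> * measure \<mu> U \<le> measure \<mu> (\<Union>\<B>)"
    using disjoint_closed_balls_fill[OF X] by metis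
  have step: "\<beta> * measure \<mu> (E \<inter> U) \<le> \<alpha> * measure \<mu> U + \<beta> * ((1 - \<eta>) ^ n * measure \<mu> U)"
    if "open U" "emeasure \<mu> U < \<infinity>" for U n
    using that
  proof (induction n arbitrary: U)
    case 0
    have "U \<in> fmeasurable \<mu>" using 0 by (simp add: fmeasurable_def \<mu>)
    then have "measure \<mu> (E \<inter> U) \<le> measure \<mu> U"
      using E(1) by (intro measure_mono_fmeasurable) (auto simp: fmeasurableD)
    then have "\<beta> * measure \<mu> (E \<inter> U) \<le> \<beta> * measure \<mu> U"
      using ab by (intro mult_left_mono)
    moreover have "0 \<le> \<alpha> * measure \<mu> U" using ab by simp
    ultimately show ?case unfolding power_0 mult_1 by linarith
  next
    case (Suc n)
    have Ufm: "U \<in> fmeasurable \<mu>" using Suc.prems by (simp add: fmeasurable_def \<mu>)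
    obtain \<B> where \<B>: "finite \<B>" "pairwise disjnt \<B>" "\<And>B. B \<in> \<B> \<Longrightarrow> \<exists>z \<rho>. B = cball z \<rho>"
        "\<Union>\<B> \<subseteq> U" "\<eta> * measure \<mu> U \<le> measure \<mu> (\<Union>\<B>)"
      using fill[OF Suc.prems] by metis
    have closed: "closed B" if "B \<in> \<B>" for B using \<B>(3)[OF that] by auto
    define K where "K = \<Union>\<B>"
    have K: "closed K" "K \<subseteq> U" unfolding K_def using \<B> closed by (auto intro: closed_Union)
    have Bfm: "B \<in> fmeasurable \<mu>" if "B \<in> \<B>" for B
      by (rule fmeasurableI2[OF Ufm subset_trans[OF Union_upper[OF that] \<B>(4)]])
         (simp add: \<mu> closed[OF that])
    have Kfm: "K \<in> fmeasurable \<mu>"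
      by (rule fmeasurableI2[OF Ufm K(2)]) (simp add: \<mu> K(1))
    have U1: "open (U - K)" "emeasure \<mu> (U - K) < \<infinity>" "U - K \<in> fmeasurable \<mu>"
    proof -
      show "open (U - K)" using Suc.prems K by (simp add: open_Diff)
      show "U - K \<in> fmeasurable \<mu>" using Ufm Kfm by (intro fmeasurable.Diff)
      then show "emeasure \<mu> (U - K) < \<infinity>" by (simp add: fmeasurable_def)
    qed
    have mU: "measure \<mu> (U - K) = measure \<mu> U - measure \<mu> K"
      using Ufm Kfm K by (intro measurable_measure_Diff) (auto simp: fmeasurableD)
    have onK: "\<beta> * measure \<mu> (E \<inter> K) \<le> \<alpha> * measure \<mu> K"
    proof -
      have EB: "E \<inter> B \<in> fmeasurable \<mu>" if "B \<in> \<B>" for B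
        using fmeasurable_Int_fmeasurable[OF Bfm[OF that] E(1)] by (simp add: Int_commute)
      have "measure \<mu> (\<Union>B\<in>\<B>. E \<inter> B) = (\<Sum>B\<in>\<B>. measure \<mu> (E \<inter> B))"
        using \<B> EB by (intro measure_UNION') (auto simp: pairwise_def disjnt_def)
      moreover have "(\<Union>B\<in>\<B>. E \<inter> B) = E \<inter> K" by (auto simp: K_def)
      ultimately have "\<beta> * measure \<mu> (E \<inter> K) = (\<Sum>B\<in>\<B>. \<beta> * measure \<mu> (E \<inter> B))"
        by (simp add: sum_distrib_left)
      also have "\<dots> \<le> (\<Sum>B\<in>\<B>. \<alpha> * measure \<mu> B)"
      proof (rule sum_mono)
        fix B assume "B \<in> \<B>"
        then obtain z \<rho> where "B = cball z \<rho>" using \<B>(3) by metis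
        then show "\<beta> * measure \<mu> (E \<inter> B) \<le> \<alpha> * measure \<mu> B"
          using superlevel_measure_closed_ball_le[OF X(1,2) E ab] by simp
      qed
      also have "\<dots> = \<alpha> * measure \<mu> K"
        using measure_Union'[OF \<B>(1) Bfm \<B>(2)] by (simp add: K_def sum_distrib_left)
      finally show ?thesis .
    qed
    have "measure \<mu> (E \<inter> U) = measure \<mu> ((E \<inter> K) \<union> (E \<inter> (U - K)))"
      using K by (intro arg_cong[where f = "measure \<mu>"]) auto
    also have "\<dots> \<le> measure \<mu> (E \<inter> K) + measure \<mu> (E \<inter> (U - K))"
      using E(1) Kfm U1(3) by (intro measure_Un_le) (auto simp: fmeasurableD)
    finally have "\<beta> * measure \<mu> (E \<inter> U) \<le> \<beta> * measure \<mu> (E \<inter> K) + \<beta> * measure \<mu> (E \<inter> (U - K))"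
      using ab by (metis distrib_left mult_left_mono)
    also have "\<dots> \<le> \<alpha> * measure \<mu> K +
        (\<alpha> * measure \<mu> (U - K) + \<beta> * ((1 - \<eta>) ^ n * measure \<mu> (U - K)))"
      using onK Suc.IH[OF U1(1,2)] by (rule add_mono)
    also have "\<dots> = \<alpha> * measure \<mu> U + \<beta> * ((1 - \<eta>) ^ n * measure \<mu> (U - K))"
      by (simp add: mU algebra_simps)
    also have "\<dots> \<le> \<alpha> * measure \<mu> U + \<beta> * ((1 - \<eta>) ^ n * ((1 - \<eta>) * measure \<mu> U))"
    proof (intro add_left_mono mult_left_mono)
      show "measure \<mu> (U - K) \<le> (1 - \<eta>) * measure \<mu> U"
        using \<B>(5)[folded K_def] by (simp add: mU algebra_simps)
    qed (use ab \<eta> in auto)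
    also have "\<dots> = \<alpha> * measure \<mu> U + \<beta> * ((1 - \<eta>) ^ Suc n * measure \<mu> U)" by simp
    finally show ?case .
  qed
  have "(\<lambda>n. \<alpha> * measure \<mu> U + \<beta> * ((1 - \<eta>) ^ n * measure \<mu> U))
      \<longlonglongrightarrow> \<alpha> * measure \<mu> U + \<beta> * (0 * measure \<mu> U)"
    using \<eta> by (intro tendsto_intros LIMSEQ_power_zero) auto
  then have "\<beta> * measure \<mu> (E \<inter> U) \<le> \<alpha> * measure \<mu> U + \<beta> * (0 * measure \<mu> U)"
    by (rule LIMSEQ_le_const) (use step[OF U] in blast)
  then show ?thesis by simp
qed

text \<open>The exceptional set is a countable union of sets \<open>E\<close> on which \<open>M h \<le> \<alpha> < \<beta> \<le> |h|\<close>. Applying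
\<open>superlevel_measure_open_le\<close> to open sets shrinking to such an \<open>E\<close> gives
\<open>\<beta> * |E| \<le> \<alpha> * |E|\<close>, so \<open>E\<close> is a null set.\<close>

lemma AE_le_hl_maximal:
  fixes \<mu> :: "'a::metric_space measure" and D :: "int \<Rightarrow> 'a set set"
  assumes X: "locally compact (UNIV :: 'a set)" "admissible_measure \<mu>" "dyadic_system D"
    and h[measurable]: "h \<in> borel_measurable \<mu>"
  shows "AE x in \<mu>. ennreal \<bar>h x\<bar> \<le> hl_maximal \<mu> h x"
proof -
  have \<mu>: "sets \<mu> = sets borel" using X by (simp add: admissible_measure_def)
  note [measurable] = borel_measurable_hl_maximal[OF \<mu>, of h]
  define E where "E \<alpha> \<beta> n = {x \<in> space \<mu>. hl_maximal \<mu> h x \<le> ennreal (of_rat \<alpha>) \<and>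
    of_rat \<beta> \<le> \<bar>h x\<bar> \<and> x \<in> ball undefined (real n)}" for \<alpha> \<beta> :: rat and n :: nat
  have null: "AE x in \<mu>. x \<notin> E \<alpha> \<beta> n" if ab: "0 \<le> \<alpha>" "\<alpha> < \<beta>" for \<alpha> \<beta> n
  proof -
    define V where "V = ball (undefined :: 'a) (real n)"
    define a b :: real where "a = of_rat \<alpha>" and "b = of_rat \<beta>"
    have ab': "0 \<le> a" "a < b" using ab by (simp_all add: a_def b_def of_rat_less)
    have Vb: "V \<in> sets \<mu>" by (simp add: V_def \<mu>)
    have Es: "E \<alpha> \<beta> n \<in> sets \<mu>"
    proof -
      have "E \<alpha> \<beta> n = {x \<in> space \<mu>. hl_maximal \<mu> h x \<le> ennreal a} \<inter> {x \<in> space \<mu>. b \<le> \<bar>h x\<bar>} \<inter> V"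
        by (auto simp: E_def V_def a_def b_def)
      also have "\<dots> \<in> sets \<mu>" using Vb by measurable
      finally show ?thesis .
    qed
    have EV: "E \<alpha> \<beta> n \<subseteq> V" by (auto simp: E_def V_def)
    have V: "open V" "emeasure \<mu> V < \<infinity>"
      using emeasure_ball_finite[OF X(1,2), of undefined "real n"] by (auto simp: V_def)
    have Efm: "E \<alpha> \<beta> n \<in> fmeasurable \<mu>"
      by (rule fmeasurableI2[OF _ EV Es]) (use V Vb in \<open>simp add: fmeasurable_def\<close>)
    have approx: "b * measure \<mu> (E \<alpha> \<beta> n) \<le> a * measure \<mu> (E \<alpha> \<beta> n) + a * \<epsilon>" if eps: "0 < \<epsilon>" for \<epsilon>
    proof -
      obtain U where U: "open U" "E \<alpha> \<beta> n \<subseteq> U" "U \<subseteq> V" "measure \<mu> U \<le> measure \<mu> (E \<alpha> \<beta> n) + \<epsilon>"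
        using open_outer_approximation[OF \<mu> V _ EV eps] Es by (auto simp: \<mu>)
      have "emeasure \<mu> U \<le> emeasure \<mu> V" using U Vb by (intro emeasure_mono)
      then have "emeasure \<mu> U < \<infinity>" using V(2) by simp
      then have "b * measure \<mu> (E \<alpha> \<beta> n \<inter> U) \<le> a * measure \<mu> U"
        using ab' ab U(1) by (intro superlevel_measure_open_le[OF X Es]) (auto simp: E_def a_def b_def zero_le_of_rat_iff)
      also have "E \<alpha> \<beta> n \<inter> U = E \<alpha> \<beta> n" using U by auto
      also have "a * measure \<mu> U \<le> a * (measure \<mu> (E \<alpha> \<beta> n) + \<epsilon>)"
        using U ab' by (intro mult_left_mono) auto
      finally show ?thesis by (simp add: algebra_simps)
    qed
    have "b * measure \<mu> (E \<alpha> \<beta> n) \<le> a * measure \<mu> (E \<alpha> \<beta> n)"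
    proof (rule field_le_epsilon)
      fix e :: real assume "0 < e"
      then have "b * measure \<mu> (E \<alpha> \<beta> n) \<le> a * measure \<mu> (E \<alpha> \<beta> n) + a * (e / (a + 1))"
        using ab' by (intro approx) simp
      also have "a * (e / (a + 1)) \<le> e" using ab' \<open>0 < e\<close> by (simp add: field_simps)
      finally show "b * measure \<mu> (E \<alpha> \<beta> n) \<le> a * measure \<mu> (E \<alpha> \<beta> n) + e" by simp
    qed
    then have "measure \<mu> (E \<alpha> \<beta> n) = 0"
      using ab' measure_nonneg[of \<mu> "E \<alpha> \<beta> n"] by (metis mult_le_cancel_right not_le order_antisym_conv)
    then have "emeasure \<mu> (E \<alpha> \<beta> n) = 0" using Efm by (simp add: emeasure_eq_measure2)
    then show ?thesis using Es by (intro AE_not_in) (simp add: null_sets_def)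
  qed
  have "AE x in \<mu>. \<forall>\<alpha> \<beta> n. 0 \<le> \<alpha> \<longrightarrow> \<alpha> < \<beta> \<longrightarrow> x \<notin> E \<alpha> \<beta> n"
    unfolding AE_all_countable using null by (intro allI) (metis (mono_tags, lifting) AE_mp AE_I2)
  then show ?thesis
  proof (rule AE_mp, intro AE_I2 impI)
    fix x assume x: "x \<in> space \<mu>" and no: "\<forall>\<alpha> \<beta> n. 0 \<le> \<alpha> \<longrightarrow> \<alpha> < \<beta> \<longrightarrow> x \<notin> E \<alpha> \<beta> n"
    show "ennreal \<bar>h x\<bar> \<le> hl_maximal \<mu> h x"
    proof (rule ccontr)
      assume "\<not> ennreal \<bar>h x\<bar> \<le> hl_maximal \<mu> h x"
      then have less: "hl_maximal \<mu> h x < ennreal \<bar>h x\<bar>" by simp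
      then obtain t where t: "hl_maximal \<mu> h x = ennreal t" "0 \<le> t"
        by (cases "hl_maximal \<mu> h x") auto
      then have "t < \<bar>h x\<bar>" using less by (simp add: ennreal_less_iff)
      then obtain \<beta> where \<beta>: "t < of_rat \<beta>" "of_rat \<beta> < \<bar>h x\<bar>" using of_rat_dense by metis
      then obtain \<alpha> where \<alpha>: "t < of_rat \<alpha>" "of_rat \<alpha> < (of_rat \<beta> :: real)" using of_rat_dense by metis
      obtain n :: nat where n: "dist undefined x < real n" using reals_Archimedean2 by blast
      have "(0::real) < of_rat \<alpha>" using t(2) \<alpha>(1) by linarith
      then have "0 \<le> \<alpha>" "\<alpha> < \<beta>" using \<alpha>(2) by (simp_all add: of_rat_less zero_less_of_rat_iff)
      moreover have "x \<in> E \<alpha> \<beta> n"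
        using x n \<alpha> \<beta> t by (simp add: E_def ennreal_leI)
      ultimately show False using no by blast
    qed
  qed
qed

section \<open>Exponents\<close>

lemma rconj_ennreal: "1 < t \<Longrightarrow> rconj (ennreal t) = t / (t - 1)"
  by (simp add: rconj_def conj_exp_ennreal)

lemma recip_conj_exp:
  assumes "1 \<le> p0"
  shows "recip (conj_exp (ennreal p0)) = 1 - 1 / p0"
proof (cases "p0 = 1")
  case True
  then show ?thesis by (simp add: recip_def conj_exp_one)
next
  case False
  then show ?thesis using assms by (simp add: recip_def conj_exp_ennreal inverse_ennreal field_simps)
qed

text \<open>The role of \<open>r\<close>: it is the exponent for which \<open>(1/p - 1/q0) * (r - 1)\<close> equals \<open>1/p0 - 1/p\<close>. Hence \<open>A_r\<close>
and \<open>A_r'\<close> are the same product, as the next two lemmas state.\<close>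

lemma exponent_relations:
  assumes "1 \<le> p0" "p0 < p" "ennreal p < q0"
  shows "0 \<le> recip q0" "recip q0 < 1 / p" "rconj q0 = 1 / (1 - recip q0)"
    and "(1 / p - recip q0) * (r_exp p0 p q0 - 1) = 1 / p0 - 1 / p" "1 < r_exp p0 p q0"
proof -
  have p: "1 < p" using assms by simp
  have "0 \<le> recip q0 \<and> recip q0 < 1 / p \<and> rconj q0 = 1 / (1 - recip q0) \<and>
    rconj (q0 / ennreal p) = 1 / (1 - p * recip q0)"
  proof (cases q0)
    case (real q)
    then have q: "p < q" using assms p by (simp add: ennreal_less_iff)
    then have "q0 / ennreal p = ennreal (q / p)" using real p by (simp add: divide_ennreal)
    then have *: "rconj (q0 / ennreal p) = (q / p) / (q / p - 1)"
      using q p by (simp add: rconj_ennreal)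
    have **: "rconj q0 = q / (q - 1)" "recip q0 = 1 / q"
      using real q p by (simp_all add: rconj_ennreal recip_def inverse_ennreal inverse_eq_divide)
    show ?thesis unfolding * ** using q p by (auto simp: divide_simps)
  next
    case top
    then have "q0 / ennreal p = \<infinity>" using p by (simp add: divide_ennreal_def ennreal_top_mult inverse_ennreal)
    then have "rconj (q0 / ennreal p) = 1" "rconj q0 = 1" "recip q0 = 0"
      using top conj_exp_infinity by (simp_all add: rconj_def recip_def)
    then show ?thesis using p by simp
  qed
  then show *: "0 \<le> recip q0" "recip q0 < 1 / p" "rconj q0 = 1 / (1 - recip q0)"
    and "(1 / p - recip q0) * (r_exp p0 p q0 - 1) = 1 / p0 - 1 / p" "1 < r_exp p0 p q0"
    using assms p by (auto simp: r_exp_def field_simps)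
qed

lemma A_r_eq:
  assumes "1 \<le> p0" "p0 < p" "ennreal p < q0"
  shows "A_r \<mu> p0 p q0 v u Q
    = avg \<mu> u Q epowr (1 / p0 - 1 / p) * avg \<mu> v Q epowr (1 / p - recip q0)"
  by (simp add: A_r_def exponent_relations[OF assms] mult.commute)

lemma A_r'_eq:
  assumes "1 \<le> p0" "p0 < p" "ennreal p < q0"
  shows "A_r' \<mu> p0 p q0 u v Q
    = avg \<mu> u Q epowr (1 / p0 - 1 / p) * avg \<mu> v Q epowr (1 / p - recip q0)"
proof -
  note rel = exponent_relations[OF assms]
  define r where "r = r_exp p0 p q0"
  have r: "1 < r" "(1 / p - recip q0) * (r - 1) = 1 / p0 - 1 / p" using rel by (auto simp: r_def)
  have e: "1 / rconj (ennreal p) - recip (conj_exp (ennreal p0)) = 1 / p0 - 1 / p"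
    using assms by (simp add: rconj_ennreal recip_conj_exp field_simps)
  have "rconj (ennreal r) - 1 = 1 / (r - 1)"
    using r by (simp add: rconj_ennreal field_simps)
  then have "(1 / p0 - 1 / p) * (rconj (ennreal r) - 1) = 1 / p - recip q0"
    using r(1) by (simp add: r(2)[symmetric])
  then show ?thesis by (simp add: A_r'_def Let_def e flip: r_def)
qed

section \<open>Summability of the bump\<close>

text \<open>By monotonicity, \<open>1 / (t * \<psi> t)\<close> is at least \<open>1 / (2 ^ n * \<psi> (2 ^ n))\<close> on the interval from \<open>2 ^ n / 2\<close> to \<open>2 ^ n\<close>,
whose length is half of \<open>2 ^ n\<close>. For \<open>n = 0\<close> this interval starts at \<open>1/2\<close>.\<close>

lemma dyadic_bump_sum_le:
  fixes \<psi> :: "real \<Rightarrow> real"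
  assumes pos: "\<And>t. 1 / 2 \<le> t \<Longrightarrow> 0 < \<psi> t" and mono: "mono_on {1 / 2..} \<psi>"
    and Z: "(\<integral>\<^sup>+t\<in>{1 / 2..}. ennreal (1 / \<psi> t / t) \<partial>lborel) \<le> ennreal Z" "0 \<le> Z" and "finite I"
  shows "(\<Sum>n\<in>I. 1 / \<psi> (2 ^ n)) \<le> 2 * Z"
proof -
  define J where "J n = {2 ^ n / 2..<2 ^ n :: real}" for n :: nat
  define c where "c n = 1 / (2 ^ n * \<psi> (2 ^ n))" for n :: nat
  have half: "1 / 2 \<le> (2::real) ^ n / 2" for n by simp
  have \<psi>: "0 < \<psi> (2 ^ n)" for n
    by (intro pos order_trans[OF half[of n]]) simp
  have disj: "disjoint_family J"
  proof -
    have "J n \<inter> J m = {}" if "n < m" for n m :: nat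
    proof -
      have "(2::real) * 2 ^ n \<le> 2 ^ m"
        using power_increasing[of "Suc n" m "2::real"] that by simp
      then show ?thesis by (auto simp: J_def)
    qed
    then show ?thesis
      unfolding disjoint_family_on_def by (metis Int_commute linorder_neqE_nat)
  qed
  have pointwise: "(\<Sum>n\<in>I. ennreal (c n) * indicator (J n) t)
      \<le> ennreal (1 / \<psi> t / t) * indicator {1 / 2..} t" for t
  proof (cases "\<exists>n\<in>I. t \<in> J n")
    case True
    then obtain n where n: "n \<in> I" "t \<in> J n" by auto
    then have t: "1 / 2 \<le> t" "t \<le> 2 ^ n"
      using order_trans[OF half[of n], of t] by (simp_all add: J_def)
    have "(\<Sum>m\<in>I. ennreal (c m) * indicator (J m) t) = (\<Sum>m\<in>{n}. ennreal (c m) * indicator (J m) t)"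
      using n disj \<open>finite I\<close>
      by (intro sum.mono_neutral_right) (auto simp: disjoint_family_on_def indicator_def)
    also have "\<dots> = ennreal (c n)" using n by simp
    also have "\<dots> \<le> ennreal (1 / \<psi> t / t)"
    proof -
      have "\<psi> t \<le> \<psi> (2 ^ n)" using mono t by (auto intro!: mono_onD[OF mono])
      then have "\<psi> t * t \<le> \<psi> (2 ^ n) * 2 ^ n"
        using t pos[OF t(1)] \<psi>[of n] by (intro mult_mono) auto
      then have "1 / (\<psi> (2 ^ n) * 2 ^ n) \<le> 1 / (\<psi> t * t)"
        using t pos[OF t(1)] \<psi>[of n] by (intro divide_left_mono mult_pos_pos) auto
      then show ?thesis by (intro ennreal_leI) (simp add: c_def mult.commute)
    qed
    finally show ?thesis using t by simp
  next
    case False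
    then have "(\<Sum>n\<in>I. ennreal (c n) * indicator (J n) t) = 0"
      by (intro sum.neutral) (auto simp: indicator_def)
    then show ?thesis by simp
  qed
  have "ennreal (\<Sum>n\<in>I. 1 / \<psi> (2 ^ n) / 2) = (\<Sum>n\<in>I. ennreal (c n) * emeasure lborel (J n))"
    using \<psi>
    by (subst sum_ennreal[symmetric])
       (auto simp: c_def J_def less_imp_le field_simps simp flip: ennreal_mult intro!: sum.cong arg_cong[where f = ennreal])
  also have "\<dots> = (\<integral>\<^sup>+t. (\<Sum>n\<in>I. ennreal (c n) * indicator (J n) t) \<partial>lborel)"
    by (subst nn_integral_sum) (auto simp: J_def nn_integral_cmult_indicator)
  also have "\<dots> \<le> (\<integral>\<^sup>+t\<in>{1 / 2..}. ennreal (1 / \<psi> t / t) \<partial>lborel)"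
    by (intro nn_integral_mono pointwise)
  also have "\<dots> \<le> ennreal Z" by (rule Z)
  finally have "(\<Sum>n\<in>I. 1 / \<psi> (2 ^ n) / 2) \<le> Z" using Z by (simp add: ennreal_le_iff)
  then have "(\<Sum>n\<in>I. 1 / \<psi> (2 ^ n)) / 2 \<le> Z" unfolding sum_divide_distrib .
  then show ?thesis by simp
qed

section \<open>The entropy of a weight on a cube\<close>

lemma one_le_A_infty:
  fixes \<mu> :: "'a::metric_space measure" and D :: "int \<Rightarrow> 'a set set"
  assumes X: "locally compact (UNIV :: 'a set)" "admissible_measure \<mu>" "dyadic_system D"
    and u[measurable]: "u \<in> borel_measurable \<mu>" and Q[measurable]: "Q \<in> sets \<mu>"
    and "mass \<mu> u Q \<noteq> 0"
  shows "1 \<le> A_infty \<mu> u Q"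
proof (cases "mass \<mu> u Q = \<infinity>")
  case False
  have "mass \<mu> u Q \<le> (\<integral>\<^sup>+x\<in>Q. hl_maximal \<mu> (\<lambda>y. u y * indicator Q y) x \<partial>\<mu>)"
    unfolding mass_def
  proof (rule nn_integral_mono_AE)
    have "AE x in \<mu>. ennreal \<bar>u x * indicator Q x\<bar> \<le> hl_maximal \<mu> (\<lambda>y. u y * indicator Q y) x"
      by (rule AE_le_hl_maximal[OF X]) measurable
    then show "AE x in \<mu>. ennreal (u x) * indicator Q x
        \<le> hl_maximal \<mu> (\<lambda>y. u y * indicator Q y) x * indicator Q x"
    proof (rule AE_mp, intro AE_I2 impI)
      fix x assume "ennreal \<bar>u x * indicator Q x\<bar> \<le> hl_maximal \<mu> (\<lambda>y. u y * indicator Q y) x"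
      then show "ennreal (u x) * indicator Q x
          \<le> hl_maximal \<mu> (\<lambda>y. u y * indicator Q y) x * indicator Q x"
        by (cases "x \<in> Q") (auto intro: order_trans[OF ennreal_leI[OF abs_ge_self]])
    qed
  qed
  then have "mass \<mu> u Q / mass \<mu> u Q \<le> A_infty \<mu> u Q"
    using False by (simp add: A_infty_def divide_right_mono_ennreal)
  moreover have "mass \<mu> u Q / mass \<mu> u Q = 1"
    using False \<open>mass \<mu> u Q \<noteq> 0\<close> by (simp add: ennreal_divide_self less_top)
  ultimately show ?thesis by simp
qed (simp add: A_infty_def)

lemma disjoint_sparse_parts:
  assumes "laminar T"
  shows "disjoint_family_on (\<lambda>Q. Q - \<Union>{Q'\<in>T. Q' \<subset> Q}) T"
proof (unfold disjoint_family_on_def, intro ballI impI)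
  fix Q R assume QR: "Q \<in> T" "R \<in> T" "Q \<noteq> R"
  then consider "Q \<inter> R = {}" | "Q \<subset> R" | "R \<subset> Q" using laminarD(1)[OF assms] by blast
  then show "(Q - \<Union>{Q'\<in>T. Q' \<subset> Q}) \<inter> (R - \<Union>{Q'\<in>T. Q' \<subset> R}) = {}"
    using QR by cases auto
qed

text \<open>The parts \<open>E Q\<close> of the cubes that remain after removing the smaller cubes are disjoint and have at
least half of the measure. On them the maximal function is at least the average over a ball containing \<open>Q\<close>,
which doubling compares with the average over \<open>Q\<close>.\<close>

lemma sum_mass_le_maximal:
  fixes \<mu> :: "'a::metric_space measure" and D :: "int \<Rightarrow> 'a set set"
  assumes X: "locally compact (UNIV :: 'a set)" "admissible_measure \<mu>" "dyadic_system D"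
  obtains L :: real where "0 \<le> L"
    "\<And>u T R. u \<in> borel_measurable \<mu> \<Longrightarrow> finite T \<Longrightarrow> T \<subseteq> cubes D \<Longrightarrow> laminar T \<Longrightarrow>
      (\<And>Q. Q \<in> T \<Longrightarrow> measure \<mu> (\<Union>{Q'\<in>T. Q' \<subset> Q}) \<le> measure \<mu> Q / 2) \<Longrightarrow>
      R \<in> sets \<mu> \<Longrightarrow> (\<And>Q. Q \<in> T \<Longrightarrow> Q \<subseteq> R) \<Longrightarrow>
      (\<Sum>Q\<in>T. mass \<mu> u Q)
        \<le> ennreal L * (\<integral>\<^sup>+x\<in>R. hl_maximal \<mu> (\<lambda>y. u y * indicator R y) x \<partial>\<mu>)"
proof -
  obtain \<delta> C C' :: real where C': "1 \<le> C'" and C: "0 < \<delta>" "0 < C"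
    and geom: "\<And>k Q. Q \<in> D k \<Longrightarrow> \<exists>z \<rho>. 0 < \<rho> \<and> cball z \<rho> \<subseteq> Q \<and> Q \<subseteq> ball z (C * \<delta> powi k) \<and>
        measure \<mu> (ball z (C * \<delta> powi k)) \<le> C' * measure \<mu> (cball z \<rho>)"
    using dyadic_cube_geometry[OF X] by metis
  have \<mu>: "sets \<mu> = sets borel" using X by (simp add: admissible_measure_def)
  have "(\<Sum>Q\<in>T. mass \<mu> u Q)
        \<le> ennreal (2 * C') * (\<integral>\<^sup>+x\<in>R. hl_maximal \<mu> (\<lambda>y. u y * indicator R y) x \<partial>\<mu>)"
    if u: "u \<in> borel_measurable \<mu>" and T: "finite T" "T \<subseteq> cubes D" "laminar T"
      and sparse: "\<And>Q. Q \<in> T \<Longrightarrow> measure \<mu> (\<Union>{Q'\<in>T. Q' \<subset> Q}) \<le> measure \<mu> Q / 2"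
      and R: "R \<in> sets \<mu>" "\<And>Q. Q \<in> T \<Longrightarrow> Q \<subseteq> R" for u T R
  proof -
    define M where "M = hl_maximal \<mu> (\<lambda>y. u y * indicator R y)"
    have M[measurable]: "M \<in> borel_measurable \<mu>"
      unfolding M_def by (rule borel_measurable_hl_maximal[OF \<mu>])
    define E where "E Q = Q - \<Union>{Q'\<in>T. Q' \<subset> Q}" for Q
    have Tfm: "Q \<in> fmeasurable \<mu>" if "Q \<in> T" for Q
      by (rule cube_measure(1)[OF X subsetD[OF T(2) that]])
    have sub_fm: "\<Union>{Q'\<in>T. Q' \<subset> Q} \<in> fmeasurable \<mu>" for Q
      using T(1) Tfm by (intro fmeasurable.finite_Union) auto
    have E: "E Q \<in> fmeasurable \<mu>" "measure \<mu> Q \<le> 2 * measure \<mu> (E Q)" if "Q \<in> T" for Q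
    proof -
      show "E Q \<in> fmeasurable \<mu>"
        unfolding E_def using Tfm[OF that] sub_fm by (rule fmeasurable.Diff)
      have "measure \<mu> (E Q) = measure \<mu> Q - measure \<mu> (\<Union>{Q'\<in>T. Q' \<subset> Q})"
        unfolding E_def
        by (rule measurable_measure_Diff[OF Tfm[OF that] fmeasurableD[OF sub_fm]]) auto
      then show "measure \<mu> Q \<le> 2 * measure \<mu> (E Q)" using sparse[OF that] by simp
    qed
    have "mass \<mu> u Q \<le> ennreal (2 * C') * (\<integral>\<^sup>+x\<in>E Q. M x \<partial>\<mu>)" if Q: "Q \<in> T" for Q
    proof -
      obtain k where "Q \<in> D k" using Q T(2) by (auto simp: cubes_def)
      then obtain z \<rho> where z: "cball z \<rho> \<subseteq> Q" "Q \<subseteq> ball z (C * \<delta> powi k)"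
        "measure \<mu> (ball z (C * \<delta> powi k)) \<le> C' * measure \<mu> (cball z \<rho>)"
        using geom by metis
      define r where "r = C * \<delta> powi k"
      have r: "0 < r" using C by (simp add: r_def zero_less_power_int)
      define A where "A = avg \<mu> (\<lambda>y. \<bar>u y * indicator R y\<bar>) (ball z r)"
      have "measure \<mu> (ball z r) \<le> C' * measure \<mu> Q"
      proof -
        have "measure \<mu> (cball z \<rho>) \<le> measure \<mu> Q"
          using z Tfm[OF Q] by (intro measure_mono_fmeasurable) (simp_all add: \<mu>)
        then show ?thesis using z(3) C' unfolding r_def by (meson mult_left_mono order_trans zero_le_one)
      qed
      also have "\<dots> \<le> C' * (2 * measure \<mu> (E Q))"
        using E(2)[OF Q] C' by (intro mult_left_mono) auto
      finally have ball: "measure \<mu> (ball z r) \<le> 2 * C' * measure \<mu> (E Q)" by simp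
      have "mass \<mu> u Q \<le> (\<integral>\<^sup>+x\<in>ball z r. ennreal \<bar>u x * indicator R x\<bar> \<partial>\<mu>)"
        unfolding mass_def
      proof (intro nn_integral_mono)
        fix x show "ennreal (u x) * indicator Q x
            \<le> ennreal \<bar>u x * indicator R x\<bar> * indicator (ball z r) x"
          using subsetD[OF z(2), of x] subsetD[OF R(2)[OF Q], of x]
          by (cases "x \<in> Q") (simp_all add: ennreal_leI flip: r_def)
      qed
      also have "\<dots> = A * ennreal (measure \<mu> (ball z r))"
        unfolding A_def using r
        by (intro avg_mult_measure[symmetric] measure_ball_pos[OF X(1,2)]
              borel_subset_ball_fmeasurable[OF X(1,2) _ subset_refl]) auto
      also have "\<dots> \<le> A * ennreal (2 * C' * measure \<mu> (E Q))"
        by (intro mult_left_mono ennreal_leI ball) simp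
      also have "\<dots> = ennreal (2 * C') * (A * emeasure \<mu> (E Q))"
        using C' by (simp add: emeasure_eq_measure2[OF E(1)[OF Q]] ennreal_mult mult_ac)
      also have "A * emeasure \<mu> (E Q) = (\<integral>\<^sup>+x. A * indicator (E Q) x \<partial>\<mu>)"
        using E(1)[OF Q] by (simp add: nn_integral_cmult_indicator fmeasurableD)
      also have "\<dots> \<le> (\<integral>\<^sup>+x\<in>E Q. M x \<partial>\<mu>)"
      proof (intro nn_integral_mono)
        fix x
        have "A \<le> M x" if "x \<in> E Q"
        proof -
          have "x \<in> Q" using that by (simp add: E_def)
          then have "x \<in> ball z r" unfolding r_def by (rule subsetD[OF z(2)])
          then show ?thesis unfolding A_def M_def by (rule hl_maximal_ge_avg[OF r])
        qed
        then show "A * indicator (E Q) x \<le> M x * indicator (E Q) x" by (simp add: indicator_def)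
      qed
      finally show ?thesis by (simp add: mult_left_mono)
    qed
    then have "(\<Sum>Q\<in>T. mass \<mu> u Q) \<le> (\<Sum>Q\<in>T. ennreal (2 * C') * (\<integral>\<^sup>+x\<in>E Q. M x \<partial>\<mu>))"
      by (rule sum_mono)
    also have "\<dots> = ennreal (2 * C') * (\<Sum>Q\<in>T. \<integral>\<^sup>+x\<in>E Q. M x \<partial>\<mu>)"
      by (simp add: sum_distrib_left)
    also have "\<dots> \<le> ennreal (2 * C') * (\<integral>\<^sup>+x\<in>R. M x \<partial>\<mu>)"
    proof (intro mult_left_mono sum_nn_integral_disjoint_le)
      show "disjoint_family_on E T"
        using disjoint_sparse_parts[OF T(3)] by (simp add: E_def[abs_def])
      show "E Q \<in> sets \<mu>" if "Q \<in> T" for Q using E(1)[OF that] by (rule fmeasurableD)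
      show "E Q \<subseteq> R" if "Q \<in> T" for Q using R(2)[OF that] by (auto simp: E_def)
    qed (use T R in auto)
    finally show ?thesis by (simp add: M_def)
  qed
  then show ?thesis using that[of "2 * C'"] C' by simp
qed

section \<open>Levels of the averages and the two halves of the sum\<close>

text \<open>The maximum over the cubes above \<open>Q\<close> makes the level monotone under inclusion, which a level of the average
over \<open>Q\<close> alone would not be.\<close>

definition dominating_level :: "'a set set \<Rightarrow> ('a set \<Rightarrow> real) \<Rightarrow> 'a set \<Rightarrow> int" where
  "dominating_level S A Q = \<lfloor>log 2 (Max (A ` {R\<in>S. Q \<subseteq> R}))\<rfloor>"

lemma dominating_level:
  assumes "finite S" "\<And>Q. Q \<in> S \<Longrightarrow> 0 < A Q" "Q \<in> S"
  shows "A Q \<le> 2 powr (dominating_level S A Q + 1)"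
    and "R \<in> S \<Longrightarrow> Q \<subseteq> R \<Longrightarrow> dominating_level S A R \<le> dominating_level S A Q"
    and "Q \<subseteq> \<Union>{R\<in>S. 2 powr dominating_level S A Q \<le> A R}"
proof -
  define F where "F P = A ` {R\<in>S. P \<subseteq> R}" for P
  have F: "finite (F P)" "P \<in> S \<Longrightarrow> A P \<in> F P" "x \<in> F P \<Longrightarrow> 0 < x" for P x
    using assms by (auto simp: F_def)
  have pos: "0 < Max (F P)" if "P \<in> S" for P
    using F(1)[of P] F(2)[OF that] F(3)[of _ P] by (metis Max_in empty_iff)
  have lev: "dominating_level S A P = \<lfloor>log 2 (Max (F P))\<rfloor>" for P
    by (simp add: dominating_level_def F_def)
  have "A Q \<le> Max (F Q)" using F assms(3) by (intro Max_ge) auto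
  also have "\<dots> = 2 powr log 2 (Max (F Q))" using pos[OF assms(3)] by simp
  also have "\<dots> \<le> 2 powr (dominating_level S A Q + 1)" unfolding lev by (intro powr_mono) linarith+
  finally show "A Q \<le> 2 powr (dominating_level S A Q + 1)" .
  show "dominating_level S A R \<le> dominating_level S A Q" if R: "R \<in> S" "Q \<subseteq> R"
  proof -
    have "F R \<subseteq> F Q" using R by (auto simp: F_def)
    then have "Max (F R) \<le> Max (F Q)" using F(1)[of Q] F(2)[OF R(1)] by (intro Max_mono) auto
    then show ?thesis unfolding lev using pos[OF R(1)] by (intro floor_mono) (simp add: log_mono)
  qed
  have "Max (F Q) \<in> F Q" using F(1)[of Q] F(2)[OF assms(3)] by (intro Max_in) auto
  then obtain R where R: "R \<in> S" "Q \<subseteq> R" "Max (F Q) = A R" by (auto simp: F_def)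
  have "2 powr dominating_level S A Q \<le> 2 powr log 2 (Max (F Q))"
    unfolding lev by (intro powr_mono) auto
  also have "\<dots> = A R" using pos[OF assms(3)] R(3) by simp
  finally show "Q \<subseteq> \<Union>{R\<in>S. 2 powr dominating_level S A Q \<le> A R}" using R by auto
qed

text \<open>The two halves \<open>S1\<close> and \<open>S2\<close> cover \<open>S\<close>. Otherwise some \<open>Q\<close> had cubes \<open>R1\<close> and \<open>R2\<close> above it with \<open>l\<close>
unchanged but \<open>k\<close> changed at \<open>R1\<close>, and with \<open>k\<close> unchanged but \<open>l\<close> changed at \<open>R2\<close>; whichever of the two is
larger contradicts the monotonicity of the levels.\<close>

lemma two_sided_sum_le:
  fixes m u v :: "'a measure" and AF AG eu ev :: "'a set \<Rightarrow> real" and \<phi> \<psi> :: "real \<Rightarrow> real"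
    and a b x y \<epsilon> K K' L X Y \<Psi> :: real
  assumes S: "finite S" "laminar S"
    and fm: "\<And>Q. Q \<in> S \<Longrightarrow> Q \<in> fmeasurable m" "\<And>Q. Q \<in> S \<Longrightarrow> Q \<in> fmeasurable u"
      "\<And>Q. Q \<in> S \<Longrightarrow> Q \<in> fmeasurable v"
    and pos: "\<And>Q. Q \<in> S \<Longrightarrow> 0 < measure m Q" "\<And>Q. Q \<in> S \<Longrightarrow> 0 < measure u Q"
      "\<And>Q. Q \<in> S \<Longrightarrow> 0 < measure v Q"
    and sparse: "\<And>Q. Q \<in> S \<Longrightarrow> measure m (\<Union>{Q'\<in>S. Q' \<subset> Q}) \<le> measure m Q / 2"
    and ab: "0 < a" "0 < b" "a + b = 1" and xy: "0 < x" "0 < y"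
    and eps: "0 < \<epsilon>" "\<epsilon> * x < a" "\<epsilon> * y < b"
    and eu: "\<And>Q. Q \<in> S \<Longrightarrow> 1 \<le> eu Q" and ev: "\<And>Q. Q \<in> S \<Longrightarrow> 1 \<le> ev Q"
    and \<psi>: "\<And>s. 1 \<le> s \<Longrightarrow> 0 < \<psi> s" "\<And>s t. 1 \<le> s \<Longrightarrow> s \<le> t \<Longrightarrow> \<psi> s \<le> \<psi> t"
    and \<phi>: "\<And>s. 1 \<le> s \<Longrightarrow> 0 < \<phi> s" "\<And>s t. 1 \<le> s \<Longrightarrow> s \<le> t \<Longrightarrow> \<phi> s \<le> \<phi> t"
    and \<Psi>: "\<And>I. finite I \<Longrightarrow> (\<Sum>n\<in>I. 1 / \<psi> (2 ^ n)) \<le> \<Psi>"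
      "\<And>I. finite I \<Longrightarrow> (\<Sum>n\<in>I. 1 / \<phi> (2 ^ n)) \<le> \<Psi>"
    and bump: "\<And>Q. Q \<in> S \<Longrightarrow> (measure u Q / measure m Q) powr x *
        (measure v Q / measure m Q) powr y * ev Q powr b * \<phi> (ev Q) \<le> K"
      "\<And>Q. Q \<in> S \<Longrightarrow> (measure u Q / measure m Q) powr x *
        (measure v Q / measure m Q) powr y * eu Q powr a * \<psi> (eu Q) \<le> K'"
    and carleson: "\<And>R. R \<in> S \<Longrightarrow> (\<Sum>Q | Q \<in> S \<and> Q \<subseteq> R. measure u Q) \<le> L * eu R * measure u R"
      "\<And>R. R \<in> S \<Longrightarrow> (\<Sum>Q | Q \<in> S \<and> Q \<subseteq> R. measure v Q) \<le> L * ev R * measure v R"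
    and nonneg: "0 \<le> L" "0 \<le> K" "0 \<le> K'"
    and AFG: "\<And>Q. Q \<in> S \<Longrightarrow> 0 < AF Q" "\<And>Q. Q \<in> S \<Longrightarrow> 0 < AG Q"
    and X: "\<And>I. finite I \<Longrightarrow>
      (\<Sum>i\<in>I. 2 powr ((a + x) / a * real_of_int i) * measure u (\<Union>{R\<in>S. 2 powr i \<le> AF R})) \<le> X"
    and Y: "\<And>I. finite I \<Longrightarrow>
      (\<Sum>i\<in>I. 2 powr ((b + y) / b * real_of_int i) * measure v (\<Union>{R\<in>S. 2 powr i \<le> AG R})) \<le> Y"
  shows "(\<Sum>Q\<in>S. AF Q powr (a + x) * AG Q powr (b + y) *
      ((measure u Q / measure m Q) powr (a + x) *
       (measure v Q / measure m Q) powr (b + y) * measure m Q))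
    \<le> 2 powr (1 + x + y) * (2 powr \<epsilon> * sparse_geometric_constant (\<epsilon> * (x + y)) * (2 * \<Psi>) *
        ((2 * L) powr a + (2 * L) powr b)) * (K + K') * (X powr a * Y powr b)"
proof -
  define c where "c = 2 powr \<epsilon> * sparse_geometric_constant (\<epsilon> * (x + y))"
  have c: "0 \<le> c"
    using sparse_geometric_constant(2)[of "\<epsilon> * (x + y)"] eps xy by (simp add: c_def)
  have \<Psi>0: "0 \<le> \<Psi>" using \<Psi>(1)[of "{}"] by simp
  define k l where "k = dominating_level S AF" and "l = dominating_level S AG"
  have k: "AF Q \<le> 2 powr (real_of_int (k Q) + 1)" "R \<in> S \<Longrightarrow> Q \<subseteq> R \<Longrightarrow> k R \<le> k Q"
      "Q \<subseteq> \<Union>{R\<in>S. 2 powr k Q \<le> AF R}"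
    and l: "AG Q \<le> 2 powr (real_of_int (l Q) + 1)" "R \<in> S \<Longrightarrow> Q \<subseteq> R \<Longrightarrow> l R \<le> l Q"
      "Q \<subseteq> \<Union>{R\<in>S. 2 powr l Q \<le> AG R}"
    if "Q \<in> S" for Q R
    using dominating_level[OF S(1) AFG(1) that] dominating_level[OF S(1) AFG(2) that]
    by (auto simp: k_def l_def)
  define \<tau> where "\<tau> Q = (measure u Q / measure m Q) powr (a + x) *
       (measure v Q / measure m Q) powr (b + y) * measure m Q" for Q
  define h where "h Q = 2 powr ((a + x) * k Q) * 2 powr ((b + y) * l Q) * \<tau> Q" for Q
  have h0: "0 \<le> h Q" for Q by (simp add: h_def \<tau>_def)
  define S1 where "S1 = {Q\<in>S. \<forall>R\<in>S. Q \<subseteq> R \<longrightarrow> l Q = l R \<longrightarrow> k Q = k R}"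
  define S2 where "S2 = {Q\<in>S. \<forall>R\<in>S. Q \<subseteq> R \<longrightarrow> k Q = k R \<longrightarrow> l Q = l R}"
  have sub: "S1 \<subseteq> S" "S2 \<subseteq> S" by (auto simp: S1_def S2_def)
  have cover: "S = S1 \<union> S2"
  proof (intro equalityI subsetI)
    fix Q assume Q: "Q \<in> S"
    show "Q \<in> S1 \<union> S2"
    proof (rule ccontr)
      assume "Q \<notin> S1 \<union> S2"
      then obtain R1 R2 where R: "R1 \<in> S" "Q \<subseteq> R1" "l Q = l R1" "k Q \<noteq> k R1"
        "R2 \<in> S" "Q \<subseteq> R2" "k Q = k R2" "l Q \<noteq> l R2"
        using Q by (auto simp: S1_def S2_def)
      have "R1 \<inter> R2 \<noteq> {}" using R laminarD(2)[OF S(2) Q] by auto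
      then consider "R1 \<subseteq> R2" | "R2 \<subseteq> R1" using laminarD(1)[OF S(2) R(1,5)] by blast
      then show False
      proof cases
        case 1
        then show False using k(2)[OF Q R(1,2)] k(2)[OF R(1,5) 1] R by simp
      next
        case 2
        then show False using l(2)[OF Q R(5,6)] l(2)[OF R(5,1) 2] R by simp
      qed
    qed
  qed (use sub in auto)
  define \<Omega>\<^sub>F where "\<Omega>\<^sub>F i = \<Union>{R\<in>S. 2 powr real_of_int i \<le> AF R}" for i
  define \<Omega>\<^sub>G where "\<Omega>\<^sub>G i = \<Union>{R\<in>S. 2 powr real_of_int i \<le> AG R}" for i
  have \<Omega>: "\<Omega>\<^sub>F i \<in> fmeasurable u" "\<Omega>\<^sub>G i \<in> fmeasurable v" for i
    using S fm by (auto simp: \<Omega>\<^sub>F_def \<Omega>\<^sub>G_def intro!: fmeasurable.finite_Union)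
  have sums: "(\<Sum>Q | Q \<in> T \<and> Q \<subseteq> R. measure N Q) \<le> (\<Sum>Q | Q \<in> S \<and> Q \<subseteq> R. measure N Q)"
    if "T \<subseteq> S" for T R and N :: "'a measure"
    using that S(1) by (intro sum_mono2) auto
  have first: "(\<Sum>Q\<in>S1. h Q) \<le> c * (2 * L) powr a * (2 * \<Psi>) * K' * (X powr a * Y powr b)"
    unfolding h_def \<tau>_def c_def
  proof (rule one_sided_sum_le[where e = eu and \<psi> = \<psi> and \<Omega>\<^sub>F = \<Omega>\<^sub>F and \<Omega>\<^sub>G = \<Omega>\<^sub>G])
    show "finite S1" "laminar S1" using sub S by (auto intro: finite_subset laminar_subset)
    fix Q assume Q1: "Q \<in> S1"
    then have Q: "Q \<in> S" using sub by auto
    show "Q \<in> fmeasurable m" "Q \<in> fmeasurable u" "Q \<in> fmeasurable v" "0 < measure m Q"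
      "0 < measure u Q" "0 < measure v Q" "1 \<le> eu Q"
      using fm[OF Q] pos[OF Q] eu[OF Q] by auto
    show "measure m (\<Union>{Q'\<in>S1. Q' \<subset> Q}) \<le> measure m Q / 2"
      by (rule sparse_subset_measure[OF S(1) fm(1) sub(1) Q sparse[OF Q]])
    show "Q \<subseteq> \<Omega>\<^sub>F (k Q)" "Q \<subseteq> \<Omega>\<^sub>G (l Q)"
      unfolding \<Omega>\<^sub>F_def \<Omega>\<^sub>G_def by (rule k(3)[OF Q], rule l(3)[OF Q])
    show "(measure u Q / measure m Q) powr x * (measure v Q / measure m Q) powr y *
        eu Q powr a * \<psi> (eu Q) \<le> K'" by (rule bump(2)[OF Q])
    show "(\<Sum>R | R \<in> S1 \<and> R \<subseteq> Q. measure u R) \<le> L * eu Q * measure u Q"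
      using sums[OF sub(1)] carleson(1)[OF Q] by (rule order_trans)
    show "k Q = k R" if "R \<in> S1" "Q \<subseteq> R" "l Q = l R" for R
      using Q1 that sub by (auto simp: S1_def)
  qed (fact ab xy eps \<psi> \<Psi> nonneg \<Omega> X[folded \<Omega>\<^sub>F_def] Y[folded \<Omega>\<^sub>G_def])+
  have ba: "b + a = 1" using ab by simp
  have second: "(\<Sum>Q\<in>S2. h Q) \<le> c * (2 * L) powr b * (2 * \<Psi>) * K * (Y powr b * X powr a)"
  proof -
    have "(\<Sum>Q\<in>S2. h Q) = (\<Sum>Q\<in>S2. 2 powr ((b + y) * l Q) * 2 powr ((a + x) * k Q) *
      ((measure v Q / measure m Q) powr (b + y) *
       (measure u Q / measure m Q) powr (a + x) * measure m Q))"
      by (simp add: h_def \<tau>_def mult_ac)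
    also have "\<dots> \<le> 2 powr \<epsilon> * sparse_geometric_constant (\<epsilon> * (y + x)) * (2 * L) powr b *
        (2 * \<Psi>) * K * (Y powr b * X powr a)"
    proof (rule one_sided_sum_le[OF _ _ _ _ _ _ _ _ _ _ _ ba, where e = ev and \<psi> = \<phi> and \<Omega>\<^sub>F = \<Omega>\<^sub>G and \<Omega>\<^sub>G = \<Omega>\<^sub>F])
      show "finite S2" "laminar S2" using sub S by (auto intro: finite_subset laminar_subset)
      fix Q assume Q2: "Q \<in> S2"
      then have Q: "Q \<in> S" using sub by auto
      show "Q \<in> fmeasurable m" "Q \<in> fmeasurable v" "Q \<in> fmeasurable u" "0 < measure m Q"
        "0 < measure v Q" "0 < measure u Q" "1 \<le> ev Q"
        using fm[OF Q] pos[OF Q] ev[OF Q] by auto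
      show "measure m (\<Union>{Q'\<in>S2. Q' \<subset> Q}) \<le> measure m Q / 2"
        by (rule sparse_subset_measure[OF S(1) fm(1) sub(2) Q sparse[OF Q]])
      show "Q \<subseteq> \<Omega>\<^sub>G (l Q)" "Q \<subseteq> \<Omega>\<^sub>F (k Q)"
        unfolding \<Omega>\<^sub>F_def \<Omega>\<^sub>G_def by (rule l(3)[OF Q], rule k(3)[OF Q])
      show "(measure v Q / measure m Q) powr y * (measure u Q / measure m Q) powr x *
          ev Q powr b * \<phi> (ev Q) \<le> K" using bump(1)[OF Q] by (simp add: mult_ac)
      show "(\<Sum>R | R \<in> S2 \<and> R \<subseteq> Q. measure v R) \<le> L * ev Q * measure v Q"
        using sums[OF sub(2)] carleson(2)[OF Q] by (rule order_trans)
      show "l Q = l R" if "R \<in> S2" "Q \<subseteq> R" "k Q = k R" for R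
        using Q2 that sub by (auto simp: S2_def)
    qed (fact ab xy eps \<phi> \<Psi> nonneg \<Omega> X[folded \<Omega>\<^sub>F_def] Y[folded \<Omega>\<^sub>G_def])+
    finally show ?thesis by (simp add: c_def add.commute)
  qed
  have "(\<Sum>Q\<in>S. AF Q powr (a + x) * AG Q powr (b + y) * \<tau> Q)
      \<le> (\<Sum>Q\<in>S. 2 powr (1 + x + y) * h Q)"
  proof (rule sum_mono)
    fix Q assume Q: "Q \<in> S"
    have "AF Q powr (a + x) \<le> (2 powr (real_of_int (k Q) + 1)) powr (a + x)"
      using k(1)[OF Q] AFG(1)[OF Q] ab xy by (intro powr_mono2) auto
    moreover have "AG Q powr (b + y) \<le> (2 powr (real_of_int (l Q) + 1)) powr (b + y)"
      using l(1)[OF Q] AFG(2)[OF Q] ab xy by (intro powr_mono2) auto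
    ultimately have "AF Q powr (a + x) * AG Q powr (b + y) * \<tau> Q \<le>
        (2 powr (real_of_int (k Q) + 1)) powr (a + x) * (2 powr (real_of_int (l Q) + 1)) powr (b + y) * \<tau> Q"
      by (intro mult_right_mono mult_mono) (auto simp: \<tau>_def)
    also have "(2 powr (real_of_int (k Q) + 1)) powr (a + x) * (2 powr (real_of_int (l Q) + 1)) powr (b + y)
        = 2 powr (a + b + x + y) * (2 powr ((a + x) * k Q) * 2 powr ((b + y) * l Q))"
      unfolding powr_powr powr_add[symmetric] by (simp add: algebra_simps)
    finally show "AF Q powr (a + x) * AG Q powr (b + y) * \<tau> Q \<le> 2 powr (1 + x + y) * h Q"
      using ab by (simp add: h_def mult_ac)
  qed
  also have "\<dots> = 2 powr (1 + x + y) * (\<Sum>Q\<in>S1 \<union> S2. h Q)"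
    using cover by (simp add: sum_distrib_left)
  also have "\<dots> \<le> 2 powr (1 + x + y) * ((\<Sum>Q\<in>S1. h Q) + (\<Sum>Q\<in>S2. h Q))"
    using sub S(1) h0
    by (intro mult_left_mono, subst sum_Un) (auto intro: finite_subset sum_nonneg)
  also have "\<dots> \<le> 2 powr (1 + x + y) * (c * (2 * \<Psi>) * ((2 * L) powr a + (2 * L) powr b) *
      (K + K') * (X powr a * Y powr b))"
  proof (rule mult_left_mono)
    define W where "W = c * (2 * \<Psi>) * (X powr a * Y powr b)"
    have W: "0 \<le> W" using c \<Psi>0 by (simp add: W_def)
    have "(\<Sum>Q\<in>S1. h Q) + (\<Sum>Q\<in>S2. h Q) \<le> W * ((2 * L) powr a * K') + W * ((2 * L) powr b * K)"
      using first second by (simp add: W_def mult_ac)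
    also have "\<dots> = W * ((2 * L) powr a * K' + (2 * L) powr b * K)" by (simp add: distrib_left)
    also have "\<dots> \<le> W * (((2 * L) powr a + (2 * L) powr b) * (K + K'))"
      using nonneg by (intro mult_left_mono W) (simp add: algebra_simps)
    finally show "(\<Sum>Q\<in>S1. h Q) + (\<Sum>Q\<in>S2. h Q) \<le> c * (2 * \<Psi>) *
        ((2 * L) powr a + (2 * L) powr b) * (K + K') * (X powr a * Y powr b)"
      by (simp only: W_def mult_ac)
  qed simp
  finally show ?thesis by (simp only: \<tau>_def c_def mult_ac)
qed

section \<open>Weights and dual functions\<close>

lemma countable_cubes: "dyadic_system D \<Longrightarrow> countable (cubes D)"
  by (auto simp: dyadic_system_def cubes_def)

lemma laminar_cubes:
  fixes \<mu> :: "'a::metric_space measure" and D :: "int \<Rightarrow> 'a set set"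
  assumes X: "locally compact (UNIV :: 'a set)" "admissible_measure \<mu>" "dyadic_system D"
    and "S \<subseteq> cubes D"
  shows "laminar S"
  unfolding laminar_def
proof (intro conjI ballI notI)
  assume "{} \<in> S"
  then show False using cube_measure(2)[OF X subsetD[OF assms(4)], of "{}"] by simp
next
  fix Q R assume "Q \<in> S" "R \<in> S"
  then have "Q \<in> cubes D" "R \<in> cubes D" using assms(4) by auto
  then show "Q \<inter> R = {} \<or> Q \<subseteq> R \<or> R \<subseteq> Q" using X(3) by (simp add: dyadic_system_def)
qed

lemma sparse_family_subset:
  fixes \<mu> :: "'a::metric_space measure"
  assumes "sets \<mu> = sets borel" "dyadic_system D" "S \<subseteq> cubes D" "sparse_family \<mu> S" "T \<subseteq> S"
  shows "sparse_family \<mu> T"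
  unfolding sparse_family_def
proof
  fix Q assume "Q \<in> T"
  have "{Q'\<in>S. Q' \<subset> Q} \<subseteq> cubes D" using assms(3) by auto
  then have "countable {Q'\<in>S. Q' \<subset> Q}" using countable_cubes[OF assms(2)] countable_subset by metis
  then have "\<Union>{Q'\<in>S. Q' \<subset> Q} \<in> sets \<mu>"
    using assms(1,3) cube_in_borel[OF assms(2)] by (intro sets.countable_Union) auto
  moreover have "\<Union>{Q'\<in>T. Q' \<subset> Q} \<subseteq> \<Union>{Q'\<in>S. Q' \<subset> Q}" using assms(5) by auto
  ultimately have "emeasure \<mu> (\<Union>{Q'\<in>T. Q' \<subset> Q}) \<le> emeasure \<mu> (\<Union>{Q'\<in>S. Q' \<subset> Q})"
    by (intro emeasure_mono)
  also have "\<dots> \<le> emeasure \<mu> Q / 2" using assms(4,5) \<open>Q \<in> T\<close> by (auto simp: sparse_family_def)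
  finally show "emeasure \<mu> (\<Union>{Q'\<in>T. Q' \<subset> Q}) \<le> emeasure \<mu> Q / 2" .
qed

lemma sparse_family_measure:
  assumes "sparse_family \<mu> S" "Q \<in> S" "Q \<in> fmeasurable \<mu>"
  shows "measure \<mu> (\<Union>{Q'\<in>S. Q' \<subset> Q}) \<le> measure \<mu> Q / 2"
proof -
  have "emeasure \<mu> (\<Union>{Q'\<in>S. Q' \<subset> Q}) \<le> emeasure \<mu> Q / 2"
    using assms by (simp add: sparse_family_def)
  also have "\<dots> = ennreal (measure \<mu> Q / 2)"
    by (simp add: emeasure_eq_measure2[OF assms(3)] divide_ennreal flip: ennreal_numeral)
  finally show ?thesis
    unfolding measure_def[of \<mu> "\<Union>{Q'\<in>S. Q' \<subset> Q}"] by (intro enn2real_leI) simp_all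
qed

text \<open>A finite entropy includes that \<open>u\<close> has finite mass on the cube, so that all quantities become real
numbers.\<close>

lemma weight_on_cube:
  fixes \<mu> :: "'a::metric_space measure" and D :: "int \<Rightarrow> 'a set set"
  assumes X: "locally compact (UNIV :: 'a set)" "admissible_measure \<mu>" "dyadic_system D"
    and u: "is_weight \<mu> u" and Q: "Q \<in> cubes D" and fin: "A_infty \<mu> u Q \<noteq> \<infinity>"
  defines "U \<equiv> density \<mu> (\<lambda>x. ennreal (u x))"
  shows "Q \<in> fmeasurable U" "0 < measure U Q" "1 \<le> enn2real (A_infty \<mu> u Q)"
    and "mass \<mu> u Q = ennreal (measure U Q)"
    and "avg \<mu> u Q = ennreal (measure U Q / measure \<mu> Q)"
    and "(\<integral>\<^sup>+x\<in>Q. hl_maximal \<mu> (\<lambda>y. u y * indicator Q y) x \<partial>\<mu>)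
      = ennreal (enn2real (A_infty \<mu> u Q) * measure U Q)"
proof -
  have um[measurable]: "u \<in> borel_measurable \<mu>" and upos: "AE x in \<mu>. 0 < u x"
    using u by (auto simp: is_weight_def)
  note Qm = cube_measure[OF X Q]
  have Qs: "Q \<in> sets \<mu>" using Qm(1) by (rule fmeasurableD)
  have mass: "mass \<mu> u Q = emeasure U Q"
    using Qs by (simp add: mass_def U_def emeasure_density)
  have "mass \<mu> u Q \<noteq> \<infinity>" using fin by (auto simp: A_infty_def)
  then show fm: "Q \<in> fmeasurable U"
    using Qs by (simp add: mass fmeasurable_def U_def less_top)
  have nz: "mass \<mu> u Q \<noteq> 0"
  proof
    assume "mass \<mu> u Q = 0"
    then have "AE x in \<mu>. ennreal (u x) * indicator Q x = 0"
      unfolding mass_def using Qs by (subst (asm) nn_integral_0_iff_AE) auto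
    with upos have "AE x in \<mu>. x \<notin> Q"
    proof (rule AE_mp[OF AE_conjI], intro AE_I2 impI)
      fix x assume "0 < u x \<and> ennreal (u x) * indicator Q x = 0"
      then show "x \<notin> Q" by (auto simp: indicator_def)
    qed
    then have "emeasure \<mu> Q = 0" using Qs by (simp add: AE_iff_measurable[OF Qs] Int_absorb1 sets.sets_into_space Int_def[symmetric] Int_commute cong: conj_cong)
    then show False using Qm(2) by (simp add: measure_def)
  qed
  show mass_eq: "mass \<mu> u Q = ennreal (measure U Q)"
    by (simp add: mass emeasure_eq_measure2[OF fm])
  then show pos: "0 < measure U Q" using nz by (simp add: less_le)
  have "1 \<le> A_infty \<mu> u Q" by (rule one_le_A_infty[OF X um Qs nz])
  then show "1 \<le> enn2real (A_infty \<mu> u Q)"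
    using fin by (cases "A_infty \<mu> u Q") auto
  show "avg \<mu> u Q = ennreal (measure U Q / measure \<mu> Q)"
    using mass_eq Qm by (simp add: avg_def mass_def[symmetric] emeasure_eq_measure2 divide_ennreal)
  have "(\<integral>\<^sup>+x\<in>Q. hl_maximal \<mu> (\<lambda>y. u y * indicator Q y) x \<partial>\<mu>) = A_infty \<mu> u Q * mass \<mu> u Q"
    using nz \<open>mass \<mu> u Q \<noteq> \<infinity>\<close>
    by (simp add: A_infty_def ennreal_divide_times ennreal_times_divide mult_divide_eq_ennreal)
  then show "(\<integral>\<^sup>+x\<in>Q. hl_maximal \<mu> (\<lambda>y. u y * indicator Q y) x \<partial>\<mu>)
      = ennreal (enn2real (A_infty \<mu> u Q) * measure U Q)"
    using fin by (simp add: mass_eq ennreal_mult less_top)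
qed

lemma weight_carleson:
  fixes \<mu> :: "'a::metric_space measure" and D :: "int \<Rightarrow> 'a set set"
  assumes X: "locally compact (UNIV :: 'a set)" "admissible_measure \<mu>" "dyadic_system D"
  obtains L :: real where "0 \<le> L"
    "\<And>u S R. is_weight \<mu> u \<Longrightarrow> (\<And>Q. Q \<in> cubes D \<Longrightarrow> A_infty \<mu> u Q \<noteq> \<infinity>) \<Longrightarrow>
      finite S \<Longrightarrow> S \<subseteq> cubes D \<Longrightarrow> sparse_family \<mu> S \<Longrightarrow> R \<in> S \<Longrightarrow>
      (\<Sum>Q | Q \<in> S \<and> Q \<subseteq> R. measure (density \<mu> (\<lambda>x. ennreal (u x))) Q)
        \<le> L * enn2real (A_infty \<mu> u R) * measure (density \<mu> (\<lambda>x. ennreal (u x))) R"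
proof (rule sum_mass_le_maximal[OF X])
  have \<mu>: "sets \<mu> = sets borel" using X by (simp add: admissible_measure_def)
  fix L :: real
  assume L: "0 \<le> L"
    "\<And>u T R. u \<in> borel_measurable \<mu> \<Longrightarrow> finite T \<Longrightarrow> T \<subseteq> cubes D \<Longrightarrow> laminar T \<Longrightarrow>
      (\<And>Q. Q \<in> T \<Longrightarrow> measure \<mu> (\<Union>{Q'\<in>T. Q' \<subset> Q}) \<le> measure \<mu> Q / 2) \<Longrightarrow>
      R \<in> sets \<mu> \<Longrightarrow> (\<And>Q. Q \<in> T \<Longrightarrow> Q \<subseteq> R) \<Longrightarrow>
      (\<Sum>Q\<in>T. mass \<mu> u Q)
        \<le> ennreal L * (\<integral>\<^sup>+x\<in>R. hl_maximal \<mu> (\<lambda>y. u y * indicator R y) x \<partial>\<mu>)"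
  have "(\<Sum>Q | Q \<in> S \<and> Q \<subseteq> R. measure (density \<mu> (\<lambda>x. ennreal (u x))) Q)
        \<le> L * enn2real (A_infty \<mu> u R) * measure (density \<mu> (\<lambda>x. ennreal (u x))) R"
    if u: "is_weight \<mu> u" and fin: "\<And>Q. Q \<in> cubes D \<Longrightarrow> A_infty \<mu> u Q \<noteq> \<infinity>"
      and S: "finite S" "S \<subseteq> cubes D" "sparse_family \<mu> S" and R: "R \<in> S" for u S R
  proof -
    define U where "U = density \<mu> (\<lambda>x. ennreal (u x))"
    define T where "T = {Q. Q \<in> S \<and> Q \<subseteq> R}"
    have T: "finite T" "T \<subseteq> S" "T \<subseteq> cubes D" using S by (auto simp: T_def)
    have RD: "R \<in> cubes D" using S R by auto
    note facts = weight_on_cube[OF X u _ fin, folded U_def]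
    have "ennreal (\<Sum>Q\<in>T. measure U Q) = (\<Sum>Q\<in>T. mass \<mu> u Q)"
    proof -
      have "mass \<mu> u Q = ennreal (measure U Q)" if "Q \<in> T" for Q
        using subsetD[OF T(3) that] by (intro facts(4))
      then show ?thesis by simp
    qed
    also have "\<dots> \<le> ennreal L * (\<integral>\<^sup>+x\<in>R. hl_maximal \<mu> (\<lambda>y. u y * indicator R y) x \<partial>\<mu>)"
    proof (rule L(2)[OF _ T(1,3) laminar_cubes[OF X T(3)]])
      show "u \<in> borel_measurable \<mu>" using u by (simp add: is_weight_def)
      show "measure \<mu> (\<Union>{Q'\<in>T. Q' \<subset> Q}) \<le> measure \<mu> Q / 2" if "Q \<in> T" for Q
        by (rule sparse_family_measure[OF sparse_family_subset[OF \<mu> X(3) S(2,3) T(2)] that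
              cube_measure(1)[OF X subsetD[OF T(3) that]]])
      show "R \<in> sets \<mu>" using cube_measure(1)[OF X RD] by (rule fmeasurableD)
    qed (simp add: T_def)
    also have "\<dots> = ennreal (L * enn2real (A_infty \<mu> u R) * measure U R)"
      using L(1) facts(6)[OF RD RD] by (simp add: ennreal_mult mult.assoc)
    finally show ?thesis
      using L(1) by (simp add: ennreal_le_iff T_def U_def)
  qed
  then show thesis by (rule that[OF L(1)])
qed

text \<open>The exponent \<open>q / (q - p)\<close> is the one for which \<open>w = u powr (1 - p / q)\<close>.\<close>

lemma dual_weight_substitution:
  fixes f w :: "'a \<Rightarrow> real"
  assumes q: "0 < q" "q < p" and w: "AE x in \<mu>. 0 < w x"
  defines "u \<equiv> (\<lambda>x. w x powr (q / (q - p)))"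
  shows "AE x in \<mu>. u x * (\<bar>f x\<bar> powr q / u x) = \<bar>f x\<bar> powr q"
    and "AE x in \<mu>. u x * (\<bar>f x\<bar> powr q / u x) powr (p / q) = \<bar>f x\<bar> powr p * w x"
proof -
  have 1: "u x * (\<bar>f x\<bar> powr q / u x) = \<bar>f x\<bar> powr q"
    and 2: "u x * (\<bar>f x\<bar> powr q / u x) powr (p / q) = \<bar>f x\<bar> powr p * w x" if "0 < w x" for x
  proof -
    have ux: "0 < u x" using that by (simp add: u_def)
    then show "u x * (\<bar>f x\<bar> powr q / u x) = \<bar>f x\<bar> powr q" by simp
    have "u x * (\<bar>f x\<bar> powr q / u x) powr (p / q) = \<bar>f x\<bar> powr p * (u x powr 1 * u x powr (- (p / q)))"
      using ux q by (simp add: powr_divide powr_powr powr_minus_divide)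
    also have "u x powr 1 * u x powr (- (p / q)) = u x powr ((q - p) / q)"
      unfolding powr_add[symmetric] using q by (simp add: diff_divide_distrib)
    also have "\<dots> = w x"
      using q that by (simp add: u_def powr_powr)
    finally show "u x * (\<bar>f x\<bar> powr q / u x) powr (p / q) = \<bar>f x\<bar> powr p * w x" .
  qed
  show "AE x in \<mu>. u x * (\<bar>f x\<bar> powr q / u x) = \<bar>f x\<bar> powr q" using w by (rule eventually_mono) (rule 1)
  show "AE x in \<mu>. u x * (\<bar>f x\<bar> powr q / u x) powr (p / q) = \<bar>f x\<bar> powr p * w x"
    using w by (rule eventually_mono) (rule 2)
qed

text \<open>The maximal theorem for \<open>|f|^q / u\<close> with respect to \<open>u\<close>, expressed through \<open>f\<close>. It is used with \<open>q = p0\<close> for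
\<open>f\<close> and, with conjugate exponents, for \<open>g\<close>.\<close>

lemma Lp_level_sums:
  fixes \<mu> :: "'a measure" and f w :: "'a \<Rightarrow> real"
  assumes q: "0 < q" "q < p" and w: "w \<in> borel_measurable \<mu>" "AE x in \<mu>. 0 < w x"
    and f: "f \<in> Lp_space \<mu> p w"
  defines "u \<equiv> (\<lambda>x. w x powr (q / (q - p)))"
  defines "U \<equiv> density \<mu> (\<lambda>x. ennreal (u x))"
  defines "J \<equiv> (\<lambda>Q. \<integral>\<^sup>+x\<in>Q. ennreal (\<bar>f x\<bar> powr q) \<partial>\<mu>)"
  assumes T: "finite T" "laminar T" "\<And>Q. Q \<in> T \<Longrightarrow> Q \<in> fmeasurable U"
    "\<And>Q. Q \<in> T \<Longrightarrow> 0 < measure U Q" and "finite I"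
  shows "\<And>Q. Q \<in> T \<Longrightarrow> J Q < \<infinity>"
    and "(\<Sum>i\<in>I. 2 powr (p / q * real_of_int i) *
        measure U (\<Union>{Q\<in>T. 2 powr i \<le> enn2real (J Q) / measure U Q}))
      \<le> level_set_constant (p / q) * enn2real (Lp_norm \<mu> p w f) powr p"
proof -
  have fm[measurable]: "f \<in> borel_measurable \<mu>" and norm: "Lp_norm \<mu> p w f < \<infinity>"
    using f by (auto simp: Lp_space_def)
  note [measurable] = w(1)
  have um[measurable]: "u \<in> borel_measurable \<mu>" unfolding u_def by measurable
  have u0: "0 \<le> u x" for x by (simp add: u_def)
  define F where "F x = \<bar>f x\<bar> powr q / u x" for x
  have F[measurable]: "F \<in> borel_measurable \<mu>" unfolding F_def[abs_def] by measurable
  have F0: "0 \<le> F x" for x using u0 by (simp add: F_def)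
  have FU: "F \<in> borel_measurable U" by (simp add: U_def)
  have \<gamma>: "1 < p / q" using q by simp
  define Z where "Z = enn2real (Lp_norm \<mu> p w f) powr p"
  have intZ: "(\<integral>\<^sup>+x. ennreal (\<bar>f x\<bar> powr p * w x) \<partial>\<mu>) = ennreal Z"
  proof -
    let ?I = "\<integral>\<^sup>+x. ennreal (\<bar>f x\<bar> powr p * w x) \<partial>\<mu>"
    have "?I \<noteq> \<infinity>" using norm by (auto simp: Lp_norm_def epowr_def split: if_splits)
    moreover from this have "Lp_norm \<mu> p w f = ennreal (enn2real ?I powr (1 / p))"
      by (simp add: Lp_norm_def epowr_def)
    ultimately show ?thesis using q by (simp add: Z_def powr_powr less_top)
  qed
  have uF: "AE x in \<mu>. u x * F x = \<bar>f x\<bar> powr q"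
    "AE x in \<mu>. u x * F x powr (p / q) = \<bar>f x\<bar> powr p * w x"
    using dual_weight_substitution[OF q w(2), of f] by (simp_all add: u_def F_def)
  have Z: "(\<integral>\<^sup>+x. ennreal (F x powr (p / q)) \<partial>U) = ennreal Z"
  proof -
    have "(\<integral>\<^sup>+x. ennreal (F x powr (p / q)) \<partial>U) = (\<integral>\<^sup>+x. ennreal (u x) * ennreal (F x powr (p / q)) \<partial>\<mu>)"
      unfolding U_def by (rule nn_integral_density) measurable
    also have "\<dots> = (\<integral>\<^sup>+x. ennreal (\<bar>f x\<bar> powr p * w x) \<partial>\<mu>)"
    proof (rule nn_integral_cong_AE)
      show "AE x in \<mu>. ennreal (u x) * ennreal (F x powr (p / q)) = ennreal (\<bar>f x\<bar> powr p * w x)"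
        using uF(2) by (rule eventually_mono) (simp add: u0 flip: ennreal_mult)
    qed
    finally show ?thesis using intZ by simp
  qed
  have JU: "(\<integral>\<^sup>+x\<in>Q. ennreal (F x) \<partial>U) = J Q" if "Q \<in> T" for Q
  proof -
    have [measurable]: "Q \<in> sets \<mu>" using T(3)[OF that] by (simp add: fmeasurable_def U_def)
    have "(\<integral>\<^sup>+x\<in>Q. ennreal (F x) \<partial>U) = (\<integral>\<^sup>+x. ennreal (u x) * (ennreal (F x) * indicator Q x) \<partial>\<mu>)"
      unfolding U_def by (rule nn_integral_density) measurable
    also have "\<dots> = J Q"
      unfolding J_def
    proof (rule nn_integral_cong_AE)
      show "AE x in \<mu>. ennreal (u x) * (ennreal (F x) * indicator Q x) = ennreal (\<bar>f x\<bar> powr q) * indicator Q x"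
        using uF(1) by (rule eventually_mono) (simp add: u0 F0 mult.assoc[symmetric] flip: ennreal_mult)
    qed
    finally show ?thesis .
  qed
  show fin: "J Q < \<infinity>" if Q: "Q \<in> T" for Q
  proof -
    have Qs: "Q \<in> sets U" "emeasure U Q < \<infinity>" using T(3)[OF Q] by (auto simp: fmeasurable_def)
    have "J Q \<le> (\<integral>\<^sup>+x. indicator Q x + ennreal (F x powr (p / q)) \<partial>U)"
      unfolding JU[OF Q, symmetric]
    proof (intro nn_integral_mono)
      fix x
      \<comment> \<open>Integrability of the larger power and finiteness of \<open>U Q\<close> give integrability of \<open>F\<close> on \<open>Q\<close>.\<close>
      have "F x \<le> 1 + F x powr (p / q)"
      proof (cases "F x \<le> 1")
        case False
        then have "F x powr 1 \<le> F x powr (p / q)" using \<gamma> by (intro powr_mono) auto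
        then show ?thesis using False by simp
      qed (simp add: add_increasing2)
      then have "ennreal (F x) \<le> 1 + ennreal (F x powr (p / q))"
        by (metis ennreal_1 ennreal_leI ennreal_plus powr_ge_zero zero_le_one)
      then show "ennreal (F x) * indicator Q x \<le> indicator Q x + ennreal (F x powr (p / q))"
        by (simp add: indicator_def)
    qed
    also have "\<dots> = emeasure U Q + ennreal Z"
      using Qs FU by (subst nn_integral_add) (auto simp: Z)
    also have "\<dots> < \<infinity>" using Qs by simp
    finally show ?thesis .
  qed
  have "(\<Union>{Q\<in>T. 2 powr real_of_int i \<le> enn2real (J Q) / measure U Q}) = average_level_set U T F i" for i
    unfolding average_level_set_def
  proof (intro arg_cong[where f = Union] Collect_cong conj_cong refl)
    fix Q assume Q: "Q \<in> T"
    have "(2 powr real_of_int i \<le> enn2real (J Q) / measure U Q)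
        \<longleftrightarrow> 2 powr real_of_int i * measure U Q \<le> enn2real (J Q)"
      using T(4)[OF Q] by (simp add: pos_le_divide_eq)
    also have "\<dots> \<longleftrightarrow> ennreal (2 powr real_of_int i * measure U Q) \<le> ennreal (enn2real (J Q))"
      by (simp add: ennreal_le_iff)
    also have "\<dots> \<longleftrightarrow> ennreal (2 powr real_of_int i) * emeasure U Q \<le> (\<integral>\<^sup>+x\<in>Q. ennreal (F x) \<partial>U)"
      using fin[OF Q] by (simp add: JU[OF Q] ennreal_mult emeasure_eq_measure2[OF T(3)[OF Q]])
    finally show "(2 powr real_of_int i \<le> enn2real (J Q) / measure U Q)
      = (ennreal (2 powr real_of_int i) * emeasure U Q \<le> (\<integral>\<^sup>+x\<in>Q. ennreal (F x) \<partial>U))" .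
  qed
  then show "(\<Sum>i\<in>I. 2 powr (p / q * real_of_int i) *
        measure U (\<Union>{Q\<in>T. 2 powr i \<le> enn2real (J Q) / measure U Q}))
      \<le> level_set_constant (p / q) * enn2real (Lp_norm \<mu> p w f) powr p"
    using sum_average_level_sets_le[OF T(1-3) FU F0 \<gamma> \<open>finite I\<close> _ Z]
    by (simp add: Z_def)
qed

section \<open>The sparse form\<close>

lemma epowr_ennreal: "0 \<le> t \<Longrightarrow> ennreal t epowr a = ennreal (t powr a)"
  by (simp add: epowr_def)

text \<open>All quantities are finite here, so the estimate reduces to \<open>two_sided_sum_le\<close> for
real numbers. Cubes on which \<open>f\<close> or \<open>g\<close> vanishes contribute nothing; they are removed first because their
averages have no dyadic level.\<close>

lemma finite_sparse_sum_le:
  fixes \<mu> :: "'a::metric_space measure" and D :: "int \<Rightarrow> 'a set set"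
    and p0 p :: real and q0 :: ennreal and \<phi> \<psi> :: "real \<Rightarrow> real"
  assumes X: "locally compact (UNIV :: 'a set)" "admissible_measure \<mu>" "dyadic_system D"
    and p: "1 \<le> p0" "p0 < p" "ennreal p < q0"
    and \<phi>: "\<And>s. 1 \<le> s \<Longrightarrow> 0 < \<phi> s" "\<And>s t. 1 \<le> s \<Longrightarrow> s \<le> t \<Longrightarrow> \<phi> s \<le> \<phi> t"
    and \<psi>: "\<And>s. 1 \<le> s \<Longrightarrow> 0 < \<psi> s" "\<And>s t. 1 \<le> s \<Longrightarrow> s \<le> t \<Longrightarrow> \<psi> s \<le> \<psi> t"
    and \<Psi>: "\<And>I. finite I \<Longrightarrow> (\<Sum>n\<in>I. 1 / \<psi> (2 ^ n)) \<le> \<Psi>"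
      "\<And>I. finite I \<Longrightarrow> (\<Sum>n\<in>I. 1 / \<phi> (2 ^ n)) \<le> \<Psi>"
  shows "\<exists>C::real. \<forall>S w \<sigma> u v f g.
      finite S \<longrightarrow> S \<subseteq> cubes D \<longrightarrow> sparse_family \<mu> S \<longrightarrow> is_weight \<mu> w \<longrightarrow> is_weight \<mu> \<sigma> \<longrightarrow>
      u = (\<lambda>x. w x powr (p0 / (p0 - p))) \<longrightarrow>
      v = (\<lambda>x. \<sigma> x powr (rconj q0 / (rconj q0 - rconj (ennreal p)))) \<longrightarrow>
      is_weight \<mu> u \<longrightarrow> is_weight \<mu> v \<longrightarrow>
      char_r \<mu> D p0 p q0 \<phi> v u < \<infinity> \<longrightarrow> char_r' \<mu> D p0 p q0 \<psi> u v < \<infinity> \<longrightarrow>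
      f \<in> Lp_space \<mu> p w \<longrightarrow> g \<in> Lp_space \<mu> (rconj (ennreal p)) \<sigma> \<longrightarrow>
      (\<Sum>Q\<in>S. avg \<mu> (\<lambda>x. \<bar>f x\<bar> powr p0) Q epowr (1 / p0) *
              avg \<mu> (\<lambda>x. \<bar>g x\<bar> powr rconj q0) Q epowr (1 / rconj q0) * emeasure \<mu> Q)
        \<le> ennreal C * (char_r \<mu> D p0 p q0 \<phi> v u + char_r' \<mu> D p0 p q0 \<psi> u v) *
          Lp_norm \<mu> p w f * Lp_norm \<mu> (rconj (ennreal p)) \<sigma> g"
proof -
  have \<mu>: "sets \<mu> = sets borel" using X by (simp add: admissible_measure_def)
  note rel = exponent_relations[OF p]
  define q p' where "q = rconj q0" and "p' = rconj (ennreal p)"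
  define a b x y where "a = 1 / p" and "b = 1 - 1 / p" and "x = 1 / p0 - 1 / p" and "y = 1 / p - recip q0"
  have p'_eq: "p' = p / (p - 1)" using p by (simp add: p'_def rconj_ennreal)
  have ab: "0 < a" "0 < b" "a + b = 1" and xy: "0 < x" "0 < y"
  proof -
    have "1 / p < 1 / p0" using p by (intro divide_strict_left_mono) auto
    then show "0 < a" "0 < b" "a + b = 1" "0 < x" "0 < y"
      using p rel(2) by (auto simp: a_def b_def x_def y_def)
  qed
  have sums: "a + x = 1 / p0" "b + y = 1 - recip q0" by (simp_all add: a_def b_def x_def y_def)
  have q1: "0 < 1 - recip q0" using sums(2) ab xy by linarith
  then have q: "0 < q" "1 / q = b + y" using rel(3) by (simp_all add: q_def sums)
  have p'b: "1 / p' = b" using p by (simp add: p'_eq b_def field_simps)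
  have p'0: "0 < p'" using p by (simp add: p'_eq)
  have qp': "q < p'"
  proof -
    have "1 / p' < 1 / q" using p'b q xy by simp
    then show ?thesis using q(1) p'0 by (simp add: field_simps)
  qed
  have ratios: "(a + x) / a = p / p0" "(b + y) / b = p' / q"
  proof -
    have "(a + x) / a = (1 / p0) / a" by (simp only: sums(1))
    also have "\<dots> = p / p0" by (simp add: a_def)
    finally show "(a + x) / a = p / p0" .
    have "(b + y) / b = (1 / q) / (1 / p')" by (simp only: q(2) p'b)
    also have "\<dots> = p' / q" by simp
    finally show "(b + y) / b = p' / q" .
  qed
  \<comment> \<open>Any \<open>\<epsilon> > 0\<close> that keeps the exponents \<open>a - \<epsilon> * x\<close> and \<open>b - \<epsilon> * y\<close> positive would do.\<close>
  define \<epsilon> where "\<epsilon> = min (a / (2 * x)) (b / (2 * y))"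
  have eps: "0 < \<epsilon>" "\<epsilon> * x < a" "\<epsilon> * y < b"
  proof -
    show "0 < \<epsilon>" using ab xy by (simp add: \<epsilon>_def)
    have "\<epsilon> * x \<le> a / (2 * x) * x" using xy by (intro mult_right_mono) (auto simp: \<epsilon>_def)
    also have "\<dots> < a" using ab xy by simp
    finally show "\<epsilon> * x < a" .
    have "\<epsilon> * y \<le> b / (2 * y) * y" using xy by (intro mult_right_mono) (auto simp: \<epsilon>_def)
    also have "\<dots> < b" using ab xy by simp
    finally show "\<epsilon> * y < b" .
  qed
  show ?thesis
  proof (rule weight_carleson[OF X])
    fix L :: real
    assume L: "0 \<le> L"
      "\<And>u S R. is_weight \<mu> u \<Longrightarrow> (\<And>Q. Q \<in> cubes D \<Longrightarrow> A_infty \<mu> u Q \<noteq> \<infinity>) \<Longrightarrow>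
      finite S \<Longrightarrow> S \<subseteq> cubes D \<Longrightarrow> sparse_family \<mu> S \<Longrightarrow> R \<in> S \<Longrightarrow>
      (\<Sum>Q | Q \<in> S \<and> Q \<subseteq> R. measure (density \<mu> (\<lambda>x. ennreal (u x))) Q)
        \<le> L * enn2real (A_infty \<mu> u R) * measure (density \<mu> (\<lambda>x. ennreal (u x))) R"
    define C0 where "C0 = 2 powr (1 + x + y) * (2 powr \<epsilon> * sparse_geometric_constant (\<epsilon> * (x + y)) *
        (2 * \<Psi>) * ((2 * L) powr a + (2 * L) powr b))"
    define WF WG where "WF = level_set_constant (p / p0)" and "WG = level_set_constant (p' / q)"
    \<comment> \<open>\<open>C0\<close> comes from the two-sided estimate, the other factors from the maximal theorems for \<open>F\<close> and \<open>G\<close>.\<close>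
    define C where "C = C0 * (WF powr a * WG powr b)"
    have "0 \<le> \<Psi>" using \<Psi>(1)[of "{}"] by simp
    moreover have "0 < sparse_geometric_constant (\<epsilon> * (x + y))"
      using eps xy by (intro sparse_geometric_constant(2)) simp
    ultimately have "0 \<le> C0" by (simp add: C0_def)
    then have C: "0 \<le> C" by (simp add: C_def)
    have W: "0 \<le> WF" "0 \<le> WG"
      using level_set_constant_pos[of "p / p0"] level_set_constant_pos[of "p' / q"] p q(1) qp'
      by (simp_all add: WF_def WG_def)
    show ?thesis
    proof (intro exI[of _ C] allI impI)
      fix S :: "'a set set" and w \<sigma> u v f g :: "'a \<Rightarrow> real"
      assume S: "finite S" "S \<subseteq> cubes D" "sparse_family \<mu> S"
        and w: "is_weight \<mu> w" "is_weight \<mu> \<sigma>"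
        and u: "u = (\<lambda>x. w x powr (p0 / (p0 - p)))"
        and v: "v = (\<lambda>x. \<sigma> x powr (rconj q0 / (rconj q0 - rconj (ennreal p))))"
        and uv: "is_weight \<mu> u" "is_weight \<mu> v"
        and chars: "char_r \<mu> D p0 p q0 \<phi> v u < \<infinity>" "char_r' \<mu> D p0 p q0 \<psi> u v < \<infinity>"
        and f: "f \<in> Lp_space \<mu> p w" and g: "g \<in> Lp_space \<mu> (rconj (ennreal p)) \<sigma>"
      define K where "K = enn2real (char_r \<mu> D p0 p q0 \<phi> v u)"
      define K' where "K' = enn2real (char_r' \<mu> D p0 p q0 \<psi> u v)"
      have K: "char_r \<mu> D p0 p q0 \<phi> v u = ennreal K" "char_r' \<mu> D p0 p q0 \<psi> u v = ennreal K'"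
          "0 \<le> K" "0 \<le> K'"
        using chars by (simp_all add: K_def K'_def)
      define U where "U = density \<mu> (\<lambda>x. ennreal (u x))"
      define V where "V = density \<mu> (\<lambda>x. ennreal (v x))"
      have bumps: "bumped \<mu> b \<phi> v Q (A_r \<mu> p0 p q0 v u Q) \<le> ennreal K"
          "bumped \<mu> a \<psi> u Q (A_r' \<mu> p0 p q0 u v Q) \<le> ennreal K'" if "Q \<in> cubes D" for Q
        unfolding K(1,2)[symmetric] char_r_def char_r'_def p'b[unfolded p'_def, symmetric] a_def
        using that by (auto intro: SUP_upper)
      have finu: "A_infty \<mu> u Q \<noteq> \<infinity>" and finv: "A_infty \<mu> v Q \<noteq> \<infinity>" if "Q \<in> cubes D" for Q
        using bumps[OF that] by (auto simp: bumped_def top_unique split: if_splits)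
      note uc = weight_on_cube[OF X uv(1) _ finu, folded U_def]
      note vc = weight_on_cube[OF X uv(2) _ finv, folded V_def]
      note mc = cube_measure[OF X]
      have Aeq: "(measure U Q / measure \<mu> Q) powr x * (measure V Q / measure \<mu> Q) powr y *
            enn2real (A_infty \<mu> v Q) powr b * \<phi> (enn2real (A_infty \<mu> v Q)) \<le> K"
        "(measure U Q / measure \<mu> Q) powr x * (measure V Q / measure \<mu> Q) powr y *
            enn2real (A_infty \<mu> u Q) powr a * \<psi> (enn2real (A_infty \<mu> u Q)) \<le> K'"
        if Q: "Q \<in> cubes D" for Q
      proof -
        define A where "A = (measure U Q / measure \<mu> Q) powr x * (measure V Q / measure \<mu> Q) powr y"
        have A0: "0 \<le> A" by (simp add: A_def)
        have A: "A_r \<mu> p0 p q0 v u Q = ennreal A" "A_r' \<mu> p0 p q0 u v Q = ennreal A"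
          unfolding A_r_eq[OF p] A_r'_eq[OF p] x_def[symmetric] y_def[symmetric]
          by (simp_all add: uc(5)[OF Q Q] vc(5)[OF Q Q] epowr_ennreal ennreal_mult A_def)
        have au: "A_infty \<mu> u Q epowr a = ennreal (enn2real (A_infty \<mu> u Q) powr a)"
          and av: "A_infty \<mu> v Q epowr b = ennreal (enn2real (A_infty \<mu> v Q) powr b)"
          using finu[OF Q] finv[OF Q] by (simp_all add: epowr_def)
        have "0 \<le> \<phi> (enn2real (A_infty \<mu> v Q))" "0 \<le> \<psi> (enn2real (A_infty \<mu> u Q))"
          using \<phi>(1)[OF vc(3)[OF Q Q]] \<psi>(1)[OF uc(3)[OF Q Q]] by simp_all
        then have "ennreal (A * enn2real (A_infty \<mu> v Q) powr b * \<phi> (enn2real (A_infty \<mu> v Q))) \<le> ennreal K"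
          "ennreal (A * enn2real (A_infty \<mu> u Q) powr a * \<psi> (enn2real (A_infty \<mu> u Q))) \<le> ennreal K'"
          using bumps[OF Q] finu[OF Q] finv[OF Q] A0
          by (simp_all add: bumped_def A au av ennreal_mult)
        then show "(measure U Q / measure \<mu> Q) powr x * (measure V Q / measure \<mu> Q) powr y *
            enn2real (A_infty \<mu> v Q) powr b * \<phi> (enn2real (A_infty \<mu> v Q)) \<le> K"
        "(measure U Q / measure \<mu> Q) powr x * (measure V Q / measure \<mu> Q) powr y *
            enn2real (A_infty \<mu> u Q) powr a * \<psi> (enn2real (A_infty \<mu> u Q)) \<le> K'"
          using K(3,4) by (simp_all add: A_def ennreal_le_iff)
      qed
      define JF where "JF Q = (\<integral>\<^sup>+x\<in>Q. ennreal (\<bar>f x\<bar> powr p0) \<partial>\<mu>)" for Q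
      define JG where "JG Q = (\<integral>\<^sup>+x\<in>Q. ennreal (\<bar>g x\<bar> powr q) \<partial>\<mu>)" for Q
      have lamS: "laminar T" if "T \<subseteq> S" for T
        using laminar_cubes[OF X] S(2) that by (meson order_trans)
      have SD: "Q \<in> cubes D" if "Q \<in> S" for Q using S(2) that by auto
      have Uw: "U = density \<mu> (\<lambda>x. ennreal (w x powr (p0 / (p0 - p))))"
        and V\<sigma>: "V = density \<mu> (\<lambda>x. ennreal (\<sigma> x powr (q / (q - p'))))"
        by (simp_all add: U_def V_def u v q_def p'_def)
      note levF = Lp_level_sums[of p0 p w \<mu> f, folded Uw JF_def]
      note levG = Lp_level_sums[of q p' \<sigma> \<mu> g, folded V\<sigma> JG_def]
      have wm: "w \<in> borel_measurable \<mu>" "AE x in \<mu>. 0 < w x" "\<sigma> \<in> borel_measurable \<mu>" "AE x in \<mu>. 0 < \<sigma> x"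
        using w by (auto simp: is_weight_def)
      have p0: "0 < p0" using p by simp
      have g': "g \<in> Lp_space \<mu> p' \<sigma>" using g by (simp add: p'_def)
      have finJ: "JF Q < \<infinity>" "JG Q < \<infinity>" if "Q \<in> S" for Q
        using levF(1)[OF p0 p(2) wm(1,2) f S(1) lamS[OF subset_refl], of "{}" Q]
          levG(1)[OF q(1) qp' wm(3,4) g' S(1) lamS[OF subset_refl], of "{}" Q] uc(1,2) vc(1,2) SD that
        by simp_all
      define NF NG where "NF = enn2real (Lp_norm \<mu> p w f)" and "NG = enn2real (Lp_norm \<mu> p' \<sigma> g)"
      have N: "Lp_norm \<mu> p w f = ennreal NF" "Lp_norm \<mu> p' \<sigma> g = ennreal NG" "0 \<le> NF" "0 \<le> NG"
        using f g' by (simp_all add: NF_def NG_def Lp_space_def)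
      define AF where "AF Q = enn2real (JF Q) / measure U Q" for Q
      define AG where "AG Q = enn2real (JG Q) / measure V Q" for Q
      define t where "t Q = AF Q powr (a + x) * AG Q powr (b + y) *
        ((measure U Q / measure \<mu> Q) powr (a + x) *
         (measure V Q / measure \<mu> Q) powr (b + y) * measure \<mu> Q)" for Q
      have summand: "avg \<mu> (\<lambda>x. \<bar>f x\<bar> powr p0) Q epowr (1 / p0) *
              avg \<mu> (\<lambda>x. \<bar>g x\<bar> powr rconj q0) Q epowr (1 / rconj q0) * emeasure \<mu> Q = ennreal (t Q)"
        if Q: "Q \<in> S" for Q
      proof -
        note QD = SD[OF Q]
        have m: "emeasure \<mu> Q = ennreal (measure \<mu> Q)" "0 < measure \<mu> Q"
          using mc[OF QD] by (simp_all add: emeasure_eq_measure2)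
        have pos: "0 < measure U Q" "0 < measure V Q" using uc(2) vc(2) QD by auto
        have "avg \<mu> (\<lambda>x. \<bar>f x\<bar> powr p0) Q = ennreal (AF Q * (measure U Q / measure \<mu> Q))"
          "avg \<mu> (\<lambda>x. \<bar>g x\<bar> powr rconj q0) Q = ennreal (AG Q * (measure V Q / measure \<mu> Q))"
          unfolding avg_def q_def[symmetric] JF_def[symmetric] JG_def[symmetric] AF_def AG_def m(1)
          using finJ[OF Q] m pos by (simp_all flip: divide_ennreal)
        moreover have "t Q = (AF Q * (measure U Q / measure \<mu> Q)) powr (1 / p0) *
            (AG Q * (measure V Q / measure \<mu> Q)) powr (1 / q) * measure \<mu> Q"
          by (simp only: t_def powr_mult q(2) sums(1)[symmetric] mult_ac)
        moreover have "0 \<le> AF Q" "0 \<le> AG Q" by (simp_all add: AF_def AG_def)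
        ultimately show ?thesis
          by (simp add: epowr_ennreal ennreal_mult m(1) flip: q_def)
      qed
      define S' where "S' = {Q\<in>S. 0 < AF Q \<and> 0 < AG Q}"
      have S': "S' \<subseteq> S" "finite S'" using S(1) by (auto simp: S'_def)
      have AF0: "0 \<le> AF Q" "0 \<le> AG Q" for Q by (simp_all add: AF_def AG_def)
      have "(\<Sum>Q\<in>S. t Q) = (\<Sum>Q\<in>S'. t Q)"
      proof (rule sum.mono_neutral_right)
        show "\<forall>Q\<in>S - S'. t Q = 0"
        proof
          fix Q assume "Q \<in> S - S'"
          then have "AF Q = 0 \<or> AG Q = 0" using AF0[of Q] by (auto simp: S'_def less_le)
          then show "t Q = 0" by (auto simp: t_def)
        qed
      qed (use S(1) S' in auto)
      also have "\<dots> \<le> C0 * (K + K') * ((WF * NF powr p) powr a * (WG * NG powr p') powr b)"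
        unfolding t_def C0_def
      proof (rule two_sided_sum_le[where eu = "\<lambda>Q. enn2real (A_infty \<mu> u Q)"
            and ev = "\<lambda>Q. enn2real (A_infty \<mu> v Q)" and \<phi> = \<phi> and \<psi> = \<psi>])
        show "finite S'" "laminar S'" using S' lamS by auto
        have sparse': "sparse_family \<mu> S'" by (rule sparse_family_subset[OF \<mu> X(3) S(2,3) S'(1)])
        have S'D: "S' \<subseteq> cubes D" using S' S by auto
        fix Q assume Q': "Q \<in> S'"
        then have Q: "Q \<in> cubes D" using S'D by auto
        show "Q \<in> fmeasurable \<mu>" "Q \<in> fmeasurable U" "Q \<in> fmeasurable V"
          "0 < measure \<mu> Q" "0 < measure U Q" "0 < measure V Q"
          "1 \<le> enn2real (A_infty \<mu> u Q)" "1 \<le> enn2real (A_infty \<mu> v Q)"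
          by (rule mc[OF Q] uc[OF Q Q] vc[OF Q Q])+
        show "measure \<mu> (\<Union>{Q'\<in>S'. Q' \<subset> Q}) \<le> measure \<mu> Q / 2"
          by (rule sparse_family_measure[OF sparse' Q' mc(1)[OF Q]])
        show "0 < AF Q" "0 < AG Q" using Q' by (auto simp: S'_def)
        show "(\<Sum>R | R \<in> S' \<and> R \<subseteq> Q. measure U R) \<le> L * enn2real (A_infty \<mu> u Q) * measure U Q"
          unfolding U_def by (rule L(2)[OF uv(1) finu S'(2) S'D sparse' Q'])
        show "(\<Sum>R | R \<in> S' \<and> R \<subseteq> Q. measure V R) \<le> L * enn2real (A_infty \<mu> v Q) * measure V Q"
          unfolding V_def by (rule L(2)[OF uv(2) finv S'(2) S'D sparse' Q'])
        show "(measure U Q / measure \<mu> Q) powr x * (measure V Q / measure \<mu> Q) powr y *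
            enn2real (A_infty \<mu> v Q) powr b * \<phi> (enn2real (A_infty \<mu> v Q)) \<le> K"
          "(measure U Q / measure \<mu> Q) powr x * (measure V Q / measure \<mu> Q) powr y *
            enn2real (A_infty \<mu> u Q) powr a * \<psi> (enn2real (A_infty \<mu> u Q)) \<le> K'"
          by (rule Aeq[OF Q])+
      next
        fix I :: "int set" assume I: "finite I"
        have cond: "\<And>Q. Q \<in> S' \<Longrightarrow> Q \<in> fmeasurable U" "\<And>Q. Q \<in> S' \<Longrightarrow> 0 < measure U Q"
          "\<And>Q. Q \<in> S' \<Longrightarrow> Q \<in> fmeasurable V" "\<And>Q. Q \<in> S' \<Longrightarrow> 0 < measure V Q"
          using uc(1,2) vc(1,2) SD S' by auto
        show "(\<Sum>i\<in>I. 2 powr ((a + x) / a * real_of_int i) * measure U (\<Union>{R\<in>S'. 2 powr i \<le> AF R}))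
            \<le> WF * NF powr p"
          unfolding ratios WF_def NF_def AF_def
          by (rule levF(2)[OF p0 p(2) wm(1,2) f S'(2) lamS[OF S'(1)] cond(1,2) I])
        show "(\<Sum>i\<in>I. 2 powr ((b + y) / b * real_of_int i) * measure V (\<Union>{R\<in>S'. 2 powr i \<le> AG R}))
            \<le> WG * NG powr p'"
          unfolding ratios WG_def NG_def AG_def
          by (rule levG(2)[OF q(1) qp' wm(3,4) g' S'(2) lamS[OF S'(1)] cond(3,4) I])
      qed (fact ab xy eps \<phi> \<psi> \<Psi> L(1) K(3,4))+
      also have "\<dots> = C * (K + K') * NF * NG"
      proof -
        have "(WF * NF powr p) powr a = WF powr a * NF" "(WG * NG powr p') powr b = WG powr b * NG"
          using W N(3,4) p p'0 by (simp_all add: powr_mult powr_powr a_def flip: p'b)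
        then show ?thesis by (simp add: C_def)
      qed
      finally have main: "(\<Sum>Q\<in>S. t Q) \<le> C * (K + K') * NF * NG" .
      have t0: "0 \<le> t Q" for Q by (simp add: t_def AF0)
      have "(\<Sum>Q\<in>S. avg \<mu> (\<lambda>x. \<bar>f x\<bar> powr p0) Q epowr (1 / p0) *
              avg \<mu> (\<lambda>x. \<bar>g x\<bar> powr rconj q0) Q epowr (1 / rconj q0) * emeasure \<mu> Q)
          = ennreal (\<Sum>Q\<in>S. t Q)"
        by (simp add: summand t0)
      also have "\<dots> \<le> ennreal (C * (K + K') * NF * NG)" using main by (rule ennreal_leI)
      also have "\<dots> = ennreal C * (ennreal K + ennreal K') * ennreal NF * ennreal NG"
        using C K(3,4) N(3,4) by (simp add: ennreal_mult)
      finally show "(\<Sum>Q\<in>S. avg \<mu> (\<lambda>x. \<bar>f x\<bar> powr p0) Q epowr (1 / p0) *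
              avg \<mu> (\<lambda>x. \<bar>g x\<bar> powr rconj q0) Q epowr (1 / rconj q0) * emeasure \<mu> Q)
        \<le> ennreal C * (char_r \<mu> D p0 p q0 \<phi> v u + char_r' \<mu> D p0 p q0 \<psi> u v) *
          Lp_norm \<mu> p w f * Lp_norm \<mu> (rconj (ennreal p)) \<sigma> g"
        by (simp add: K(1,2) N(1) N(2)[unfolded p'_def])
    qed
  qed
qed

text \<open>The sum over \<open>S\<close> is the supremum of its finite partial sums, and subfamilies of a sparse family are
sparse. An infinite characteristic leaves nothing to prove once the constant is positive.\<close>

theorem theorem1p8:
  fixes \<mu> :: "'a::{metric_space, second_countable_topology} measure"
    and D :: "int \<Rightarrow> 'a set set"
    and p0 p :: real and q0 :: ennreal
    and \<phi> \<psi> :: "real \<Rightarrow> real"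
  assumes "locally compact (UNIV :: 'a set)"
    and "admissible_measure \<mu>"
    and "dyadic_system D"
    and "1 \<le> p0" "p0 < p" "ennreal p < q0"
    and "\<forall>t\<ge>1/2. 0 < \<phi> t" "mono_on {1/2..} \<phi>"
    and "\<forall>t\<ge>1/2. 0 < \<psi> t" "mono_on {1/2..} \<psi>"
    and "(\<integral>\<^sup>+t\<in>{1/2..}. ennreal ((1 / \<phi> t + 1 / \<psi> t) / t) \<partial>lborel) < \<infinity>"
  shows "\<exists>C::real. \<forall>(S :: 'a set set) (w :: 'a \<Rightarrow> real) (\<sigma> :: 'a \<Rightarrow> real).
           S \<subseteq> cubes D \<longrightarrow> sparse_family \<mu> S \<longrightarrow> is_weight \<mu> w \<longrightarrow> is_weight \<mu> \<sigma> \<longrightarrow>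
           (let u = (\<lambda>x. w x powr (p0 / (p0 - p)));
                v = (\<lambda>x. \<sigma> x powr (rconj q0 / (rconj q0 - rconj (ennreal p))))
            in is_weight \<mu> u \<longrightarrow> is_weight \<mu> v \<longrightarrow>
               best_constant \<mu> S p0 p q0 w \<sigma>
                 \<le> ennreal C * (char_r \<mu> D p0 p q0 \<phi> v u + char_r' \<mu> D p0 p q0 \<psi> u v))"
proof -
  have \<mu>: "sets \<mu> = sets borel" using assms(2) by (simp add: admissible_measure_def)
  have \<phi>: "\<And>t. 1 / 2 \<le> t \<Longrightarrow> 0 < \<phi> t" and \<psi>: "\<And>t. 1 / 2 \<le> t \<Longrightarrow> 0 < \<psi> t"
    using assms(7,9) by auto
  define Z where "Z = enn2real (\<integral>\<^sup>+t\<in>{1/2..}. ennreal ((1 / \<phi> t + 1 / \<psi> t) / t) \<partial>lborel)"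
  have Z: "(\<integral>\<^sup>+t\<in>{1/2..}. ennreal ((1 / \<phi> t + 1 / \<psi> t) / t) \<partial>lborel) = ennreal Z" "0 \<le> Z"
    using assms(11) by (simp_all add: Z_def)
  have le: "(\<integral>\<^sup>+t\<in>{1/2..}. ennreal (1 / \<phi> t / t) \<partial>lborel) \<le> ennreal Z"
    "(\<integral>\<^sup>+t\<in>{1/2..}. ennreal (1 / \<psi> t / t) \<partial>lborel) \<le> ennreal Z"
  proof -
    have "1 / \<phi> t / t \<le> (1 / \<phi> t + 1 / \<psi> t) / t" "1 / \<psi> t / t \<le> (1 / \<phi> t + 1 / \<psi> t) / t"
      if "1 / 2 \<le> t" for t
      using that \<phi>[OF that] \<psi>[OF that] by (intro divide_right_mono; simp)+
    then show "(\<integral>\<^sup>+t\<in>{1/2..}. ennreal (1 / \<phi> t / t) \<partial>lborel) \<le> ennreal Z"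
      "(\<integral>\<^sup>+t\<in>{1/2..}. ennreal (1 / \<psi> t / t) \<partial>lborel) \<le> ennreal Z"
      unfolding Z(1)[symmetric]
      by (auto intro!: nn_integral_mono ennreal_leI simp: indicator_def)
  qed
  have \<Psi>: "(\<Sum>n\<in>I. 1 / \<psi> (2 ^ n)) \<le> 2 * Z" "(\<Sum>n\<in>I. 1 / \<phi> (2 ^ n)) \<le> 2 * Z" if "finite I" for I
    using dyadic_bump_sum_le[OF \<psi> assms(10) le(2) Z(2) that]
      dyadic_bump_sum_le[OF \<phi> assms(8) le(1) Z(2) that] by auto
  have mono: "\<phi> s \<le> \<phi> t" "\<psi> s \<le> \<psi> t" if "1 \<le> s" "s \<le> t" for s t
    using that by (auto intro!: mono_onD[OF assms(8)] mono_onD[OF assms(10)])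
  obtain C0 :: real where C0: "\<forall>S w \<sigma> u v f g.
      finite S \<longrightarrow> S \<subseteq> cubes D \<longrightarrow> sparse_family \<mu> S \<longrightarrow> is_weight \<mu> w \<longrightarrow> is_weight \<mu> \<sigma> \<longrightarrow>
      u = (\<lambda>x. w x powr (p0 / (p0 - p))) \<longrightarrow>
      v = (\<lambda>x. \<sigma> x powr (rconj q0 / (rconj q0 - rconj (ennreal p)))) \<longrightarrow>
      is_weight \<mu> u \<longrightarrow> is_weight \<mu> v \<longrightarrow>
      char_r \<mu> D p0 p q0 \<phi> v u < \<infinity> \<longrightarrow> char_r' \<mu> D p0 p q0 \<psi> u v < \<infinity> \<longrightarrow>
      f \<in> Lp_space \<mu> p w \<longrightarrow> g \<in> Lp_space \<mu> (rconj (ennreal p)) \<sigma> \<longrightarrow>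
      (\<Sum>Q\<in>S. avg \<mu> (\<lambda>x. \<bar>f x\<bar> powr p0) Q epowr (1 / p0) *
              avg \<mu> (\<lambda>x. \<bar>g x\<bar> powr rconj q0) Q epowr (1 / rconj q0) * emeasure \<mu> Q)
        \<le> ennreal C0 * (char_r \<mu> D p0 p q0 \<phi> v u + char_r' \<mu> D p0 p q0 \<psi> u v) *
          Lp_norm \<mu> p w f * Lp_norm \<mu> (rconj (ennreal p)) \<sigma> g"
    using finite_sparse_sum_le[OF assms(1-6) \<phi> mono(1) \<psi> mono(2) \<Psi>] by auto
  \<comment> \<open>Positivity makes the right-hand side infinite when a characteristic is.\<close>
  define C where "C = max 1 C0"
  show ?thesis
  proof (rule exI[of _ C], unfold Let_def, intro allI impI)
    fix S :: "'a set set" and w \<sigma> :: "'a \<Rightarrow> real"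
    define u where "u = (\<lambda>x. w x powr (p0 / (p0 - p)))"
    define v where "v = (\<lambda>x. \<sigma> x powr (rconj q0 / (rconj q0 - rconj (ennreal p))))"
    assume S: "S \<subseteq> cubes D" "sparse_family \<mu> S" and w: "is_weight \<mu> w" "is_weight \<mu> \<sigma>"
      and "is_weight \<mu> (\<lambda>x. w x powr (p0 / (p0 - p)))"
        "is_weight \<mu> (\<lambda>x. \<sigma> x powr (rconj q0 / (rconj q0 - rconj (ennreal p))))"
    then have uv: "is_weight \<mu> u" "is_weight \<mu> v" by (simp_all add: u_def v_def)
    define B where "B = char_r \<mu> D p0 p q0 \<phi> v u + char_r' \<mu> D p0 p q0 \<psi> u v"
    have "best_constant \<mu> S p0 p q0 w \<sigma> \<le> ennreal C * B"
    proof (cases "B = \<infinity>")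
      case True
      then show ?thesis by (simp add: C_def ennreal_mult_top)
    next
      case False
      then have chars: "char_r \<mu> D p0 p q0 \<phi> v u < \<infinity>" "char_r' \<mu> D p0 p q0 \<psi> u v < \<infinity>"
        by (auto simp: B_def less_top)
      show ?thesis
        unfolding best_constant_def
      proof (intro Inf_lower CollectI ballI)
        fix f g
        assume fg: "f \<in> Lp_space \<mu> p w" "g \<in> Lp_space \<mu> (rconj (ennreal p)) \<sigma>"
        show "sparse_form \<mu> S p0 (rconj q0) f g
            \<le> ennreal C * B * Lp_norm \<mu> p w f * Lp_norm \<mu> (rconj (ennreal p)) \<sigma> g"
          unfolding sparse_form_def
        proof (subst nonneg_infsum_complete, simp, intro SUP_least)
          fix T assume "T \<in> {F. finite F \<and> F \<subseteq> S}"
          then have T: "finite T" "T \<subseteq> S" by auto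
          let ?s = "\<lambda>Q. avg \<mu> (\<lambda>x. \<bar>f x\<bar> powr p0) Q epowr (1 / p0) *
              avg \<mu> (\<lambda>x. \<bar>g x\<bar> powr rconj q0) Q epowr (1 / rconj q0) * emeasure \<mu> Q"
          have "(\<Sum>Q\<in>T. ?s Q)
            \<le> ennreal C0 * B * Lp_norm \<mu> p w f * Lp_norm \<mu> (rconj (ennreal p)) \<sigma> g"
            unfolding B_def
            by (rule C0[rule_format, OF T(1) order_trans[OF T(2) S(1)]
                  sparse_family_subset[OF \<mu> assms(3) S T(2)] w u_def v_def uv chars fg])
          also have "\<dots> \<le> ennreal C * B * Lp_norm \<mu> p w f * Lp_norm \<mu> (rconj (ennreal p)) \<sigma> g"
            by (intro mult_right_mono ennreal_leI) (auto simp: C_def)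
          finally show "(\<Sum>Q\<in>T. ?s Q)
            \<le> ennreal C * B * Lp_norm \<mu> p w f * Lp_norm \<mu> (rconj (ennreal p)) \<sigma> g" .
        qed
      qed
    qed
    then show "best_constant \<mu> S p0 p q0 w \<sigma>
        \<le> ennreal C * (char_r \<mu> D p0 p q0 \<phi> (\<lambda>x. \<sigma> x powr (rconj q0 / (rconj q0 - rconj (ennreal p))))
              (\<lambda>x. w x powr (p0 / (p0 - p))) +
            char_r' \<mu> D p0 p q0 \<psi> (\<lambda>x. w x powr (p0 / (p0 - p)))
              (\<lambda>x. \<sigma> x powr (rconj q0 / (rconj q0 - rconj (ennreal p)))))"
      unfolding B_def u_def v_def .
  qed
qed

end
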